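(* Let $F$ be a field containing $\mathbb{F}_q$ ($q$ a prime power), let $b\in F$, and let $L(x)=x^{q^2}+bx^q+x\in F[x]$ with $L(x)/x$ irreducible over $F$. Let $G$ be the Galois group of $L$ over $F$. If $q\notin\{2,3,5,7,11\}$, then $G\cong SL(2,q)$. In the exceptional cases: (1) if $q=2$, $G$ is cyclic of order $3$ or $G\cong SL(2,2)$; (2) if $q=3$, $G$ is the quaternion group of order $8$ or $G\cong SL(2,3)$; (3) if $q=5$, $G\cong SL(2,3)$ or $G\cong SL(2,5)$; (4) if $q=7$, $G$ is the binary octahedral group of order $48$ (a double cover of the symmetric group $S_4$ with generalized quaternion Sylow $2$-subgroup) or $G\cong SL(2,7)$; (5) if $q=11$, $G\cong SL(2,5)$ or $G\cong SL(2,11)$. Moreover, for each $q\in\{2,3,5,7,11\}$, the listed group other than $SL(2,q)$ occurs as $G$ for a suitable field $F$ and such an $L$; specifically $F$ can be taken to be an extension field of degree $q$ of the rational function field $\mathbb{F}_q(t)$.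
   Context: The Galois group of $L$ over $F$ is the Galois group of a splitting field of $L$ over $F$. *)

theory Defs
  imports "HOL-Computational_Algebra.Polynomial" "HOL-Library.Numeral_Type"
          "HOL-Algebra.Elementary_Groups"
begin

(* Fields are modelled as subfields of an algebraically closed field 'c
   (every field embeds into one); splitting fields are taken inside 'c. *)

definition is_subfield :: "'c::field set \<Rightarrow> bool" where
  "is_subfield K \<longleftrightarrow> 0 \<in> K \<and> 1 \<in> K \<and>
     (\<forall>x\<in>K. \<forall>y\<in>K. x + y \<in> K \<and> x * y \<in> K) \<and>
     (\<forall>x\<in>K. - x \<in> K) \<and> (\<forall>x\<in>K. x \<noteq> 0 \<longrightarrow> inverse x \<in> K)"

definition gen_field :: "'c::field set \<Rightarrow> 'c set" where
  "gen_field S = \<Inter>{K. is_subfield K \<and> S \<subseteq> K}"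

(* the subfield F_q of a field of characteristic p, q = p^n:
   the set of roots of x^q - x *)
definition Fq :: "nat \<Rightarrow> 'c::field set" where
  "Fq q = {x. x ^ q = x}"

definition poly_over :: "'c::field set \<Rightarrow> 'c poly \<Rightarrow> bool" where
  "poly_over F p \<longleftrightarrow> (\<forall>i. coeff p i \<in> F)"

definition irreducible_over :: "'c::field set \<Rightarrow> 'c poly \<Rightarrow> bool" where
  "irreducible_over F p \<longleftrightarrow> poly_over F p \<and> degree p > 0 \<and>
     (\<forall>g h. poly_over F g \<and> poly_over F h \<and> p = g * h \<longrightarrow> degree g = 0 \<or> degree h = 0)"

definition Lpoly :: "nat \<Rightarrow> 'c::field \<Rightarrow> 'c poly" where
  "Lpoly q b = monom 1 (q ^ 2) + monom b q + monom 1 1"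

definition splitting_field :: "'c::alg_closed_field set \<Rightarrow> 'c poly \<Rightarrow> 'c set" where
  "splitting_field F p = gen_field (F \<union> {x. poly p x = 0})"

definition aut_group :: "'c::field set \<Rightarrow> 'c set \<Rightarrow> ('c \<Rightarrow> 'c) monoid" where
  "aut_group K F = \<lparr> carrier = {\<sigma>. bij_betw \<sigma> K K \<and>
        (\<forall>x\<in>K. \<forall>y\<in>K. \<sigma> (x + y) = \<sigma> x + \<sigma> y \<and> \<sigma> (x * y) = \<sigma> x * \<sigma> y) \<and>
        (\<forall>x\<in>F. \<sigma> x = x) \<and> (\<forall>x. x \<notin> K \<longrightarrow> \<sigma> x = x)},
      monoid.mult = (\<lambda>\<sigma> \<tau>. \<sigma> \<circ> \<tau>), one = id \<rparr>"

definition galois_group :: "'c::alg_closed_field set \<Rightarrow> 'c poly \<Rightarrow> ('c \<Rightarrow> 'c) monoid" where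
  "galois_group F p = aut_group (splitting_field F p) F"

definition SL2 :: "'k::comm_ring_1 set \<Rightarrow> ('k \<times> 'k \<times> 'k \<times> 'k) monoid" where
  "SL2 k = \<lparr> carrier = {(a,b,c,d). a \<in> k \<and> b \<in> k \<and> c \<in> k \<and> d \<in> k \<and> a * d - b * c = 1},
      monoid.mult = (\<lambda>(a,b,c,d) (a',b',c',d').
          (a*a' + b*c', a*b' + b*d', c*a' + d*c', c*b' + d*d')),
      one = (1,0,0,1) \<rparr>"

(* real quaternions a + b i + c j + d k as 4-tuples, Hamilton product *)
definition qmult :: "real \<times> real \<times> real \<times> real \<Rightarrow> real \<times> real \<times> real \<times> real \<Rightarrow> real \<times> real \<times> real \<times> real" where
  "qmult = (\<lambda>(a1,b1,c1,d1) (a2,b2,c2,d2).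
     (a1*a2 - b1*b2 - c1*c2 - d1*d2,
      a1*b2 + b1*a2 + c1*d2 - d1*c2,
      a1*c2 - b1*d2 + c1*a2 + d1*b2,
      a1*d2 + b1*c2 - c1*b2 + d1*a2))"

(* quaternion group Q8 = {+-1, +-i, +-j, +-k} *)
definition quaternion_group :: "(real \<times> real \<times> real \<times> real) monoid" where
  "quaternion_group = \<lparr> carrier = {(a,b,c,d). sort [\<bar>a\<bar>,\<bar>b\<bar>,\<bar>c\<bar>,\<bar>d\<bar>] = [0,0,0,1]},
      monoid.mult = qmult, one = (1,0,0,0) \<rparr>"

(* binary octahedral group (order 48): the unit quaternions
   +-1,+-i,+-j,+-k, (+-1+-i+-j+-k)/2, and (+-u+-v)/sqrt 2 for distinct u,v in {1,i,j,k} *)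
definition binary_octahedral_group :: "(real \<times> real \<times> real \<times> real) monoid" where
  "binary_octahedral_group = \<lparr> carrier = {(a,b,c,d).
        sort [\<bar>a\<bar>,\<bar>b\<bar>,\<bar>c\<bar>,\<bar>d\<bar>] \<in>
          {[0,0,0,1], [1/2,1/2,1/2,1/2], [0,0,1/sqrt 2,1/sqrt 2]}},
      monoid.mult = qmult, one = (1,0,0,0) \<rparr>"

definition ext_degree_is :: "'c::field set \<Rightarrow> 'c set \<Rightarrow> nat \<Rightarrow> bool" where
  "ext_degree_is F E n \<longleftrightarrow> (\<exists>B. finite B \<and> card B = n \<and> B \<subseteq> F \<and>
     (\<forall>c. (\<forall>v\<in>B. c v \<in> E) \<and> (\<Sum>v\<in>B. c v * v) = 0 \<longrightarrow> (\<forall>v\<in>B. c v = 0)) \<and>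
     (\<forall>x\<in>F. \<exists>c. (\<forall>v\<in>B. c v \<in> E) \<and> x = (\<Sum>v\<in>B. c v * v)))"

definition transcendental_over :: "'c::field set \<Rightarrow> 'c \<Rightarrow> bool" where
  "transcendental_over E t \<longleftrightarrow> (\<forall>P. poly_over E P \<and> P \<noteq> 0 \<longrightarrow> poly P t \<noteq> 0)"

definition occurs_over_rational_function_field :: "nat \<Rightarrow> ('g, 'x) monoid_scheme \<Rightarrow> 'c::alg_closed_field itself \<Rightarrow> bool" where
  "occurs_over_rational_function_field q H _ \<longleftrightarrow>
     (\<exists>(t::'c) F b. transcendental_over (Fq q) t \<and> is_subfield F \<and>
        gen_field (Fq q \<union> {t}) \<subseteq> F \<and> ext_degree_is F (gen_field (Fq q \<union> {t})) q \<and>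
        b \<in> F \<and> irreducible_over F (Lpoly q b div [:0,1:]) \<and>
        galois_group F (Lpoly q b) \<cong> H)"

end

theory Submission
  imports Defs "HOL-Number_Theory.Cong"
begin

text \<open>
  The roots of \<open>L\<close> form a plane over \<open>k = F\<^sub>q\<close> on which \<open>G\<close> acts linearly. The form \<open>x y\<^sup>q - x\<^sup>q y\<close> on it has
  values in \<open>k\<close>, so \<open>G\<close> is a subgroup of \<open>SL(2,q)\<close>, transitive on nonzero vectors as \<open>L(x)/x\<close> is irreducible.
  The transvections in \<open>G\<close> fixing a vector form an additive group stable under multiplication by squares; hence
  either \<open>G = SL(2,q)\<close> or \<open>G\<close> is regular on nonzero vectors.

  If \<open>G\<close> is regular and \<open>q > 3\<close>, then in a suitable basis \<open>G\<close> contains all diagonal and antidiagonal matrices of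
  determinant 1, and for the other matrices \<open>(x,z,y,w)\<close> in \<open>G\<close> the product \<open>x w\<close> depends only on the square class
  of \<open>x y\<close>. Multiplying such matrices shows that \<open>q\<close> is 5, 7 or 11 and determines the two values, so \<open>G\<close> is
  unique up to conjugation. It is therefore isomorphic to any group with an embedding in \<open>SL(2,q)\<close> of order
  \<open>q\<^sup>2 - 1\<close>, such as the listed one.

  For the converse, take \<open>u\<close> transcendental and let \<open>t\<close> be the coefficient for which \<open>u\<close> is a root of
  \<open>x^(q^2) + t x^q + x\<close>. Over \<open>F\<^sub>q(t)\<close> the Galois group is \<open>SL(2,q)\<close>, and the fixed field of the exceptional
  subgroup has degree \<open>q\<close>.
\<close>

section \<open>Finite fields and two-by-two matrices\<close>

text \<open>First columns replace the general list of subgroups of SL(2,q). In a regular group a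
  matrix is determined by its first column, so equal first columns mean equal matrices; this yields
  the diagonal matrices and forbids trace 2 except for the identity. The dichotomy between full and
  regular also gives maximality: a proper subgroup containing a regular one equals it. Hence a
  single element moved by something outside H suffices to generate the fixed field of H, and its
  degree is q because SL(2,q) = U H, where U is the group of the q unipotent matrices fixing a
  vector. The bounds on q are root counts: every nonzero element of k is a root of an explicit
  polynomial of degree 4 or 10. In the second case -1 is a nonsquare, which leaves only 7 and 11.
  Order and embedding suffice to recognise a regular group because q^2 - 1 is prime to p, so that no
  transvection has a place in it. Over the field generated by t, irreducibility of L(x)/x comes from
  its being linear in t, and the regular alternative fails because the second basis vector v of the
  root space is not a rational function of u.\<close>

lemma card_roots_separable:
  fixes P :: "'c::alg_closed_field poly"
  assumes "P \<noteq> 0" and sep: "\<And>x. poly P x = 0 \<Longrightarrow> poly (pderiv P) x \<noteq> 0"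
  shows "card {x. poly P x = 0} = degree P"
proof -
  obtain A where A: "size A = degree P" "P = smult (lead_coeff P) (\<Prod>x\<in>#A. [:-x, 1:])"
    using alg_closed_imp_factorization[OF assms(1)] by blast
  \<comment> \<open>A repeated linear factor would make \<open>x\<close> a common root of
    \<open>P\<close> and its derivative.\<close>
  have "count A x \<le> 1" for x
  proof (rule ccontr)
    assume "\<not> count A x \<le> 1"
    then have "{#x, x#} \<subseteq># A"
      by (auto simp: subseteq_mset_def count_greater_zero_iff)
    then obtain B where "A = {#x, x#} + B" using subset_mset.le_iff_add by blast
    then have "P = [:-x, 1:] * ([:-x, 1:] * smult (lead_coeff P) (\<Prod>x\<in>#B. [:-x, 1:]))"
      using A(2) by (simp add: mult_ac)
    then obtain Q where Q: "P = [:-x, 1:] * ([:-x, 1:] * Q)" by blast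
    have "poly P x = 0" "poly (pderiv P) x = 0"
      unfolding Q by (simp_all add: pderiv_mult del: mult_pCons_left)
    with sep show False by blast
  qed
  then have "A = mset_set (set_mset A)"
    by (intro multiset_eqI) (metis One_nat_def count_eq_zero_iff count_mset_set(1,3)
        finite_set_mset le_antisym less_one linorder_not_le not_less_eq_eq)
  then have "size A = card (set_mset A)"
    by (metis size_mset_set)
  moreover have "{x. poly P x = 0} = set_mset A"
  proof -
    have "poly P x = 0 \<longleftrightarrow> x \<in># A" for x
      using assms(1) by (subst A(2)) (auto simp: poly_prod_mset prod_mset_zero_iff)
    then show ?thesis by blast
  qed
  ultimately show ?thesis using A(1) by simp
qed

definition mmul :: "'a::comm_ring_1 \<times> 'a \<times> 'a \<times> 'a \<Rightarrow> 'a \<times> 'a \<times> 'a \<times> 'a \<Rightarrow> 'a \<times> 'a \<times> 'a \<times> 'a"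
  where "mmul = (\<lambda>(a,b,c,d) (a',b',c',d').
    (a*a' + b*c', a*b' + b*d', c*a' + d*c', c*b' + d*d'))"

text \<open>The adjugate, which is the inverse for determinant 1 and needs no division.\<close>

definition madj :: "'a::comm_ring_1 \<times> 'a \<times> 'a \<times> 'a \<Rightarrow> 'a \<times> 'a \<times> 'a \<times> 'a"
  where "madj = (\<lambda>(a,b,c,d). (d,-b,-c,a))"

lemma mmul_simp [simp]: "mmul (a,b,c,d) (a',b',c',d') =
    (a*a' + b*c', a*b' + b*d', c*a' + d*c', c*b' + d*d')"
  by (simp add: mmul_def)

lemma madj_simp [simp]: "madj (a,b,c,d) = (d,-b,-c,a)"
  by (simp add: madj_def)

lemma mmul_assoc: "mmul (mmul A B) C = mmul A (mmul B C)"
  by (cases A; cases B; cases C) (simp add: algebra_simps)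

lemma mult_SL2 [simp]: "monoid.mult (SL2 k) = mmul"
  by (simp add: SL2_def mmul_def)

lemma carrier_SL2 [simp]: "(a,b,c,d) \<in> carrier (SL2 k) \<longleftrightarrow>
    a \<in> k \<and> b \<in> k \<and> c \<in> k \<and> d \<in> k \<and> a * d - b * c = 1"
  by (simp add: SL2_def)

lemma one_SL2 [simp]: "one (SL2 k) = (1,0,0,1)"
  by (simp add: SL2_def)

locale finite_subfield =
  fixes p n q :: nat and k :: "'c::alg_closed_field set"
  assumes prime_p: "prime p" and n_pos: "n > 0" and q_eq: "q = p ^ n"
    and char_p: "CHAR('c) = p" and k_eq: "k = Fq q"
begin

lemma k_iff: "x \<in> k \<longleftrightarrow> x ^ q = x"
  by (simp add: k_eq Fq_def)

lemma q_gt_1: "q > 1"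
  using prime_p n_pos q_eq by (metis one_less_power prime_gt_1_nat)

lemma frob_add: "(x + y :: 'c) ^ q = x ^ q + y ^ q"
  using freshmans_dream'[where 'a='c] prime_p char_p q_eq by blast

lemma of_nat_p [simp]: "of_nat p = (0 :: 'c)"
  using char_p of_nat_CHAR by blast

lemma frob_minus: "(- x :: 'c) ^ q = - (x ^ q)"
  using frob_add[of x "-x"] q_gt_1 by (simp add: power_0_left eq_neg_iff_add_eq_0 add.commute)

lemma frob_diff: "(x - y :: 'c) ^ q = x ^ q - y ^ q"
  using frob_add[of x "-y"] by (simp add: frob_minus)

lemma k_closed [simp, intro]:
  "0 \<in> k" "1 \<in> k" "x \<in> k \<Longrightarrow> y \<in> k \<Longrightarrow> x + y \<in> k" "x \<in> k \<Longrightarrow> y \<in> k \<Longrightarrow> x * y \<in> k"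
  "x \<in> k \<Longrightarrow> - x \<in> k" "x \<in> k \<Longrightarrow> y \<in> k \<Longrightarrow> x - y \<in> k" "x \<in> k \<Longrightarrow> inverse x \<in> k"
  "x \<in> k \<Longrightarrow> y \<in> k \<Longrightarrow> x / y \<in> k" "x \<in> k \<Longrightarrow> x ^ m \<in> k"
  using q_gt_1 by (auto simp: k_iff frob_add frob_minus frob_diff power_mult_distrib power_inverse
      power_divide power_0_left simp flip: power_mult) (metis mult.commute power_mult)

lemma of_nat_k [simp, intro]: "of_nat m \<in> k"
  by (induction m) auto

lemma numeral_k [simp, intro]: "numeral m \<in> k"
  by (metis of_nat_k of_nat_numeral)

text \<open>In characteristic p the polynomial x^q - x has derivative -1, so its q roots are
  distinct.\<close>

lemma card_k: "card k = q" and finite_k: "finite k"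
proof -
  let ?P = "monom 1 q - monom 1 1 :: 'c poly"
  have deg: "degree ?P = q" and nz: "?P \<noteq> 0"
  proof -
    have "degree ?P = degree (monom (1::'c) q)"
      using q_gt_1 degree_add_eq_left[of "- monom (1::'c) 1" "monom 1 q"]
      by (simp add: degree_monom_eq)
    then show "degree ?P = q" by (simp add: degree_monom_eq)
    then show "?P \<noteq> 0" using q_gt_1 by force
  qed
  have k: "k = {x. poly ?P x = 0}"
    by (auto simp: k_iff poly_monom)
  have "(of_nat q :: 'c) = 0"
    using q_eq n_pos by (simp add: of_nat_power power_0_left)
  then have "poly (pderiv ?P) x \<noteq> 0" for x
    by (simp add: pderiv_diff pderiv_monom poly_monom)
  then show "card k = q"
    using card_roots_separable[of ?P] nz deg k by simp
  then show "finite k" using q_gt_1 card.infinite by force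
qed

lemma k_pow: "x \<in> k \<Longrightarrow> x \<noteq> 0 \<Longrightarrow> x ^ (q - 1) = 1"
  using q_gt_1 by (simp add: k_iff power_eq_if[of x q])

end

section \<open>Transitive subgroups of SL2\<close>

text \<open>Below a matrix is usually written \<open>(x,z,y,w)\<close>, so that its first column is \<open>(x,y)\<close>.\<close>

definition transitive_subgroup :: "'a::field set \<Rightarrow> ('a \<times> 'a \<times> 'a \<times> 'a) set \<Rightarrow> bool" where
  "transitive_subgroup k \<Gamma> \<longleftrightarrow> \<Gamma> \<subseteq> carrier (SL2 k) \<and> (\<forall>g\<in>\<Gamma>. \<forall>h\<in>\<Gamma>. mmul g h \<in> \<Gamma>) \<and>
     (\<forall>g\<in>\<Gamma>. madj g \<in> \<Gamma>) \<and>
     (\<forall>x\<in>k. \<forall>y\<in>k. x \<noteq> 0 \<or> y \<noteq> 0 \<longrightarrow> (\<exists>z w. (x,z,y,w) \<in> \<Gamma>))"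

text \<open>The matrices of determinant 1 fixing the first basis vector are exactly the
  \<open>(1,c,0,1)\<close>, so the last condition says that its stabilizer is trivial.\<close>

definition regular_subgroup :: "'a::field set \<Rightarrow> ('a \<times> 'a \<times> 'a \<times> 'a) set \<Rightarrow> bool" where
  "regular_subgroup k \<Gamma> \<longleftrightarrow> transitive_subgroup k \<Gamma> \<and> (\<forall>c. (1,c,0,1) \<in> \<Gamma> \<longrightarrow> c = 0)"

lemma regular_subgroupD:
  assumes "regular_subgroup k \<Gamma>"
  shows "g \<in> \<Gamma> \<Longrightarrow> h \<in> \<Gamma> \<Longrightarrow> mmul g h \<in> \<Gamma>" "g \<in> \<Gamma> \<Longrightarrow> madj g \<in> \<Gamma>"
    "x \<in> k \<Longrightarrow> y \<in> k \<Longrightarrow> x \<noteq> 0 \<or> y \<noteq> 0 \<Longrightarrow> \<exists>z w. (x,z,y,w) \<in> \<Gamma>"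
    "(x,z,y,w) \<in> \<Gamma> \<Longrightarrow> x \<in> k \<and> z \<in> k \<and> y \<in> k \<and> w \<in> k \<and> x * w - z * y = 1"
    "(1,c,0,1) \<in> \<Gamma> \<Longrightarrow> c = 0"
proof -
  have sub: "\<Gamma> \<subseteq> carrier (SL2 k)" and "\<forall>g\<in>\<Gamma>. \<forall>h\<in>\<Gamma>. mmul g h \<in> \<Gamma>" "\<forall>g\<in>\<Gamma>. madj g \<in> \<Gamma>"
    "\<forall>x\<in>k. \<forall>y\<in>k. x \<noteq> 0 \<or> y \<noteq> 0 \<longrightarrow> (\<exists>z w. (x,z,y,w) \<in> \<Gamma>)" "\<forall>c. (1,c,0,1) \<in> \<Gamma> \<longrightarrow> c = 0"
    using assms unfolding regular_subgroup_def transitive_subgroup_def by simp_all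
  then show "g \<in> \<Gamma> \<Longrightarrow> h \<in> \<Gamma> \<Longrightarrow> mmul g h \<in> \<Gamma>" "g \<in> \<Gamma> \<Longrightarrow> madj g \<in> \<Gamma>"
    "x \<in> k \<Longrightarrow> y \<in> k \<Longrightarrow> x \<noteq> 0 \<or> y \<noteq> 0 \<Longrightarrow> \<exists>z w. (x,z,y,w) \<in> \<Gamma>"
    "(1,c,0,1) \<in> \<Gamma> \<Longrightarrow> c = 0"
    by simp_all
  show "(x,z,y,w) \<in> \<Gamma> \<Longrightarrow> x \<in> k \<and> z \<in> k \<and> y \<in> k \<and> w \<in> k \<and> x * w - z * y = 1"
    using subsetD[OF sub, of "(x,z,y,w)"] by simp
qed

section \<open>The dichotomy, the quadratic character and conjugation\<close>

context finite_subfield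
begin

lemma two_nz: "odd q \<Longrightarrow> (2 :: 'c) \<noteq> 0"
proof
  assume "odd q" "(2 :: 'c) = 0"
  then have "of_nat 2 = (0 :: 'c)" by simp
  then have "p dvd 2" using char_p of_nat_eq_0_iff_char_dvd by blast
  then have "p = 2" using prime_p primes_dvd_imp_eq two_is_prime_nat by blast
  with \<open>odd q\<close> q_eq n_pos show False by simp
qed

lemma even_sqrt: assumes "even q" "x \<in> k" shows "\<exists>d\<in>k. x = d\<^sup>2"
proof -
  have "x = (x ^ (q div 2))\<^sup>2"
    using assms by (simp add: k_iff flip: power_mult)
  then show ?thesis using assms(2) by blast
qed

text \<open>The \<open>c\<close> with \<open>(1,c,0,1) \<in> \<Gamma>\<close> form an additive group stable under multiplication by squares, and every
  element of \<open>k\<close> is a difference of squares.\<close>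

lemma full_or_regular:
  assumes G: "transitive_subgroup k \<Gamma>"
  shows "\<Gamma> = carrier (SL2 k) \<or> regular_subgroup k \<Gamma>"
proof (cases "regular_subgroup k \<Gamma>")
  case False
  have sub: "\<Gamma> \<subseteq> carrier (SL2 k)" and mult: "\<And>g h. g \<in> \<Gamma> \<Longrightarrow> h \<in> \<Gamma> \<Longrightarrow> mmul g h \<in> \<Gamma>"
    and inv: "\<And>g. g \<in> \<Gamma> \<Longrightarrow> madj g \<in> \<Gamma>"
    and tr: "\<And>x y. x \<in> k \<Longrightarrow> y \<in> k \<Longrightarrow> x \<noteq> 0 \<or> y \<noteq> 0 \<Longrightarrow> \<exists>z w. (x,z,y,w) \<in> \<Gamma>"
    using G unfolding transitive_subgroup_def by blast+
  obtain c where c: "(1,c,0,1) \<in> \<Gamma>" "c \<noteq> 0"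
    using False G unfolding regular_subgroup_def by blast
  have ck: "c \<in> k" using sub c(1) by auto
  have one: "(1,0,0,1) \<in> \<Gamma>"
    using mult[OF c(1) inv[OF c(1)]] by simp
  \<comment> \<open>Conjugation by an upper triangular matrix with diagonal entries \<open>a\<close>
    and \<open>1/a\<close> multiplies the parameter of a transvection by the square of
    \<open>a\<close>.\<close>
  have scale: "(1,a\<^sup>2*d,0,1) \<in> \<Gamma>" if "a \<in> k" "(1,d,0,1) \<in> \<Gamma>" for a d
  proof (cases "a = 0")
    case True
    then show ?thesis using one by simp
  next
    case False
    then obtain z w where g: "(a,z,0,w) \<in> \<Gamma>" using tr[of a 0] \<open>a \<in> k\<close> by auto
    then have "a * w = 1" using sub by auto
    then show ?thesis
      using mult[OF mult[OF g that(2)] inv[OF g]]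
      by (simp add: mult.commute power2_eq_square algebra_simps)
  qed
  have add: "(1,d+e,0,1) \<in> \<Gamma>" if "(1,d,0,1) \<in> \<Gamma>" "(1,e,0,1) \<in> \<Gamma>" for d e
    using mult[OF that(2,1)] by simp
  have neg: "(1,-d,0,1) \<in> \<Gamma>" if "(1,d,0,1) \<in> \<Gamma>" for d
    using inv[OF that] by simp
  have all: "(1,e,0,1) \<in> \<Gamma>" if e: "e \<in> k" for e
  proof (cases "even q")
    case True
    obtain d where "d \<in> k" "e / c = d\<^sup>2" using even_sqrt[OF True, of "e / c"] e ck by auto
    then show ?thesis using scale[of d c] c by (simp add: field_simps)
  next
    case False
    \<comment> \<open>Solves (beta + 1)^2 - beta^2 = 2 beta + 1 = e/c, possible as 2 is
      invertible.\<close>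
    define \<beta> where "\<beta> = (e / c - 1) / 2"
    have "2 * \<beta> = e / c - 1" unfolding \<beta>_def
      using two_nz[OF False] by (metis nonzero_mult_div_cancel_left times_divide_eq_right)
    then have "2 * \<beta> + 1 = e / c" by simp
    then have "(\<beta> + 1)\<^sup>2 * c + - (\<beta>\<^sup>2 * c) = e"
      using c(2) by (simp add: power2_eq_square field_simps)
    moreover have "\<beta> \<in> k" using e ck by (auto simp: \<beta>_def)
    ultimately show ?thesis
      using add[OF scale neg[OF scale], of "\<beta> + 1" c \<beta> c] c(1) by auto
  qed
  have "carrier (SL2 k) \<subseteq> \<Gamma>"
  proof
    fix g assume g: "g \<in> carrier (SL2 k)"
    obtain x z y w where gx: "g = (x,z,y,w)" by (cases g)
    have xk: "x \<in> k" "y \<in> k" "w \<in> k" "z \<in> k" "x * w - z * y = 1" using g gx by auto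
    then have "x \<noteq> 0 \<or> y \<noteq> 0" by auto
    then obtain z' w' where h: "(x,z',y,w') \<in> \<Gamma>" using tr xk by blast
    then have h': "x * w' - z' * y = 1" "w' \<in> k" "z' \<in> k" using sub by auto
    \<comment> \<open>Two matrices of determinant 1 with the same first column differ by a
      transvection on the right; its parameter is the upper right entry of \<open>h\<close> inverse
      times \<open>g\<close>.\<close>
    have "mmul (x,z',y,w') (1, w'*z - z'*w, 0, 1) = g"
      unfolding gx using xk(5) h'(1) by (simp, algebra)
    moreover have "(1, w'*z - z'*w, 0, 1) \<in> \<Gamma>" using all xk h' by simp
    ultimately show "g \<in> \<Gamma>" using mult[OF h] by metis
  qed
  with sub show ?thesis by blast
qed simp

text \<open>For odd \<open>q\<close> this is the quadratic character of \<open>k\<close> in the form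
  of Euler's criterion, with values in the field itself; multiplicativity is then immediate.\<close>

definition chi :: "'c \<Rightarrow> 'c" where "chi x = x ^ ((q - 1) div 2)"

lemma chi_mult: "chi (x * y) = chi x * chi y" by (simp add: chi_def power_mult_distrib)

lemma chi_1 [simp]: "chi 1 = 1" by (simp add: chi_def)

lemma chi_square: assumes "odd q" "d \<in> k" "d \<noteq> 0" shows "chi (d\<^sup>2) = 1"
proof -
  have "2 * ((q - 1) div 2) = q - 1" using assms(1) q_gt_1 by auto
  then show ?thesis using k_pow[OF assms(2,3)] by (simp add: chi_def flip: power_mult)
qed

lemma chi_cases: assumes "odd q" "x \<in> k" "x \<noteq> 0" shows "chi x = 1 \<or> chi x = -1"
proof -
  have "(chi x)\<^sup>2 = 1"
    using chi_square[OF assms] by (simp add: chi_def power2_eq_square power_mult_distrib)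
  then show ?thesis by (simp add: power2_eq_1_iff)
qed

lemma chi_1_imp_square: assumes "odd q" "x \<in> k" "x \<noteq> 0" "chi x = 1"
  shows "\<exists>d\<in>k. d \<noteq> 0 \<and> x = d\<^sup>2"
proof -
  \<comment> \<open>A square root exists in the algebraically closed field; since d^q = chi(x) d =
    d, it lies in \<open>k\<close>.\<close>
  obtain d where d: "d ^ 2 = x" using nth_root_exists[of 2 x] by auto
  have "q = 2 * ((q - 1) div 2) + 1" using assms(1) q_gt_1 by auto
  then have "d ^ q = chi x * d"
    unfolding chi_def d[symmetric] power_mult[symmetric] by (metis power_add power_one_right)
  then have "d \<in> k" using assms by (simp add: k_iff)
  with d assms(3) show ?thesis by auto
qed

lemma neg_one_ne: "odd q \<Longrightarrow> (1::'c) \<noteq> -1"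
  using two_nz by (metis add.right_inverse one_add_one)

lemma card_k_le_degree:
  assumes "P \<noteq> 0" "\<And>x. x \<in> k \<Longrightarrow> x \<noteq> 0 \<Longrightarrow> poly P x = 0"
  shows "q - 1 \<le> degree P"
proof -
  have "q - 1 = card (k - {0})" using card_k finite_k by simp
  also have "\<dots> \<le> card {x. poly P x = 0}"
    using assms by (intro card_mono poly_roots_finite) auto
  also have "\<dots> \<le> degree P" by (rule card_poly_roots_bound[OF assms(1)])
  finally show ?thesis .
qed

text \<open>Otherwise X^((q-1)/2) - 1 would have q - 1 roots.\<close>

lemma ex_nonsquare: assumes "odd q" shows "\<exists>x\<in>k. x \<noteq> 0 \<and> chi x = -1"
proof (rule ccontr)
  let ?m = "(q - 1) div 2"
  let ?P = "monom 1 ?m + (-1) :: 'c poly"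
  assume "\<not> ?thesis"
  then have all: "chi x = 1" if "x \<in> k" "x \<noteq> 0" for x using that chi_cases[OF assms] by blast
  have m: "?m > 0" "2 * ?m = q - 1" using assms q_gt_1 by presburger+
  have deg: "degree ?P = ?m"
    using m degree_add_eq_left[of "-1 :: 'c poly" "monom 1 ?m"] by (simp add: degree_monom_eq)
  with m have "?P \<noteq> 0" by force
  then have "q - 1 \<le> ?m"
    using card_k_le_degree[of ?P] all deg by (simp add: poly_monom chi_def)
  with m show False by simp
qed

text \<open>Conjugation by the upper triangular matrix \<open>(1,\<mu>,0,\<nu>)\<close>, which fixes the first basis vector.\<close>

definition upper_conj :: "'c \<Rightarrow> 'c \<Rightarrow> 'c \<times> 'c \<times> 'c \<times> 'c \<Rightarrow> 'c \<times> 'c \<times> 'c \<times> 'c" where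
  "upper_conj \<mu> \<nu> = (\<lambda>(a,b,c,d). (a - \<mu> * c / \<nu>, a * \<mu> + b * \<nu> - \<mu> * (c * \<mu> + d * \<nu>) / \<nu>,
     c / \<nu>, (c * \<mu> + d * \<nu>) / \<nu>))"

lemma upper_conj_simp [simp]: "upper_conj \<mu> \<nu> (a,b,c,d) = (a - \<mu> * c / \<nu>,
    a * \<mu> + b * \<nu> - \<mu> * (c * \<mu> + d * \<nu>) / \<nu>, c / \<nu>, (c * \<mu> + d * \<nu>) / \<nu>)"
  by (simp add: upper_conj_def)

lemma upper_conj_mult: assumes "\<nu> \<noteq> 0" shows "upper_conj \<mu> \<nu> (mmul A B) = mmul (upper_conj \<mu> \<nu> A) (upper_conj \<mu> \<nu> B)"
proof -
  obtain a b c d where A: "A = (a,b,c,d)" by (cases A)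
  obtain a' b' c' d' where B: "B = (a',b',c',d')" by (cases B)
  define \<nu>' where "\<nu>' = inverse \<nu>"
  have i: "x / \<nu> = x * \<nu>'" for x by (simp add: \<nu>'_def divide_inverse)
  have "\<nu> * \<nu>' = 1" using assms by (simp add: \<nu>'_def)
  then have i': "\<nu> * (\<nu>' * x) = x" for x by (simp flip: mult.assoc)
  show ?thesis unfolding A B by (simp add: i i' algebra_simps)
qed

lemma upper_conj_adj: assumes "\<nu> \<noteq> 0" shows "upper_conj \<mu> \<nu> (madj A) = madj (upper_conj \<mu> \<nu> A)"
  using assms by (cases A) (simp add: field_simps)

lemma upper_conj_carrier: assumes "\<mu> \<in> k" "\<nu> \<in> k" "\<nu> \<noteq> 0" "A \<in> carrier (SL2 k)"
  shows "upper_conj \<mu> \<nu> A \<in> carrier (SL2 k)"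
proof -
  obtain a b c d where A: "A = (a,b,c,d)" by (cases A)
  have "(a - \<mu> * c / \<nu>) * ((c * \<mu> + d * \<nu>) / \<nu>)
     - (a * \<mu> + b * \<nu> - \<mu> * (c * \<mu> + d * \<nu>) / \<nu>) * (c / \<nu>) = a * d - b * c"
    using assms(3) by (simp add: field_simps)
  then show ?thesis using assms unfolding A by auto
qed

lemma upper_conj_hom: assumes "\<mu> \<in> k" "\<nu> \<in> k" "\<nu> \<noteq> 0" shows "upper_conj \<mu> \<nu> \<in> hom (SL2 k) (SL2 k)"
  using assms by (auto simp: hom_def upper_conj_mult upper_conj_carrier simp del: upper_conj_simp)

lemma upper_conj_inj: assumes "\<nu> \<noteq> 0" shows "inj (upper_conj \<mu> \<nu>)"
proof (rule injI)
  fix A B assume "upper_conj \<mu> \<nu> A = upper_conj \<mu> \<nu> B"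
  then show "A = B" using assms by (cases A; cases B) auto
qed

text \<open>The conjugating matrix fixes the first basis vector, so the stabilizer of that vector in
  the conjugate is the conjugate of its stabilizer.\<close>

lemma upper_conj_regular: assumes "\<mu> \<in> k" "\<nu> \<in> k" "\<nu> \<noteq> 0" and R: "regular_subgroup k \<Gamma>"
  shows "regular_subgroup k (upper_conj \<mu> \<nu> ` \<Gamma>)"
  unfolding regular_subgroup_def transitive_subgroup_def
proof (intro conjI ballI impI allI)
  have G: "transitive_subgroup k \<Gamma>" using R regular_subgroup_def by blast
  show "upper_conj \<mu> \<nu> ` \<Gamma> \<subseteq> carrier (SL2 k)"
    using assms(1-3) upper_conj_carrier G unfolding transitive_subgroup_def by blast
  show "mmul g h \<in> upper_conj \<mu> \<nu> ` \<Gamma>" if gh: "g \<in> upper_conj \<mu> \<nu> ` \<Gamma>" "h \<in> upper_conj \<mu> \<nu> ` \<Gamma>" for g h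
  proof -
    obtain g' h' where *: "g' \<in> \<Gamma>" "g = upper_conj \<mu> \<nu> g'" "h' \<in> \<Gamma>" "h = upper_conj \<mu> \<nu> h'"
      using gh by blast
    then have "mmul g h = upper_conj \<mu> \<nu> (mmul g' h')" by (simp only: upper_conj_mult[OF assms(3)])
    with * G show ?thesis unfolding transitive_subgroup_def by blast
  qed
  show "madj g \<in> upper_conj \<mu> \<nu> ` \<Gamma>" if gh: "g \<in> upper_conj \<mu> \<nu> ` \<Gamma>" for g
  proof -
    obtain g' where *: "g' \<in> \<Gamma>" "g = upper_conj \<mu> \<nu> g'" using gh by blast
    then have "madj g = upper_conj \<mu> \<nu> (madj g')" by (simp only: upper_conj_adj[OF assms(3)])
    with * G show ?thesis unfolding transitive_subgroup_def by blast
  qed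
  show "\<exists>z w. (x,z,y,w) \<in> upper_conj \<mu> \<nu> ` \<Gamma>" if xy: "x \<in> k" "y \<in> k" "x \<noteq> 0 \<or> y \<noteq> 0" for x y
  proof -
    \<comment> \<open>The column \<open>(x,y)\<close> arises after conjugation from the column
      obtained by applying the matrix \<open>(1,\<mu>,0,\<nu>)\<close> to it.\<close>
    have *: "x + \<mu> * y \<noteq> 0 \<or> \<nu> * y \<noteq> 0" using xy assms by auto
    obtain z w where g: "(x + \<mu> * y, z, \<nu> * y, w) \<in> \<Gamma>"
    proof -
      have "x + \<mu> * y \<in> k" "\<nu> * y \<in> k" using xy assms by auto
      with G * that show thesis unfolding transitive_subgroup_def by blast
    qed
    show ?thesis using imageI[OF g, of "upper_conj \<mu> \<nu>"] assms(3) by auto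
  qed
  show "c = 0" if gh: "(1,c,0,1) \<in> upper_conj \<mu> \<nu> ` \<Gamma>" for c
  proof -
    obtain a b c' d where g: "(a,b,c',d) \<in> \<Gamma>" "(1,c,0,1) = upper_conj \<mu> \<nu> (a,b,c',d)" using gh by force
    then have c': "c' = 0" using assms(3) by auto
    with g(2) assms(3) have "a = 1" "d = 1" by auto
    with c' g(1) R have "b = 0" unfolding regular_subgroup_def by blast
    with g(2) c' \<open>a = 1\<close> \<open>d = 1\<close> assms(3) show "c = 0" by auto
  qed
qed

text \<open>The quotient of the two matrices fixes the first basis vector, hence is a transvection
  and therefore trivial.\<close>

lemma regular_unique:
  assumes "regular_subgroup k \<Gamma>" "(x,z,y,w) \<in> \<Gamma>" "(x,z',y,w') \<in> \<Gamma>"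
  shows "z = z' \<and> w = w'"
proof -
  have "mmul (madj (x,z,y,w)) (x,z',y,w') \<in> \<Gamma>"
    using assms(2,3) by (intro regular_subgroupD(1,2)[OF assms(1)])
  moreover have d: "x * w - z * y = 1" "x * w' - z' * y = 1"
    using assms regular_subgroupD(4) by metis+
  then have "mmul (madj (x,z,y,w)) (x,z',y,w') = (1, w*z' - z*w', 0, 1)"
    by (auto simp: algebra_simps)
  ultimately have "w*z' - z*w' = 0"
    using regular_subgroupD(5)[OF assms(1)] by metis
  with d show ?thesis by algebra
qed

text \<open>Determinant 1 and trace 2 force the eigenvalue 1. If \<open>h\<close> carries the first
  basis vector to a fixed vector of \<open>g\<close>, then \<open>g h\<close> and \<open>h\<close>
  have the same first column, so \<open>g h = h\<close>.\<close>

lemma regular_trace_2: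
  assumes R: "regular_subgroup k \<Gamma>" and g: "(a,b,c,d) \<in> \<Gamma>" and tr: "a + d = 2"
  shows "(a,b,c,d) = (1,0,0,1)"
proof -
  have gk: "a \<in> k" "b \<in> k" "c \<in> k" "d \<in> k" "a * d - b * c = 1"
    using regular_subgroupD(4)[OF R g] by auto
  have "\<exists>x y. x \<in> k \<and> y \<in> k \<and> (x \<noteq> 0 \<or> y \<noteq> 0) \<and> a * x + b * y = x \<and> c * x + d * y = y"
  proof (cases "b = 0 \<and> a = 1")
    case True
    with tr have "d = 1" by simp
    with True show ?thesis by (intro exI[of _ 0] exI[of _ 1]) simp
  next
    case False
    \<comment> \<open>The eigenvector is \<open>(-b, a - 1)\<close>, annihilated by the first row of
      \<open>g - 1\<close>; trace and determinant take care of the second row.\<close>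
    have "c * (- b) + d * (a - 1) = (a * d - b * c) - d" by (simp add: algebra_simps)
    also have "\<dots> = a - 1" using tr unfolding gk(5) by (simp add: algebra_simps)
    finally have "c * (- b) + d * (a - 1) = a - 1" .
    with False gk show ?thesis by (intro exI[of _ "- b"] exI[of _ "a - 1"]) (auto simp: algebra_simps)
  qed
  then obtain x y where xy: "x \<in> k" "y \<in> k" "x \<noteq> 0 \<or> y \<noteq> 0" "a * x + b * y = x" "c * x + d * y = y"
    by blast
  then obtain z w where h: "(x,z,y,w) \<in> \<Gamma>"
    using regular_subgroupD(3)[OF R] by blast
  have "mmul (a,b,c,d) (x,z,y,w) \<in> \<Gamma>"
    by (rule regular_subgroupD(1)[OF R g h])
  then have "(x, a*z+b*w, y, c*z+d*w) \<in> \<Gamma>" using xy by simp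
  from regular_unique[OF R h this] have e: "a*z+b*w = z" "c*z+d*w = w" by auto
  have det: "x * w - z * y = 1"
    using regular_subgroupD(4)[OF R h] by simp
  \<comment> \<open>Multiplication of \<open>g h = h\<close> by the adjugate of \<open>h\<close>,
    written out entry by entry.\<close>
  have "w * (a * x + b * y) - y * (a * z + b * w) = a * (x * w - z * y)"
    "x * (a * z + b * w) - z * (a * x + b * y) = b * (x * w - z * y)"
    "w * (c * x + d * y) - y * (c * z + d * w) = c * (x * w - z * y)"
    "x * (c * z + d * w) - z * (c * x + d * y) = d * (x * w - z * y)"
    by (simp_all add: algebra_simps)
  from this[unfolded e xy det] show ?thesis using det by (simp add: mult.commute)
qed

end

section \<open>Regular subgroups containing a split torus\<close>

text \<open>The condition on \<open>a\<close> makes the two eigenvalues of the diagonal matrix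
  distinct, so that only diagonal matrices commute with it. For q > 3 every regular subgroup is
  conjugate to one of this kind.\<close>

locale split_regular = finite_subfield p n q k
  for p n q :: nat and k :: "'c::alg_closed_field set" +
  fixes \<Gamma> :: "('c \<times> 'c \<times> 'c \<times> 'c) set" and a :: 'c
  assumes R: "regular_subgroup k \<Gamma>" and a_mem: "(a,0,0,1/a) \<in> \<Gamma>" and a_sq: "a\<^sup>2 \<noteq> 1"
begin

lemmas mult = regular_subgroupD(1)[OF R] and inv = regular_subgroupD(2)[OF R]
  and ex_col = regular_subgroupD(3)[OF R] and uni = regular_unique[OF R]

lemma memD: assumes "(x,z,y,w) \<in> \<Gamma>"
  shows "x \<in> k" "z \<in> k" "y \<in> k" "w \<in> k" "x * w - z * y = 1"
  using regular_subgroupD(4)[OF R assms] by auto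

lemma a_nz: "a \<noteq> 0" using memD(5)[OF a_mem] by auto

text \<open>Multiplying an upper triangular element by the given diagonal matrix on the left and on
  the right gives the same first column. By regularity the two commute, which kills the upper right
  entry.\<close>

lemma diag_mem: assumes "x \<in> k" "x \<noteq> 0" shows "(x,0,0,1/x) \<in> \<Gamma>"
proof -
  obtain z w where g: "(x,z,0,w) \<in> \<Gamma>" using ex_col[of x 0] assms by auto
  have "(a*x, a*z, 0, w/a) \<in> \<Gamma>" "(a*x, z/a, 0, w/a) \<in> \<Gamma>"
    using mult[OF a_mem g] mult[OF g a_mem] by (simp_all add: mult.commute)
  then have "a * z = z / a" using uni by blast
  then have "z = 0" using a_nz a_sq by (simp add: field_simps power2_eq_square)
  moreover have "w = 1 / x" using memD(5)[OF g] assms by (simp add: field_simps)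
  ultimately show ?thesis using g by simp
qed

lemma upper_diag: assumes "(x,z,0,w) \<in> \<Gamma>" shows "z = 0"
proof -
  have "x \<noteq> 0" using memD(5)[OF assms] by auto
  then show ?thesis using uni[OF assms diag_mem] memD(1)[OF assms] by blast
qed

text \<open>The element with first column \<open>(0,1)\<close> conjugates the given diagonal matrix
  into an upper triangular element, which must be diagonal; this forces its last entry to
  vanish.\<close>

lemma W_mem: "(0,-1,1,0) \<in> \<Gamma>"
proof -
  obtain z w where W: "(0,z,1,w) \<in> \<Gamma>" using ex_col[of 0 1] by auto
  have z: "z = -1" using memD(5)[OF W] by (simp add: eq_neg_iff_add_eq_0 add.commute neg_eq_iff_add_eq_0)
  have "(1/a, w/a - a*w, 0, a) \<in> \<Gamma>"
    using mult[OF inv[OF W] mult[OF a_mem W]] unfolding z by (simp add: mult.commute)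
  then have "w/a - a*w = 0" by (rule upper_diag)
  then have "w = 0" using a_nz a_sq by (simp add: field_simps power2_eq_square)
  with W z show ?thesis by simp
qed

lemma mult_W: "(x,z,y,w) \<in> \<Gamma> \<Longrightarrow> (z,-x,w,-y) \<in> \<Gamma>"
  using mult[OF _ W_mem] by fastforce

lemma mult_diag: assumes "(x,z,y,w) \<in> \<Gamma>" "d \<in> k" "d \<noteq> 0" "e \<in> k" "e \<noteq> 0"
  shows "(x*e*d, z*e/d, y*d/e, w/(e*d)) \<in> \<Gamma>"
  using mult[OF mult[OF diag_mem[OF assms(4,5)] assms(1)] diag_mem[OF assms(2,3)]]
  by (simp add: mult_ac)

text \<open>Multiplication by \<open>(0,-1,1,0)\<close> exchanges the columns up to sign, so all
  cases reduce to upper triangular elements or to comparison with an antidiagonal element of the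
  same first column.\<close>

lemma zero_entries: assumes "(x,z,y,w) \<in> \<Gamma>"
  shows "x = 0 \<longleftrightarrow> w = 0" "y = 0 \<longleftrightarrow> z = 0"
proof -
  have 1: "x = 0" if "(x,z,y,0) \<in> \<Gamma>" for x y z
    using upper_diag[OF mult_W[OF that]] by simp
  have 2: "w = 0" if g: "(0,z,y,w) \<in> \<Gamma>" for z y w
  proof -
    have "(z,0,w,-y) \<in> \<Gamma>" using mult_W[OF g] by simp
    have "y \<noteq> 0" using memD(5)[OF g] by auto
    moreover have "(0,-1/y,y,0) \<in> \<Gamma>"
      using mult_diag[OF W_mem, of 1 "1/y"] memD(3)[OF g] \<open>y \<noteq> 0\<close> by simp
    ultimately show ?thesis using uni[OF g] by blast
  qed
  show "x = 0 \<longleftrightarrow> w = 0" using 1 2 assms by blast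
  show "y = 0 \<longleftrightarrow> z = 0"
    using 2[of "-x" w "-y"] mult_W[OF assms] upper_diag assms by auto
qed

text \<open>Diagonal factors on both sides leave \<open>x * w\<close> unchanged, move
  \<open>x\<close> freely and multiply \<open>x * y\<close> by an arbitrary nonzero square.\<close>

lemma invariant: assumes g: "(x,z,y,w) \<in> \<Gamma>" "(x',z',y',w') \<in> \<Gamma>"
  and nz: "x \<noteq> 0" "y \<noteq> 0" "x' \<noteq> 0" "y' \<noteq> 0" and d: "d \<in> k" "d \<noteq> 0" "x' * y' = x * y * d\<^sup>2"
  shows "x' * w' = x * w"
proof -
  define e where "e = x' / (x * d)"
  have e: "e \<in> k" "e \<noteq> 0" using memD[OF g(1)] memD[OF g(2)] nz d by (auto simp: e_def)
  have "x * e * d = x'" "y * d / e = y'"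
    using nz d by (simp_all add: e_def field_simps power2_eq_square)
  then have "(x', z*e/d, y', w/(e*d)) \<in> \<Gamma>" using mult_diag[OF g(1) d(1,2) e] by simp
  then have "w' = w / (e*d)" using uni[OF g(2)] by blast
  then show ?thesis using nz d(2) by (simp add: e_def)
qed

text \<open>Otherwise the product of \<open>(x,z,y,w)\<close> with some diagonal matrix has trace 2.\<close>

lemma one_minus_nonsquare: assumes g: "(x,z,y,w) \<in> \<Gamma>" "x \<noteq> 0" "y \<noteq> 0" and d: "\<delta> \<in> k"
  shows "1 - x * w \<noteq> \<delta>\<^sup>2"
proof
  assume eq: "1 - x * w = \<delta>\<^sup>2"
  have "w \<noteq> 0" using zero_entries(1)[OF g(1)] g(2) by blast
  have "1 + \<delta> \<noteq> 0"
  proof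
    assume "1 + \<delta> = 0"
    then have "\<delta> = - 1" by (simp add: eq_neg_iff_add_eq_0 add.commute)
    with eq show False using \<open>w \<noteq> 0\<close> g(2) by simp
  qed
  \<comment> \<open>A root of the equation x e + w/e = 2, that is x e^2 - 2 e + w = 0, whose
    discriminant is 4 (1 - x w).\<close>
  define e where "e = (1 + \<delta>) / x"
  have e: "e \<in> k" "e \<noteq> 0" using memD[OF g(1)] g \<open>1 + \<delta> \<noteq> 0\<close> d by (auto simp: e_def)
  have m: "(x*e, z*e, y/e, w/e) \<in> \<Gamma>" using mult_diag[OF g(1) _ _ e, of 1] by simp
  have "x * w = (1 + \<delta>) * (1 - \<delta>)" using eq by (simp add: algebra_simps power2_eq_square)
  then have "w / e = 1 - \<delta>" using g(2) \<open>1 + \<delta> \<noteq> 0\<close> by (simp add: e_def field_simps)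
  moreover have "x * e = 1 + \<delta>" using g(2) by (simp add: e_def)
  ultimately have "x * e + w / e = 2" by simp
  from regular_trace_2[OF R m this] show False using e(2) g(3) by auto
qed

text \<open>In characteristic 2 every element of \<open>k\<close> is a square, which
  \<open>one_minus_nonsquare\<close> forbids for \<open>1 - x * w\<close>.\<close>

lemma odd_q: "odd q"
proof
  assume ev: "even q"
  obtain z w where g: "(1,z,1,w) \<in> \<Gamma>" using ex_col[of 1 1] by auto
  then have "1 - 1 * w \<in> k" using memD[OF g] by auto
  from even_sqrt[OF ev this] one_minus_nonsquare[OF g] show False by auto
qed

lemma chi_invariant: assumes g: "(x,z,y,w) \<in> \<Gamma>" "(x',z',y',w') \<in> \<Gamma>"
  and nz: "x \<noteq> 0" "y \<noteq> 0" "x' \<noteq> 0" "y' \<noteq> 0" and c: "chi (x * y) = chi (x' * y')"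
  shows "x' * w' = x * w"
proof -
  let ?r = "(x' * y') / (x * y)"
  have k: "x * y \<in> k" "x' * y' \<in> k" "x \<in> k" using memD[OF g(1)] memD[OF g(2)] by auto
  have "chi (x * y) * chi ?r = chi (x' * y')"
    unfolding chi_mult[symmetric] using nz by simp
  moreover have "chi (x * y) \<noteq> 0" using nz by (simp add: chi_def)
  ultimately have "chi ?r = 1" using c by simp
  then obtain d where "d \<in> k" "d \<noteq> 0" "?r = d\<^sup>2"
    using chi_1_imp_square[OF odd_q, of ?r] k nz by auto
  then show ?thesis using invariant[OF g nz, of d] nz by (simp add: field_simps)
qed

lemma chi_one_minus: assumes g: "(x,z,y,w) \<in> \<Gamma>" "x \<noteq> 0" "y \<noteq> 0"
  shows "chi (1 - x * w) = -1" "1 - x * w \<noteq> 0"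
proof -
  have k: "1 - x * w \<in> k" using memD[OF g(1)] by auto
  show "1 - x * w \<noteq> 0" using one_minus_nonsquare[OF g, of 0] by auto
  then show "chi (1 - x * w) = -1"
    using chi_1_imp_square[OF odd_q k] one_minus_nonsquare[OF g] chi_cases[OF odd_q k] by blast
qed

text \<open>The nonzero elements of \<open>k\<close> have two classes modulo squares; the
  representatives used are the elements with first columns \<open>(1,1)\<close> and
  \<open>(1,\<nu>)\<close>, where \<open>\<nu>\<close> is a nonsquare.\<close>

lemma ex_invariants:
  obtains s1 s2 where
    "\<And>x z y w. (x,z,y,w) \<in> \<Gamma> \<Longrightarrow> x \<noteq> 0 \<Longrightarrow> y \<noteq> 0 \<Longrightarrow> x * w = (if chi (x * y) = 1 then s1 else s2)"
    "\<exists>z. (1,z,1,s1) \<in> \<Gamma>" "\<exists>\<nu> z. (1,z,\<nu>,s2) \<in> \<Gamma> \<and> \<nu> \<noteq> 0 \<and> chi \<nu> = -1"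
proof -
  obtain z1 s1 where g1: "(1,z1,1,s1) \<in> \<Gamma>" using ex_col[of 1 1] by auto
  obtain \<nu> where \<nu>: "\<nu> \<in> k" "\<nu> \<noteq> 0" "chi \<nu> = -1" using ex_nonsquare[OF odd_q] by blast
  obtain z2 s2 where g2: "(1,z2,\<nu>,s2) \<in> \<Gamma>" using ex_col[of 1 \<nu>] \<nu> by auto
  have "x * w = (if chi (x * y) = 1 then s1 else s2)"
    if g: "(x,z,y,w) \<in> \<Gamma>" and nz: "x \<noteq> 0" "y \<noteq> 0" for x z y w
  proof (cases "chi (x * y) = 1")
    case True
    then show ?thesis using chi_invariant[OF g1 g] nz by simp
  next
    case False
    then have "chi (x * y) = -1" using chi_cases[OF odd_q, of "x * y"] memD[OF g] nz by auto
    then show ?thesis using chi_invariant[OF g2 g] nz \<nu> False by simp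
  qed
  then show ?thesis using that g1 g2 \<nu> by blast
qed

end

context finite_subfield
begin

text \<open>The normal form of a regular subgroup with a split torus, collecting
  \<open>zero_entries\<close> and the two values of \<open>x * w\<close>. For general
  \<open>s1\<close>, \<open>s2\<close> it is only a set of matrices.\<close>

definition std_subgroup :: "'c \<Rightarrow> 'c \<Rightarrow> ('c \<times> 'c \<times> 'c \<times> 'c) set" where
  "std_subgroup s1 s2 = {(x,z,y,w). (x,z,y,w) \<in> carrier (SL2 k) \<and> (x = 0 \<longrightarrow> w = 0) \<and> (y = 0 \<longrightarrow> z = 0) \<and>
     (x \<noteq> 0 \<and> y \<noteq> 0 \<longrightarrow> x * w = (if chi (x * y) = 1 then s1 else s2))}"

text \<open>Conjugation by the diagonal matrix with entries 1 and \<open>\<nu>\<close> keeps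
  \<open>x * w\<close> and divides \<open>x * y\<close> by a nonsquare, so the two values change
  places.\<close>

lemma std_subgroup_swap: assumes "odd q" "\<nu> \<in> k" "\<nu> \<noteq> 0" "chi \<nu> = -1" shows "upper_conj 0 \<nu> ` std_subgroup s1 s2 = std_subgroup s2 s1"
proof -
  have "chi (inverse \<nu>) * chi \<nu> = 1" unfolding chi_mult[symmetric] using assms by simp
  then have inv: "chi (inverse \<nu>) = -1" using assms(4) by (simp add: eq_neg_iff_add_eq_0 neg_eq_iff_add_eq_0 add.commute)
  have sub: "upper_conj 0 \<mu> ` std_subgroup s1 s2 \<subseteq> std_subgroup s2 s1" if \<mu>: "\<mu> \<in> k" "\<mu> \<noteq> 0" "chi \<mu> = -1" "chi (inverse \<mu>) = -1"
    for \<mu> s1 s2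
  proof
    fix g assume "g \<in> upper_conj 0 \<mu> ` std_subgroup s1 s2"
    then obtain g0 where "g = upper_conj 0 \<mu> g0" "g0 \<in> std_subgroup s1 s2" by blast
    then obtain x z y w where g: "g = upper_conj 0 \<mu> (x,z,y,w)" "(x,z,y,w) \<in> std_subgroup s1 s2" by (cases g0) blast
    have c: "(x,z,y,w) \<in> carrier (SL2 k)" using g(2) by (simp add: std_subgroup_def)
    have "chi (x * (y / \<mu>)) = - chi (x * y)"
      using \<mu>(4) chi_mult[of "x * y" "inverse \<mu>"] by (simp add: divide_inverse mult_ac)
    moreover have "chi (x * y) = 1 \<or> chi (x * y) = -1" if "x \<noteq> 0" "y \<noteq> 0"
      using chi_cases[OF assms(1), of "x * y"] c that by auto
    moreover have "g \<in> carrier (SL2 k)" unfolding g(1) by (rule upper_conj_carrier[OF _ \<mu>(1,2) c]) simp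
    ultimately show "g \<in> std_subgroup s2 s1"
      using g \<mu>(2) neg_one_ne[OF assms(1)] by (auto simp: std_subgroup_def simp del: carrier_SL2)
  qed
  have "std_subgroup s2 s1 = upper_conj 0 \<nu> ` upper_conj 0 (inverse \<nu>) ` std_subgroup s2 s1"
  proof -
    have "upper_conj 0 \<nu> (upper_conj 0 (inverse \<nu>) g) = g" for g
      using assms(3) by (cases g) simp
    then show ?thesis by (simp add: image_image)
  qed
  also have "\<dots> \<subseteq> upper_conj 0 \<nu> ` std_subgroup s1 s2"
    using sub[of "inverse \<nu>" s2 s1] assms inv by (intro image_mono) auto
  finally show ?thesis using sub[of \<nu> s1 s2] assms inv by auto
qed

end

context split_regular
begin

text \<open>For the converse inclusion take the element of \<open>\<Gamma>\<close> with the same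
  first column: the defining conditions and determinant 1 determine the second column.\<close>

lemma eq_std_subgroup:
  assumes "\<And>x z y w. (x,z,y,w) \<in> \<Gamma> \<Longrightarrow> x \<noteq> 0 \<Longrightarrow> y \<noteq> 0 \<Longrightarrow> x * w = (if chi (x * y) = 1 then s1 else s2)"
  shows "\<Gamma> = std_subgroup s1 s2"
proof -
  have sub: "(x,z,y,w) \<in> std_subgroup s1 s2" if g: "(x,z,y,w) \<in> \<Gamma>" for x z y w
    using assms[OF g] zero_entries[OF g] memD[OF g] by (simp add: std_subgroup_def)
  moreover have "g \<in> \<Gamma>" if g: "g \<in> std_subgroup s1 s2" for g
  proof -
    obtain x z y w where g': "g = (x,z,y,w)" by (cases g)
    then have k: "x \<in> k" "y \<in> k" "x * w - z * y = 1" using g by (auto simp: std_subgroup_def)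
    then have "x \<noteq> 0 \<or> y \<noteq> 0" by auto
    then obtain z' w' where h: "(x,z',y,w') \<in> \<Gamma>" using ex_col k by blast
    note h' = sub[OF h]
    have k': "x * w' - z' * y = 1" using memD[OF h] by simp
    consider "x = 0" | "y = 0" | "x \<noteq> 0" "y \<noteq> 0" by blast
    then have "z = z' \<and> w = w'"
    proof cases
      case 1
      then have "w = 0" "w' = 0" using g h' unfolding g' by (auto simp: std_subgroup_def)
      moreover have "x * w - z * y = x * w' - z' * y" using k k' by simp
      moreover have "y \<noteq> 0" using k 1 by auto
      ultimately show ?thesis by simp
    next
      case 2
      then have "z = 0" "z' = 0" using g h' unfolding g' by (auto simp: std_subgroup_def)
      moreover have "x * w = x * w'" "x \<noteq> 0" using k k' 2 by auto
      ultimately show ?thesis by simp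
    next
      case 3
      then have eq: "x * w = x * w'" using g h' unfolding g' by (simp add: std_subgroup_def)
      have "x * w' - z * y = x * w' - z' * y" using k(3)[unfolded eq] k' by simp
      then have "z * y = z' * y" by simp
      with eq 3 show ?thesis by simp
    qed
    with h g' show ?thesis by simp
  qed
  ultimately show ?thesis by auto
qed

lemma q_gt_3: "q > 3"
proof -
  have "a \<noteq> 0" "a \<noteq> 1" "a \<noteq> -1" using a_nz a_sq by auto
  then have "card {0,1,-1,a} = 4" using neg_one_ne[OF odd_q] by auto
  moreover have "{0,1,-1,a} \<subseteq> k" using memD[OF a_mem] by auto
  ultimately show ?thesis using card_mono[OF finite_k, of "{0,1,-1,a}"] card_k by simp
qed

lemma prime_q_char: assumes "prime q" shows "p = q" "of_nat q = (0::'c)"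
proof -
  have "p dvd q" using q_eq n_pos by simp
  then show "p = q" using assms prime_p primes_dvd_imp_eq by blast
  then show "of_nat q = (0::'c)" using of_nat_p by simp
qed

text \<open>The possible values of \<open>x * w\<close> in \<open>\<Gamma>\<close> are \<open>0\<close>, \<open>1\<close>, \<open>s1\<close>, \<open>s2\<close>. Evaluating \<open>x * w\<close> on products of two
  elements gives polynomials with many roots in \<open>k\<close>, which bounds \<open>q\<close>.\<close>

lemma classification:
  obtains s1 s2 where "\<Gamma> = std_subgroup s1 s2"
    "q = 5 \<and> s1 = 3 \<and> s2 = 3 \<or> q = 7 \<and> (s1 = 3 \<and> s2 = 5 \<or> s1 = 5 \<and> s2 = 3) \<or>
     q = 11 \<and> (s1 = 2 \<and> s2 = 10 \<or> s1 = 10 \<and> s2 = 2)"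
proof -
  obtain s1 s2 where
    S: "\<And>x z y w. (x,z,y,w) \<in> \<Gamma> \<Longrightarrow> x \<noteq> 0 \<Longrightarrow> y \<noteq> 0 \<Longrightarrow> x * w = (if chi (x * y) = 1 then s1 else s2)"
    and ex: "\<exists>z. (1,z,1,s1) \<in> \<Gamma>" "\<exists>\<nu> z. (1,z,\<nu>,s2) \<in> \<Gamma> \<and> \<nu> \<noteq> 0 \<and> chi \<nu> = -1"
    by (rule ex_invariants) (rule that, assumption+)
  from ex obtain z1 \<nu> z2 where g1: "(1,z1,1,s1) \<in> \<Gamma>"
    and g2: "(1,z2,\<nu>,s2) \<in> \<Gamma>" and \<nu>: "\<nu> \<noteq> 0" "chi \<nu> = -1" by blast
  have vals: "x * w = 0 \<or> x * w = 1 \<or> x * w = s1 \<or> x * w = s2" if g: "(x,z,y,w) \<in> \<Gamma>" for x z y w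
  proof -
    consider "x = 0" | "y = 0" | "x \<noteq> 0" "y \<noteq> 0" by blast
    then show ?thesis
    proof cases
      case 1
      then show ?thesis by simp
    next
      case 2
      then show ?thesis using memD(5)[OF g] by simp
    next
      case 3
      show ?thesis using S[OF g 3] by presburger
    qed
  qed
  have k: "s1 \<in> k" "s2 \<in> k" "\<nu> \<in> k" using memD[OF g1] memD[OF g2] by auto
  have z1: "z1 = s1 - 1" and z2: "z2 * \<nu> = s2 - 1"
    using memD(5)[OF g1] memD(5)[OF g2] by (simp_all add: algebra_simps)
  have c1: "chi (1 - s1) = -1" "1 - s1 \<noteq> 0" and c2: "chi (1 - s2) = -1" "1 - s2 \<noteq> 0"
    using chi_one_minus[OF g1] chi_one_minus[OF g2] \<nu> by auto
  have nz: "s1 \<noteq> 0" "s2 \<noteq> 0" using zero_entries[OF g1] zero_entries[OF g2] by auto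
  have two: "(2::'c) \<noteq> 0" by (rule two_nz[OF odd_q])
  have m1: "(-1::'c) \<noteq> 1" using neg_one_ne[OF odd_q] by simp
  \<comment> \<open>Times \<open>(0,-1,1,0)\<close> the element \<open>g1\<close> becomes one with
    first column \<open>(z1,s1)\<close> and diagonal product \<open>-z1 = 1 - s1\<close>.\<close>
  have W1: "1 - s1 = (if chi (s1 * (s1 - 1)) = 1 then s1 else s2)"
    using S[OF mult_W[OF g1]] z1 nz c1 by (simp add: algebra_simps)
  \<comment> \<open>The same for \<open>g2\<close>; the factor \<open>\<nu>\<close> in the square
    class exchanges the two alternatives compared with \<open>W1\<close>.\<close>
  have W2: "1 - s2 = (if chi (\<nu> * (s2 * (s2 - 1))) = 1 then s1 else s2)"
  proof -
    have "z2 \<noteq> 0" using zero_entries[OF g2] \<nu> by auto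
    moreover have "chi (z2 * s2) = chi (\<nu> * (s2 * (s2 - 1)))"
    proof -
      have "chi (\<nu> * (s2 * (s2 - 1))) = chi (\<nu>\<^sup>2 * (z2 * s2))"
        unfolding z2[symmetric] by (simp add: power2_eq_square mult_ac)
      also have "\<dots> = chi (z2 * s2)" by (simp add: chi_mult[of "\<nu>\<^sup>2"] chi_square[OF odd_q k(3) \<nu>(1)])
      finally show ?thesis ..
    qed
    ultimately have "z2 * - \<nu> = (if chi (\<nu> * (s2 * (s2 - 1))) = 1 then s1 else s2)"
      using S[OF mult_W[OF g2]] nz by simp
    moreover have "z2 * - \<nu> = 1 - s2" by (simp add: z2)
    ultimately show ?thesis by simp
  qed
  have W2': "1 - s2 = (if chi (s2 * (s2 - 1)) = 1 then s2 else s1)"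
  proof -
    have "chi (s2 * (s2 - 1)) = 1 \<or> chi (s2 * (s2 - 1)) = -1"
      using chi_cases[OF odd_q] k nz c2 by simp
    then show ?thesis using W2 unfolding chi_mult[of \<nu>] \<nu>(2) using m1 by auto
  qed
  have G: "\<Gamma> = std_subgroup s1 s2" by (rule eq_std_subgroup[OF S])
  show thesis
  \<comment> \<open>\<open>1 - s1\<close> and \<open>1 - s2\<close> are again among
    \<open>s1\<close>, \<open>s2\<close>. Either both values are 1/2, leading to q = 5, or
    \<open>s2 = 1 - s1\<close>.\<close>
  proof (cases "s1 = s2 \<and> 2 * s1 = 1")
    case True
    then have t: "2 * s1 = 1" by (rule conjunct2)
    \<comment> \<open>The diagonal product X of \<open>g1\<close> times the element with first
      column \<open>(1,\<rho>)\<close> satisfies 8 rho X = -(2 - rho)^2. The possible X are 0, 1 and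
      1/2, giving the three alternatives in this order.\<close>
    have val: "\<rho> = 2 \<or> \<rho> = -2 \<or> \<rho>\<^sup>2 = -4" if \<rho>: "\<rho> \<in> k" "\<rho> \<noteq> 0" for \<rho>
    proof -
      obtain z w where h: "(1,z,\<rho>,w) \<in> \<Gamma>" using ex_col[of 1 \<rho>] \<rho> by auto
      have w: "w = s1" using S[OF h] \<rho> True by (auto split: if_splits)
      have z: "z * \<rho> = s1 - 1" using memD(5)[OF h] w by (simp add: algebra_simps)
      have "(1 + z1 * \<rho>, z + z1 * s1, 1 + s1 * \<rho>, z + s1 * s1) \<in> \<Gamma>"
        using mult[OF g1 h] w by simp
      from vals[OF this] have "(1 + z1 * \<rho>) * (z + s1 * s1) = 0 \<or> (1 + z1 * \<rho>) * (z + s1 * s1) = 1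
          \<or> (1 + z1 * \<rho>) * (z + s1 * s1) = s1" using True by metis
      moreover have "8 * \<rho> * ((1 + z1 * \<rho>) * (z + s1 * s1)) = - ((2 - \<rho>)\<^sup>2)"
      proof -
        have s: "z1 = - s1" using z1 t by (metis add_diff_cancel_left' minus_diff_eq mult_2)
        have z': "2 * (z * \<rho>) = - 1" using z t by (simp add: right_diff_distrib)
        have "8 * \<rho> * ((1 + z1 * \<rho>) * (z + s1 * s1)) =
            (2 - (2 * s1) * \<rho>) * (2 * (2 * (z * \<rho>)) + (2 * s1) * (2 * s1) * \<rho>)"
          unfolding s by (simp add: algebra_simps)
        also have "\<dots> = (2 - \<rho>) * (- 2 + \<rho>)" using t unfolding z' by simp
        finally show ?thesis by (simp add: power2_eq_square algebra_simps)
      qed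
      ultimately obtain X where X: "X = 0 \<or> X = 1 \<or> X = s1" "8 * \<rho> * X = - ((2 - \<rho>)\<^sup>2)"
        by blast
      have "8 * \<rho> * s1 = 4 * \<rho> * (2 * s1)" by simp
      then have "8 * \<rho> * s1 = 4 * \<rho>" using t by simp
      with X have "(2 - \<rho>)\<^sup>2 = 0 \<or> 8 * \<rho> + (2 - \<rho>)\<^sup>2 = 0 \<or> 4 * \<rho> + (2 - \<rho>)\<^sup>2 = 0"
        by (elim disjE) (simp_all add: eq_neg_iff_add_eq_0)
      moreover have "8 * \<rho> + (2 - \<rho>)\<^sup>2 = (2 + \<rho>)\<^sup>2" "4 * \<rho> + (2 - \<rho>)\<^sup>2 = \<rho>\<^sup>2 + 4"
        by (simp_all add: power2_eq_square algebra_simps)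
      ultimately have "(2 - \<rho>)\<^sup>2 = 0 \<or> (2 + \<rho>)\<^sup>2 = 0 \<or> \<rho>\<^sup>2 = -4"
        by (simp add: eq_neg_iff_add_eq_0)
      then show ?thesis by (auto simp: eq_neg_iff_add_eq_0 add.commute)
    qed
    \<comment> \<open>Its factors express the three alternatives; degree 4 gives
      \<open>q - 1 \<le> 4\<close>.\<close>
    let ?P = "[:-2,1:] * [:2,1:] * [:4,0,1:] :: 'c poly"
    have "poly ?P x = 0" if x: "x \<in> k" "x \<noteq> 0" for x
    proof -
      have "poly ?P x = (x - 2) * (x + 2) * (x\<^sup>2 + 4)"
        by (simp only: poly_mult) (simp add: power2_eq_square add.commute)
      also have "\<dots> = 0" using val[OF x] by auto
      finally show ?thesis .
    qed
    then have "q - 1 \<le> degree ?P"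
      by (intro card_k_le_degree) (simp, blast)
    also have "degree ?P = 4" by simp
    finally have "q = 5" using q_gt_3 odd_q by presburger
    moreover have "s1 = 3"
    proof -
      have "(5::'c) = 0" using prime_q_char(2) \<open>q = 5\<close> by simp
      moreover have "s1 - 3 = 3 * (2 * s1 - 1) - 5 * s1" by simp
      ultimately show ?thesis using t by simp
    qed
    ultimately show thesis using that G True by blast
  next
    case False
    \<comment> \<open>Otherwise \<open>W1\<close> gives \<open>s1 = 1/2\<close>, and then
      \<open>W2'\<close> gives \<open>s2 = 1/2\<close>, the case already treated.\<close>
    have nonsq: "chi (s1 * (s1 - 1)) \<noteq> 1"
    proof
      assume "chi (s1 * (s1 - 1)) = 1"
      with W1 have s1: "2 * s1 = 1" by (simp add: algebra_simps)
      then have "1 - s2 = s1 \<or> 2 * s2 = 1" using W2' by (auto split: if_splits simp: algebra_simps)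
      moreover have "2 * s2 = 1" if "1 - s2 = s1"
      proof -
        have "2 * s2 = 2 - 2 * (1 - s2)" by simp
        also have "\<dots> = 1" unfolding that s1 by simp
        finally show ?thesis .
      qed
      ultimately have "2 * s1 = 2 * s2" using s1 by metis
      then have "s1 = s2" using two by (metis mult_left_cancel)
      with False s1 show False by blast
    qed
    then have s2: "s2 = 1 - s1" using W1 by simp
    have cs1: "chi s1 = -1" using c2 s2 by simp
    \<comment> \<open>Now \<open>s1\<close> and \<open>1 - s1\<close> are nonsquares and so is
      \<open>s1 * (s1 - 1)\<close>; hence -1 is a nonsquare.\<close>
    have chim1: "chi (-1) = -1"
    proof -
      have "chi (s1 * (s1 - 1)) = chi s1 * (chi (-1) * chi (1 - s1))"
        unfolding chi_mult[symmetric] by (simp add: algebra_simps)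
      then have "chi (-1) \<noteq> 1" using nonsq cs1 c1 by auto
      then show ?thesis using chi_cases[OF odd_q, of "-1"] by auto
    qed
    \<comment> \<open>The factors, polynomials in e^2, correspond to the diagonal products 1,
      \<open>s1\<close> and \<open>1 - s1\<close> of the matrix computed below; the product 0 is
      excluded by the quadratic character.\<close>
    let ?P = "[:s1,0,1:] * [:s1\<^sup>2, 0, 2*s1-1, 0, 1:] *
      [:(s1-1)*s1\<^sup>2, 0, s1*(2*s1-1), 0, s1-1:]"
    have zero: "poly ?P e = 0" if e: "e \<in> k" "e \<noteq> 0" for e
    proof -
      define A where "A = e\<^sup>2"
      have A: "A \<noteq> 0" "chi A = 1" "A \<in> k" using e chi_square[OF odd_q] by (auto simp: A_def)
      \<comment> \<open>\<open>g1\<close> multiplied on the left by a diagonal matrix; the product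
        of \<open>g1\<close> with it is then tested against \<open>vals\<close>.\<close>
      have "(e, z1*e, 1/e, s1/e) \<in> \<Gamma>" using mult_diag[OF g1, of 1 e] e by simp
      from mult[OF g1 this]
      have "(e + z1/e, z1*e + z1*s1/e, e + s1/e, z1*e + s1*s1/e) \<in> \<Gamma>" by simp
      note vals[OF this]
      moreover have "A * ((e + z1/e) * (z1*e + s1*s1/e)) = (A + z1) * (z1 * A + s1\<^sup>2)"
        using e(2) by (simp add: A_def field_simps power2_eq_square)
      ultimately obtain X where "X = 0 \<or> X = 1 \<or> X = s1 \<or> X = s2"
        and prod: "A * X = (A + z1) * (z1 * A + s1\<^sup>2)" by blast
      then consider "X = 0" | "X = 1" | "X = s1" | "X = 1 - s1" unfolding s2 by blast
      then show ?thesis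
      proof cases
        case 1
        with prod have "A + z1 = 0 \<or> z1 * A + s1\<^sup>2 = 0" by simp
        then have "A = 1 - s1 \<or> (1 - s1) * A = s1\<^sup>2"
          unfolding z1 by (auto simp: algebra_simps)
        moreover have "A \<noteq> 1 - s1" using A c1 m1 by auto
        moreover have "(1 - s1) * A \<noteq> s1\<^sup>2"
        proof
          assume "(1 - s1) * A = s1\<^sup>2"
          then have "chi (1 - s1) * chi A = chi (s1\<^sup>2)" by (simp flip: chi_mult)
          then show False using A c1 m1 chi_square[OF odd_q k(1) nz(1)] by simp
        qed
        ultimately show ?thesis by blast
      next
        case 2
        have "(s1 - 1) * ((A + s1) * (A + s1)) = (A + z1) * (z1 * A + s1\<^sup>2) - A"
          unfolding z1 by (simp add: power2_eq_square algebra_simps)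
        also have "\<dots> = 0" using prod 2 by simp
        finally have "A + s1 = 0" using c1(2) by simp
        then have "poly [:s1,0,1:] e = 0" by (simp add: A_def power2_eq_square add.commute)
        then show ?thesis by (simp only: poly_mult mult_zero_left)
      next
        case 3
        have "(s1 - 1) * (A * A + (2*s1-1) * A + s1\<^sup>2) = (A + z1) * (z1 * A + s1\<^sup>2) - A * s1"
          unfolding z1 by (simp add: power2_eq_square algebra_simps)
        also have "\<dots> = 0" using prod 3 by simp
        finally have "A * A + (2*s1-1) * A + s1\<^sup>2 = 0" using c1(2) by simp
        then have "poly [:s1\<^sup>2, 0, 2*s1-1, 0, 1:] e = 0"
          by (simp add: A_def power2_eq_square algebra_simps)
        then show ?thesis by (simp only: poly_mult mult_zero_left mult_zero_right)
      next
        case 4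
        have "(s1 - 1) * A * A + s1 * (2*s1-1) * A + (s1-1)*s1\<^sup>2 = (A + z1) * (z1 * A + s1\<^sup>2) - A * (1 - s1)"
          unfolding z1 by (simp add: power2_eq_square algebra_simps)
        also have "\<dots> = 0" using prod 4 by simp
        finally have "poly [:(s1-1)*s1\<^sup>2, 0, s1*(2*s1-1), 0, s1-1:] e = 0"
          by (simp add: A_def power2_eq_square algebra_simps)
        then show ?thesis by (simp only: poly_mult mult_zero_left mult_zero_right)
      qed
    qed
    have deg: "degree ?P = 10"
      using c1(2) by (subst degree_mult_eq, simp, simp, subst degree_mult_eq) auto
    then have "q - 1 \<le> 10" using card_k_le_degree[of ?P] zero by fastforce
    \<comment> \<open>-1 is a nonsquare exactly if (q-1)/2 is odd; among the odd q with 3 < q and q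
      - 1 at most 10 this leaves 7 and 11.\<close>
    moreover have "odd ((q - 1) div 2)"
      using chim1 m1 by (cases "even ((q - 1) div 2)") (auto simp: chi_def)
    ultimately have q: "q = 7 \<or> q = 11" using odd_q q_gt_3 by presburger
    have G': "\<Gamma> = std_subgroup s1 (1 - s1)" using G s2 by simp
    from q show thesis
    proof
      assume q7: "q = 7"
      have z7: "(7::'c) = 0" using prime_q_char(2) q7 by simp
      have "s1 ^ 3 = -1" "(1 - s1) ^ 3 = -1" using cs1 c1(1) unfolding chi_def by (simp_all add: q7)
      \<comment> \<open>Both \<open>s1\<close> and \<open>1 - s1\<close> are roots of X^3 + 1. The
        nonsquares modulo 7 are 3, 5, 6, and only 3 and 5 sum to 1; the identity over the integers
        encodes this.\<close>
      moreover have "(s1 - 3) * (s1 - 5) = 5 * ((1 - s1) ^ 3 + s1 ^ 3 + 2) + 7 * (s1 - 2 * s1\<^sup>2)"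
        by (simp add: power2_eq_square power3_eq_cube algebra_simps)
      ultimately have "(s1 - 3) * (s1 - 5) = 0" using z7 by simp
      then have "s1 = 3 \<or> s1 = 5" by simp
      moreover have "1 - (3::'c) = 5 - 7" "1 - (5::'c) = 3 - 7" by simp_all
      then have "1 - (3::'c) = 5" "1 - (5::'c) = 3" unfolding z7 by simp_all
      ultimately show thesis using that[OF G'] q7 by auto
    next
      assume q11: "q = 11"
      have z11: "(11::'c) = 0" using prime_q_char(2) q11 by simp
      have "s1 ^ 5 = -1" "(1 - s1) ^ 5 = -1" using cs1 c1(1) unfolding chi_def by (simp_all add: q11)
      \<comment> \<open>The nonsquares modulo 11 are 2, 6, 7, 8, 10; the pairs with sum 1 are 2, 10
        and 6, 6. Modulo 11 the identity reduces the sum of the two fifth-power conditions to these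
        roots.\<close>
      moreover have "(s1 - 6) * (s1 - 6) * ((s1 - 2) * (s1 - 10)) = 9 * ((1 - s1) ^ 5 + s1 ^ 5 + 2)
          + 11 * (- 4 * s1^4 + 6 * s1^3 + 10 * s1^2 - 57 * s1 + 63)"
        by (simp add: eval_nat_numeral algebra_simps)
      ultimately have "(s1 - 6) * (s1 - 6) * ((s1 - 2) * (s1 - 10)) = 0" using z11 by simp
      then have "s1 = 6 \<or> s1 = 2 \<or> s1 = 10" by auto
      \<comment> \<open>6 is 1/2 modulo 11, so it would belong to the first case.\<close>
      moreover have "s1 \<noteq> 6"
      proof
        assume "s1 = 6"
        moreover have "2 * (6::'c) = 1 + 11" "1 - (6 :: 'c) = 6 - 11" by simp_all
        then have "2 * (6::'c) = 1" "1 - (6 :: 'c) = 6" unfolding z11 by simp_all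
        ultimately show False using False s2 by simp
      qed
      moreover have "1 - (2::'c) = 10 - 11" "1 - (10::'c) = 2 - 11" by simp_all
      then have "1 - (2::'c) = 10" "1 - (10::'c) = 2" unfolding z11 by simp_all
      ultimately show thesis using that[OF G'] q11 by auto
    qed
  qed
qed

end

section \<open>From the split case to all regular subgroups\<close>

context finite_subfield
begin

lemma regular_imp_split:
  assumes R: "regular_subgroup k \<Gamma>" and q: "q > 3"
  obtains \<mu> a where "\<mu> \<in> k" "split_regular p n q k (upper_conj \<mu> 1 ` \<Gamma>) a"
proof -
  have "card {0,1,-1::'c} \<le> 3" by (simp add: card_insert_if)
  then have "\<not> k \<subseteq> {0,1,-1}" using q card_k card_mono[of "{0,1,-1::'c}" k] by force
  then obtain a where a: "a \<in> k" "a \<noteq> 0" "a \<noteq> 1" "a \<noteq> -1" by auto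
  then have a2: "a\<^sup>2 \<noteq> 1" by (simp add: power2_eq_1_iff)
  obtain z w where g: "(a,z,0,w) \<in> \<Gamma>" using regular_subgroupD(3)[OF R, of a 0] a by auto
  have zw: "z \<in> k" "w \<in> k" "a * w = 1" using regular_subgroupD(4)[OF R g] by auto
  then have w: "w = 1 / a" using a by (simp add: field_simps)
  then have "w \<noteq> a" using a2 a(2) by (auto simp: field_simps power2_eq_square)
  \<comment> \<open>\<open>(\<mu>,1)\<close> is the eigenvector of \<open>(a,z,0,w)\<close> for the
    eigenvalue \<open>w\<close>; with the first basis vector it diagonalises this element.\<close>
  define \<mu> where "\<mu> = z / (w - a)"
  have \<mu>: "\<mu> \<in> k" using zw a by (auto simp: \<mu>_def)
  have "\<mu> * (w - a) = z" using \<open>w \<noteq> a\<close> by (simp add: \<mu>_def)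
  then have "upper_conj \<mu> 1 (a,z,0,w) = (a,0,0,1/a)" using w by (simp add: algebra_simps)
  then have "(a,0,0,1/a) \<in> upper_conj \<mu> 1 ` \<Gamma>" using g by (metis imageI)
  then have "split_regular p n q k (upper_conj \<mu> 1 ` \<Gamma>) a"
    using upper_conj_regular[OF \<mu> _ _ R, of 1] a2 by unfold_locales auto
  with \<mu> show ?thesis using that by blast
qed

text \<open>Trace 2 is excluded for nonidentity elements. For q = 2 only trace 1 remains; for q = 3
  the matrix -1 lies in the group, so trace -2 is excluded as well and only 0 remains.\<close>

lemma regular_small:
  assumes R: "regular_subgroup k \<Gamma>" and q: "q = 2 \<or> q = 3" and g: "(x,z,y,w) \<in> \<Gamma>"
  shows "y = 0 \<Longrightarrow> z = 0" "y \<noteq> 0 \<Longrightarrow> x + w = (if q = 2 then 1 else 0)"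
proof -
  have "prime q" using q by auto
  then have "p = q" using primes_dvd_imp_eq prime_p q_eq n_pos by (metis dvd_power)
  then have q0: "(of_nat q :: 'c) = 0" using of_nat_p by simp
  have k2: "t = 0 \<or> t = 1" if "t \<in> k" "q = 2" for t
    using that by (simp add: k_iff power2_eq_square)
  have k3: "t = 0 \<or> t = 1 \<or> t = -1" if "t \<in> k" "q = 3" for t
  proof -
    have "t * ((t - 1) * (t + 1)) = 0"
      using that by (simp add: k_iff power3_eq_cube algebra_simps)
    then show ?thesis by (auto simp: eq_neg_iff_add_eq_0)
  qed
  have 1: "z = 0" if g: "(x,z,0,w) \<in> \<Gamma>" for x z w
  proof -
    have m: "x \<in> k" "w \<in> k" "x * w = 1" using regular_subgroupD(4)[OF R g] by auto
    have "x = 1 \<and> w = 1 \<or> q = 3 \<and> x = -1 \<and> w = -1"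
      using q k2[OF m(1)] k3[OF m(1)] m(3)
      by (auto simp: minus_equation_iff[of w] dest: sym)
    then show ?thesis
    proof
      assume "x = 1 \<and> w = 1"
      then show ?thesis using regular_subgroupD(5)[OF R] g by blast
    next
      assume x: "q = 3 \<and> x = -1 \<and> w = -1"
      then have "mmul (x,z,0,w) (x,z,0,w) = (1, z - 3 * z, 0, 1)" by simp
      then have "(1, z - 3 * z, 0, 1) \<in> \<Gamma>" using regular_subgroupD(1)[OF R g g] by simp
      then show ?thesis using regular_subgroupD(5)[OF R] q0 x by fastforce
    qed
  qed
  then show "y = 0 \<Longrightarrow> z = 0" using g by blast
  assume y: "y \<noteq> 0"
  then have tr: "x + w \<noteq> 2" using regular_trace_2[OF R g] by auto
  have xw: "x + w \<in> k" using regular_subgroupD(4)[OF R g] by auto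
  show "x + w = (if q = 2 then 1 else 0)"
  proof (cases "q = 2")
    case True
    then show ?thesis using k2[OF xw] tr q0 by auto
  next
    case False
    with q have q3: "q = 3" by simp
    have "(2::'c) = 3 - 1" by simp
    then have two: "(2::'c) = -1" using q0 q3 by simp
    obtain z' w' where m: "(-1,z',0,w') \<in> \<Gamma>" using regular_subgroupD(3)[OF R, of "-1" 0] by auto
    then have "(-1,0,0,-1) \<in> \<Gamma>"
      using 1[OF m] regular_subgroupD(4)[OF R m] by (metis add.inverse_inverse diff_zero mult_minus1 mult_zero_left)
    from regular_subgroupD(1)[OF R this g] have "(-x,-z,-y,-w) \<in> \<Gamma>" by simp
    from regular_trace_2[OF R this] y have "- (x + w) \<noteq> 2" by auto
    then have "x + w \<noteq> 1" "x + w \<noteq> -1" using tr unfolding two by metis+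
    then show ?thesis using k3[OF xw q3] q3 by auto
  qed
qed

text \<open>First column, determinant and the trace forced by \<open>regular_small\<close> determine
  every matrix with \<open>y \<noteq> 0\<close>.\<close>

lemma regular_small_unique:
  assumes "regular_subgroup k \<Gamma>" "regular_subgroup k \<Gamma>'" and q: "q = 2 \<or> q = 3"
  shows "\<Gamma> = \<Gamma>'"
proof -
  have "\<Gamma> \<subseteq> \<Gamma>'" if R: "regular_subgroup k \<Gamma>" "regular_subgroup k \<Gamma>'" for \<Gamma> \<Gamma>'
  proof
    fix g assume "g \<in> \<Gamma>"
    then obtain x z y w where g: "g = (x,z,y,w)" "(x,z,y,w) \<in> \<Gamma>" by (cases g) auto
    then have k: "x \<in> k" "y \<in> k" "x * w - z * y = 1" using regular_subgroupD(4)[OF R(1)] by auto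
    then have "x \<noteq> 0 \<or> y \<noteq> 0" by auto
    then obtain z' w' where g': "(x,z',y,w') \<in> \<Gamma>'" using regular_subgroupD(3)[OF R(2)] k by blast
    then have k': "x * w' - z' * y = 1" using regular_subgroupD(4)[OF R(2)] by auto
    have "z = z' \<and> w = w'"
    proof (cases "y = 0")
      case True
      then have "x * w = x * w'" "x \<noteq> 0" using k k' by auto
      with True show ?thesis
        using regular_small(1)[OF R(1) q g(2)] regular_small(1)[OF R(2) q g'] by simp
    next
      case False
      then have "w = w'"
        using regular_small(2)[OF R(1) q g(2)] regular_small(2)[OF R(2) q g'] by (metis add_left_cancel)
      moreover from this have "z * y = z' * y" using k(3) k' by (simp add: algebra_simps)
      ultimately show ?thesis using False by simp
    qed
    with g g' show "g \<in> \<Gamma>'" by simp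
  qed
  with assms show ?thesis by blast
qed

text \<open>One conjugation makes the group split; when the values \<open>s1\<close>,
  \<open>s2\<close> come in the wrong order, a second one with a nonsquare swaps them.\<close>

lemma regular_conj_std_subgroup:
  assumes R: "regular_subgroup k \<Gamma>" and q: "q > 3"
  shows "q \<in> {5,7,11} \<and> (\<exists>f \<in> hom (SL2 k) (SL2 k). inj f \<and>
    f ` \<Gamma> = (if q = 5 then std_subgroup 3 3 else if q = 7 then std_subgroup 3 5 else std_subgroup 2 10))"
proof -
  obtain \<mu> a where \<mu>: "\<mu> \<in> k" and "split_regular p n q k (upper_conj \<mu> 1 ` \<Gamma>) a"
    using regular_imp_split[OF R q] .
  then interpret S: split_regular p n q k "upper_conj \<mu> 1 ` \<Gamma>" a by blast
  obtain s1 s2 where G: "upper_conj \<mu> 1 ` \<Gamma> = std_subgroup s1 s2" and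
    s: "q = 5 \<and> s1 = 3 \<and> s2 = 3 \<or> q = 7 \<and> (s1 = 3 \<and> s2 = 5 \<or> s1 = 5 \<and> s2 = 3) \<or>
      q = 11 \<and> (s1 = 2 \<and> s2 = 10 \<or> s1 = 10 \<and> s2 = 2)"
    using S.classification .
  obtain \<nu> where \<nu>: "\<nu> \<in> k" "\<nu> \<noteq> 0" "chi \<nu> = -1" using ex_nonsquare[OF S.odd_q] by blast
  have h: "upper_conj \<mu> 1 \<in> hom (SL2 k) (SL2 k)" "inj (upper_conj \<mu> 1)"
    using upper_conj_hom[OF \<mu>, of 1] upper_conj_inj[of 1 \<mu>] by auto
  have h': "upper_conj 0 \<nu> \<circ> upper_conj \<mu> 1 \<in> hom (SL2 k) (SL2 k)" "inj (upper_conj 0 \<nu> \<circ> upper_conj \<mu> 1)"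
    using hom_compose[OF h(1) upper_conj_hom[OF _ \<nu>(1,2)], of 0] upper_conj_inj[OF \<nu>(2)] h(2) inj_compose by blast+
  have im: "(upper_conj 0 \<nu> \<circ> upper_conj \<mu> 1) ` \<Gamma> = std_subgroup s2 s1"
    using std_subgroup_swap[OF S.odd_q \<nu>] G by (metis image_comp)
  from s show ?thesis
  proof (elim disjE conjE)
  qed (use h h' im G in \<open>auto simp del: upper_conj_simp o_apply\<close>)
qed

text \<open>For q > 3 both groups are carried to the common normal form, for smaller q they are
  equal. Two maps meeting in one image avoid forming an inverse conjugation.\<close>

theorem regular_subgroups_conjugate:
  assumes R: "regular_subgroup k \<Gamma>" "regular_subgroup k \<Gamma>'"
  shows "\<exists>f \<in> hom (SL2 k) (SL2 k). \<exists>f' \<in> hom (SL2 k) (SL2 k). inj f \<and> inj f' \<and> f ` \<Gamma> = f' ` \<Gamma>'"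
proof (cases "q > 3")
  case True
  show ?thesis using regular_conj_std_subgroup[OF R(1) True] regular_conj_std_subgroup[OF R(2) True] by metis
next
  case False
  then have "\<Gamma> = \<Gamma>'" using regular_small_unique R q_gt_1 by (metis One_nat_def Suc_lessI numeral_2_eq_2 numeral_3_eq_3)
  moreover have "id \<in> hom (SL2 k) (SL2 k)" by (auto simp: hom_def)
  ultimately show ?thesis by (metis inj_on_id)
qed

lemma regular_imp_q:
  assumes R: "regular_subgroup k \<Gamma>" shows "q \<in> {2,3,5,7,11}"
proof (cases "q > 3")
  case True
  show ?thesis using regular_conj_std_subgroup[OF R True] by blast
next
  case False
  then show ?thesis using q_gt_1 by auto
qed

end

section \<open>SL2(3) inside SL2(5) and SL2(5) inside SL2(11)\<close>

type_synonym imat = "int \<times> int \<times> int \<times> int"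

definition mulm :: "int \<Rightarrow> imat \<Rightarrow> imat \<Rightarrow> imat" where
  "mulm m = (\<lambda>(a,b,c,d) (a',b',c',d').
     ((a*a' + b*c') mod m, (a*b' + b*d') mod m, (c*a' + d*c') mod m, (c*b' + d*d') mod m))"

definition sl2_list :: "int \<Rightarrow> imat list" where
  "sl2_list m = filter (\<lambda>(a,b,c,d). (a * d - b * c) mod m = 1)
     (List.product [0..m - 1] (List.product [0..m - 1] (List.product [0..m - 1] [0..m - 1])))"

text \<open>With \<open>U = (1,1,0,1)\<close> and \<open>W = (0,-1,1,0)\<close> one has
  \<open>(a,b,c,d) = U^((a+1)/c) W U^c W U^((d+1)/c)\<close> for \<open>c \<noteq> 0\<close>; the case \<open>c = 0\<close> is reduced to this one by
  multiplication with \<open>W\<close>. Here \<open>u\<close> lists the powers of the image of \<open>U\<close>, and \<open>W\<close> is sent to \<open>W\<close>.\<close>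

fun word :: "int \<Rightarrow> int \<Rightarrow> (int \<Rightarrow> imat) \<Rightarrow> imat \<Rightarrow> imat" where
  "word l m u (a,b,c,d) = (let i = c ^ nat (l - 2);
      v = (\<lambda>(x,y,z). mulm m (mulm m (mulm m (mulm m (u x) (0,m-1,1,0)) (u y)) (0,m-1,1,0)) (u z))
    in if c = 0 then mulm m (0,m-1,1,0) (v (- d mod l, l - a, (b - 1) * d mod l))
    else v ((a + 1) * i mod l, c, (d + 1) * i mod l))"

text \<open>Powers modulo 11 of \<open>(3,1,0,4)\<close>, of order 5. Its product with
  \<open>(0,-1,1,0)\<close> has trace 1, hence cube -1, the same relation as for the generators of
  SL(2,5).\<close>

definition image_pow_5 :: "int \<Rightarrow> imat" where
  "image_pow_5 e = (if e = 0 then (1,0,0,1) else if e = 1 then (3,1,0,4) else if e = 2 then (9,7,0,5)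
     else if e = 3 then (5,4,0,9) else (4,10,0,3))"

text \<open>Powers modulo 5 of \<open>(1,2,1,3)\<close>, which has trace -1 and hence order 3; its
  product with \<open>(0,-1,1,0)\<close> again has trace 1.\<close>

definition image_pow_3 :: "int \<Rightarrow> imat" where
  "image_pow_3 e = (if e = 0 then (1,0,0,1) else if e = 1 then (1,2,1,3) else (3,3,4,1))"

definition SL2_int :: "int \<Rightarrow> imat set" where
  "SL2_int m = {(a,b,c,d). a \<in> {0..<m} \<and> b \<in> {0..<m} \<and> c \<in> {0..<m} \<and> d \<in> {0..<m} \<and>
     (a * d - b * c) mod m = 1}"

lemma SL2_int_iff [simp]: "(a,b,c,d) \<in> SL2_int m \<longleftrightarrow> a \<in> {0..<m} \<and> b \<in> {0..<m} \<and> c \<in> {0..<m} \<and>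
    d \<in> {0..<m} \<and> (a * d - b * c) mod m = 1"
  by (simp add: SL2_int_def)

lemma SL2_int_code [code_unfold]: "A \<in> SL2_int m \<longleftrightarrow> (case A of (a,b,c,d) \<Rightarrow>
    0 \<le> a \<and> a < m \<and> 0 \<le> b \<and> b < m \<and> 0 \<le> c \<and> c < m \<and> 0 \<le> d \<and> d < m \<and> (a * d - b * c) mod m = 1)"
  by (auto simp: SL2_int_def split: prod.splits)

lemma distinct_sl2_list: "distinct (sl2_list m)"
  by (simp add: sl2_list_def distinct_product)

lemma set_sl2_list: "set (sl2_list m) = SL2_int m"
  by (auto simp: sl2_list_def SL2_int_def)

lemma mulm_simp [simp]: "mulm m (a,b,c,d) (a',b',c',d') =
    ((a*a' + b*c') mod m, (a*b' + b*d') mod m, (c*a' + d*c') mod m, (c*b' + d*d') mod m)"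
  by (simp add: mulm_def)

lemma mulm_assoc: "mulm m (mulm m A B) C = mulm m A (mulm m B C)"
proof -
  have "(a * (b mod m) + c * (d mod m)) mod m = (a * b + c * d) mod m" for a b c d :: int
    unfolding cong_def[symmetric] by (intro cong_add cong_mult) (simp_all add: cong_def)
  moreover from this have "(b mod m * a + d mod m * c) mod m = (a * b + c * d) mod m" for a b c d :: int
    by (simp only: mult.commute)
  ultimately show ?thesis
    by (cases A; cases B; cases C) (simp, simp add: algebra_simps)
qed

lemma mulm_closed:
  assumes "A \<in> SL2_int m" "B \<in> SL2_int m" "m > 1" shows "mulm m A B \<in> SL2_int m"
proof -
  obtain a b c d where A: "A = (a,b,c,d)" by (cases A)
  obtain a' b' c' d' where B: "B = (a',b',c',d')" by (cases B)
  have "((a*a' + b*c') mod m * ((c*b' + d*d') mod m) - (a*b' + b*d') mod m * ((c*a' + d*c') mod m)) mod m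
      = ((a*a' + b*c') * (c*b' + d*d') - (a*b' + b*d') * (c*a' + d*c')) mod m"
    unfolding cong_def[symmetric] by (intro cong_diff cong_mult) (simp_all add: cong_def)
  also have "(a*a' + b*c') * (c*b' + d*d') - (a*b' + b*d') * (c*a' + d*c')
      = (a * d - b * c) * (a' * d' - b' * c')" by (simp add: algebra_simps)
  also have "\<dots> mod m = (((a * d - b * c) mod m) * ((a' * d' - b' * c') mod m)) mod m"
    by (simp only: mod_simps)
  also have "\<dots> = 1" using assms unfolding A B by simp
  finally show ?thesis using assms(3) unfolding A B by simp
qed

text \<open>The word expresses every matrix through the generators \<open>(1,1,0,1)\<close> and \<open>(0,-1,1,0)\<close>,
  so it suffices to check multiplicativity on these two.\<close>

lemma hom_from_generators:
  assumes l: "l > 1" and m: "m > 1"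
    and w: "\<And>A. A \<in> SL2_int l \<Longrightarrow> word l l (\<lambda>e. (1,e,0,1)) A = A"
    and clos: "\<And>A. A \<in> SL2_int l \<Longrightarrow> \<phi> A \<in> SL2_int m" and one: "\<phi> (1,0,0,1) = (1,0,0,1)"
    and U: "\<And>A. A \<in> SL2_int l \<Longrightarrow> \<phi> (mulm l A (1,1,0,1)) = mulm m (\<phi> A) (\<phi> (1,1,0,1))"
    and W: "\<And>A. A \<in> SL2_int l \<Longrightarrow> \<phi> (mulm l A (0,l-1,1,0)) = mulm m (\<phi> A) (\<phi> (0,l-1,1,0))"
    and A: "A \<in> SL2_int l" and B: "B \<in> SL2_int l"
  shows "\<phi> (mulm l A B) = mulm m (\<phi> A) (\<phi> B)"
proof -
  \<comment> \<open>The right factors against which \<open>\<phi>\<close> is multiplicative for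
    every left factor; by associativity they are closed under products.\<close>
  define S where "S = {B \<in> SL2_int l. \<forall>A \<in> SL2_int l. \<phi> (mulm l A B) = mulm m (\<phi> A) (\<phi> B)}"
  have mult: "mulm l B C \<in> S" if "B \<in> S" "C \<in> S" for B C
    using that l by (auto simp: S_def mulm_closed simp flip: mulm_assoc simp del: SL2_int_iff)
  have right_one: "mulm n C (1,0,0,1) = C" if "C \<in> SL2_int n" for n C
    using that by (cases C) simp
  have WS: "(0,l-1,1,0) \<in> S" using W l by (auto simp: S_def)
  have US: "(1,1,0,1) \<in> S" using U l by (auto simp: S_def)
  have "int e < l \<longrightarrow> (1,int e,0,1) \<in> S" for e
  proof (induction e)
    case 0
    show ?case using l clos one right_one by (auto simp: S_def)
  next
    case (Suc e)
    show ?case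
    proof
      assume e: "int (Suc e) < l"
      then have "mulm l (1,int e,0,1) (1,1,0,1) = (1,int (Suc e),0,1)" by simp
      then show "(1,int (Suc e),0,1) \<in> S" using mult[OF _ US, of "(1,int e,0,1)"] Suc e by simp
    qed
  qed
  then have pow: "(1,e,0,1) \<in> S" if "e \<in> {0..<l}" for e
    using that zero_le_imp_eq_int by fastforce
  have "word l l (\<lambda>e. (1,e,0,1)) B \<in> S"
  proof -
    obtain a b c d where B': "B = (a,b,c,d)" by (cases B)
    have mods: "x mod l \<in> {0..<l}" for x using l by simp
    have v: "mulm l (mulm l (mulm l (mulm l (1,x,0,1) (0,l-1,1,0)) (1,y,0,1)) (0,l-1,1,0)) (1,z,0,1) \<in> S"
      if "x \<in> {0..<l}" "y \<in> {0..<l}" "z \<in> {0..<l}" for x y z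
      using that by (intro mult pow WS)
    show ?thesis
    proof (cases "c = 0")
      case True
      then have "a \<noteq> 0" using B B' by auto
      then have "l - a \<in> {0..<l}" using B B' by auto
      then show ?thesis using True unfolding B' by (simp add: Let_def v mods mult WS del: mulm_simp)
    next
      case False
      then show ?thesis using B unfolding B' by (simp add: Let_def v mods del: mulm_simp)
    qed
  qed
  with w[OF B] A show ?thesis by (simp add: S_def)
qed

section \<open>Transfer from integer matrices modulo m to matrices over a ring\<close>

definition of_int_mat :: "imat \<Rightarrow> 'a::comm_ring_1 \<times> 'a \<times> 'a \<times> 'a" where
  "of_int_mat = (\<lambda>(a,b,c,d). (of_int a, of_int b, of_int c, of_int d))"

lemma of_int_mat_simp [simp]: "of_int_mat (a,b,c,d) = (of_int a, of_int b, of_int c, of_int d)"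
  by (simp add: of_int_mat_def)

lemma of_int_mod_eq:
  assumes "CHAR('a) = nat m" "m > 1" shows "of_int (x mod m) = (of_int x :: 'a::comm_ring_1)"
  using assms by (simp add: of_int_eq_iff_cong_CHAR cong_def)

lemma of_int_mat_mulm:
  assumes "CHAR('a) = nat m" "m > 1"
  shows "of_int_mat (mulm m A B) = mmul (of_int_mat A) (of_int_mat B :: 'a::comm_ring_1 \<times> 'a \<times> 'a \<times> 'a)"
  by (cases A; cases B) (simp add: of_int_mod_eq[OF assms])

lemma of_int_mat_bij:
  assumes "CHAR('a) = nat m" "m > 1"
  shows "bij_betw of_int_mat (SL2_int m) (carrier (SL2 (of_int ` {0..<m} :: 'a::comm_ring_1 set)))"
proof -
  have eq: "(of_int x :: 'a) = of_int y \<longleftrightarrow> x mod m = y mod m" for x y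
    using assms by (simp add: of_int_eq_iff_cong_CHAR cong_def)
  have "inj_on (of_int_mat :: _ \<Rightarrow> 'a \<times> 'a \<times> 'a \<times> 'a) (SL2_int m)"
    by (rule inj_onI) (auto simp: SL2_int_def eq)
  moreover have det: "(of_int a * of_int d - of_int b * of_int c :: 'a) = 1 \<longleftrightarrow> (a * d - b * c) mod m = 1"
    for a b c d
    using eq[of "a * d - b * c" 1] assms(2) by simp
  have "of_int_mat ` SL2_int m = carrier (SL2 (of_int ` {0..<m} :: 'a set))"
  proof
    show "of_int_mat ` SL2_int m \<subseteq> carrier (SL2 (of_int ` {0..<m} :: 'a set))"
      by (auto simp: SL2_int_def det)
    show "carrier (SL2 (of_int ` {0..<m} :: 'a set)) \<subseteq> of_int_mat ` SL2_int m"
    proof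
      fix g :: "'a \<times> 'a \<times> 'a \<times> 'a" assume g: "g \<in> carrier (SL2 (of_int ` {0..<m}))"
      obtain x y z w where g': "g = (x,y,z,w)" by (cases g)
      obtain a b c d where "a \<in> {0..<m}" "b \<in> {0..<m}" "c \<in> {0..<m}" "d \<in> {0..<m}"
        "x = of_int a" "y = of_int b" "z = of_int c" "w = of_int d" using g unfolding g' by auto
      then have "(a,b,c,d) \<in> SL2_int m" "g = of_int_mat (a,b,c,d)" using g unfolding g' by (auto simp: det)
      then show "g \<in> of_int_mat ` SL2_int m" by blast
    qed
  qed
  ultimately show ?thesis unfolding bij_betw_def by blast
qed

lemma UNIV_3: "(UNIV :: 3 set) = of_int ` {0..<3}"
proof -
  have "x \<in> of_int ` {0..<3}" for x :: 3
    by (cases x rule: bit1_cases) auto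
  then show ?thesis by blast
qed

lemma UNIV_5: "(UNIV :: 5 set) = of_int ` {0..<5}"
proof -
  have "x \<in> of_int ` {0..<5}" for x :: 5
    by (cases x rule: bit1_cases) auto
  then show ?thesis by blast
qed

lemma SL2_hom_of_int:
  fixes l m :: int
  assumes l: "CHAR('a::comm_ring_1) = nat l" "l > 1" and m: "CHAR('c::comm_ring_1) = nat m" "m > 1"
    and U: "(UNIV :: 'a set) = of_int ` {0..<l}" and k: "of_int ` {0..<m} \<subseteq> (k :: 'c set)"
    and clos: "\<And>A. A \<in> SL2_int l \<Longrightarrow> \<phi> A \<in> SL2_int m" and inj: "inj_on \<phi> (SL2_int l)"
    and hom: "\<And>A B. A \<in> SL2_int l \<Longrightarrow> B \<in> SL2_int l \<Longrightarrow> \<phi> (mulm l A B) = mulm m (\<phi> A) (\<phi> B)"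
  shows "\<exists>\<psi> \<in> hom (SL2 (UNIV :: 'a set)) (SL2 k). inj_on \<psi> (carrier (SL2 (UNIV :: 'a set)))"
proof -
  let ?i = "inv_into (SL2_int l) of_int_mat :: 'a \<times> 'a \<times> 'a \<times> 'a \<Rightarrow> imat"
  have bl: "bij_betw of_int_mat (SL2_int l) (carrier (SL2 (UNIV :: 'a set)))"
    unfolding U by (rule of_int_mat_bij[OF l])
  have bi: "bij_betw ?i (carrier (SL2 (UNIV :: 'a set))) (SL2_int l)"
    by (rule bij_betw_inv_into[OF bl])
  have bm: "bij_betw of_int_mat (SL2_int m) (carrier (SL2 (of_int ` {0..<m} :: 'c set)))"
    by (rule of_int_mat_bij[OF m])
  have i_mem: "?i X \<in> SL2_int l" if "X \<in> carrier (SL2 (UNIV :: 'a set))" for X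
    using bij_betwE[OF bi] that by blast
  have oi: "of_int_mat (?i X) = X" if "X \<in> carrier (SL2 (UNIV :: 'a set))" for X
    by (rule bij_betw_inv_into_right[OF bl that])
  have i_mult: "?i (mmul X Y) = mulm l (?i X) (?i Y)"
    if XY: "X \<in> carrier (SL2 (UNIV :: 'a set))" "Y \<in> carrier (SL2 (UNIV :: 'a set))" for X Y
  proof -
    have "mmul X Y = of_int_mat (mulm l (?i X) (?i Y))" using oi XY by (simp add: of_int_mat_mulm[OF l])
    then show ?thesis
      using bij_betw_inv_into_left[OF bl mulm_closed[OF i_mem[OF XY(1)] i_mem[OF XY(2)] l(2)]] by simp
  qed
  define \<psi> :: "'a \<times> 'a \<times> 'a \<times> 'a \<Rightarrow> 'c \<times> 'c \<times> 'c \<times> 'c" where "\<psi> = of_int_mat \<circ> \<phi> \<circ> ?i"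
  have "\<psi> X \<in> carrier (SL2 k)" if X: "X \<in> carrier (SL2 UNIV)" for X
  proof -
    have "\<psi> X \<in> carrier (SL2 (of_int ` {0..<m}))"
      using bij_betwE[OF bm] clos[OF i_mem[OF X]] by (simp add: \<psi>_def)
    then show ?thesis using k by (cases "\<psi> X") auto
  qed
  moreover have "\<psi> (mmul X Y) = mmul (\<psi> X) (\<psi> Y)" if "X \<in> carrier (SL2 UNIV)" "Y \<in> carrier (SL2 UNIV)" for X Y
    using that by (simp add: \<psi>_def i_mult hom i_mem of_int_mat_mulm[OF m])
  ultimately have "\<psi> \<in> hom (SL2 (UNIV :: 'a set)) (SL2 k)" by (simp add: hom_def)
  moreover have "inj_on \<psi> (carrier (SL2 (UNIV :: 'a set)))"
    unfolding \<psi>_def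
  proof (intro comp_inj_on)
    show "inj_on ?i (carrier (SL2 UNIV))" using bi bij_betw_def by blast
    show "inj_on \<phi> (?i ` carrier (SL2 UNIV))" using inj bij_betw_imp_surj_on[OF bi] by simp
    show "inj_on (of_int_mat :: imat \<Rightarrow> 'c \<times> 'c \<times> 'c \<times> 'c) (\<phi> ` ?i ` carrier (SL2 (UNIV :: 'a set)))"
      using bm clos bij_betw_imp_surj_on[OF bi]
      by (auto simp: bij_betw_def intro: inj_on_subset)
  qed
  ultimately show ?thesis by blast
qed

text \<open>Two evaluations per matrix, one for each generator, replace the multiplicativity check
  on all pairs.\<close>

lemma SL2_list_facts:
  assumes "list_all (\<lambda>A. word l l (\<lambda>e. (1,e,0,1)) A = A) (sl2_list l)"
    "list_all (\<lambda>A. \<phi> A \<in> SL2_int m) (sl2_list l)"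
    "list_all (\<lambda>A. \<phi> (mulm l A (1,1,0,1)) = mulm m (\<phi> A) u) (sl2_list l)"
    "list_all (\<lambda>A. \<phi> (mulm l A (0,l-1,1,0)) = mulm m (\<phi> A) w) (sl2_list l)"
    "\<phi> (1,0,0,1) = (1,0,0,1) \<and> \<phi> (1,1,0,1) = u \<and> \<phi> (0,l-1,1,0) = w"
    "distinct (map \<phi> (sl2_list l))" "l > 1" "m > 1"
  shows "\<And>A. A \<in> SL2_int l \<Longrightarrow> \<phi> A \<in> SL2_int m" "inj_on \<phi> (SL2_int l)"
    "\<And>A B. A \<in> SL2_int l \<Longrightarrow> B \<in> SL2_int l \<Longrightarrow> \<phi> (mulm l A B) = mulm m (\<phi> A) (\<phi> B)"
proof -
  note assms(1-4)[unfolded list_all_iff set_sl2_list, rule_format]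
  note h = hom_from_generators[of l m \<phi>, OF assms(7,8) this(1,2)]
  show "\<And>A. A \<in> SL2_int l \<Longrightarrow> \<phi> A \<in> SL2_int m"
    using assms(2) by (simp add: list_all_iff set_sl2_list)
  show "inj_on \<phi> (SL2_int l)" using assms(6) by (simp add: distinct_map set_sl2_list)
  show "\<phi> (mulm l A B) = mulm m (\<phi> A) (\<phi> B)" if "A \<in> SL2_int l" "B \<in> SL2_int l" for A B
    by (rule h) (use that assms(3-5) in \<open>simp_all add: list_all_iff set_sl2_list del: mulm_simp SL2_int_iff\<close>)
qed

lemma SL2_3_5:
  assumes "CHAR('c::comm_ring_1) = 5" "of_int ` {0..<5} \<subseteq> (k :: 'c set)"
  shows "\<exists>\<psi> \<in> hom (SL2 (UNIV :: 3 set)) (SL2 k). inj_on \<psi> (carrier (SL2 (UNIV :: 3 set)))"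
proof -
  have 1: "list_all (\<lambda>A. word 3 3 (\<lambda>e. (1,e,0,1)) A = A) (sl2_list 3)" by code_simp
  have 2: "list_all (\<lambda>A. word 3 5 image_pow_3 A \<in> SL2_int 5) (sl2_list 3)" by code_simp
  have 3: "list_all (\<lambda>A. word 3 5 image_pow_3 (mulm 3 A (1,1,0,1)) = mulm 5 (word 3 5 image_pow_3 A) (1,2,1,3)) (sl2_list 3)" by code_simp
  have 4: "list_all (\<lambda>A. word 3 5 image_pow_3 (mulm 3 A (0,3-1,1,0)) = mulm 5 (word 3 5 image_pow_3 A) (0,4,1,0)) (sl2_list 3)" by code_simp
  have 5: "word 3 5 image_pow_3 (1,0,0,1) = (1,0,0,1) \<and> word 3 5 image_pow_3 (1,1,0,1) = (1,2,1,3) \<and> word 3 5 image_pow_3 (0,3-1,1,0) = (0,4,1,0)" by code_simp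
  have 6: "distinct (map (word 3 5 image_pow_3) (sl2_list 3))" by code_simp
  note F = SL2_list_facts[OF 1 2 3 4 5 6]
  show ?thesis by (rule SL2_hom_of_int[of 3 5]) (use assms F UNIV_3 in auto)
qed

lemma SL2_5_11:
  assumes "CHAR('c::comm_ring_1) = 11" "of_int ` {0..<11} \<subseteq> (k :: 'c set)"
  shows "\<exists>\<psi> \<in> hom (SL2 (UNIV :: 5 set)) (SL2 k). inj_on \<psi> (carrier (SL2 (UNIV :: 5 set)))"
proof -
  have 1: "list_all (\<lambda>A. word 5 5 (\<lambda>e. (1,e,0,1)) A = A) (sl2_list 5)" by code_simp
  have 2: "list_all (\<lambda>A. word 5 11 image_pow_5 A \<in> SL2_int 11) (sl2_list 5)" by code_simp
  have 3: "list_all (\<lambda>A. word 5 11 image_pow_5 (mulm 5 A (1,1,0,1)) = mulm 11 (word 5 11 image_pow_5 A) (3,1,0,4)) (sl2_list 5)" by code_simp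
  have 4: "list_all (\<lambda>A. word 5 11 image_pow_5 (mulm 5 A (0,5-1,1,0)) = mulm 11 (word 5 11 image_pow_5 A) (0,10,1,0)) (sl2_list 5)" by code_simp
  have 5: "word 5 11 image_pow_5 (1,0,0,1) = (1,0,0,1) \<and> word 5 11 image_pow_5 (1,1,0,1) = (3,1,0,4) \<and> word 5 11 image_pow_5 (0,5-1,1,0) = (0,10,1,0)" by code_simp
  have 6: "distinct (map (word 5 11 image_pow_5) (sl2_list 5))" by code_simp
  note F = SL2_list_facts[OF 1 2 3 4 5 6]
  show ?thesis by (rule SL2_hom_of_int[of 5 11]) (use assms F UNIV_5 in auto)
qed

lemma card_SL2_3: "card (carrier (SL2 (UNIV :: 3 set))) = 24"
proof -
  have "length (sl2_list 3) = 24" by code_simp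
  then have "card (SL2_int 3) = 24" unfolding set_sl2_list[symmetric] by (metis distinct_card distinct_sl2_list)
  moreover have "bij_betw of_int_mat (SL2_int 3) (carrier (SL2 (UNIV :: 3 set)))"
    unfolding UNIV_3 by (rule of_int_mat_bij) auto
  ultimately show ?thesis using bij_betw_same_card by metis
qed

lemma card_SL2_5: "card (carrier (SL2 (UNIV :: 5 set))) = 120"
proof -
  have "length (sl2_list 5) = 120" by code_simp
  then have "card (SL2_int 5) = 120" unfolding set_sl2_list[symmetric] by (metis distinct_card distinct_sl2_list)
  moreover have "bij_betw of_int_mat (SL2_int 5) (carrier (SL2 (UNIV :: 5 set)))"
    unfolding UNIV_5 by (rule of_int_mat_bij) auto
  ultimately show ?thesis using bij_betw_same_card by metis
qed

section \<open>Quaternions modulo 3 and 7\<close>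

text \<open>The exponent of 2 is even in m^2 and odd in 2 n^2.\<close>

lemma sqrt_2_int_independent:
  fixes m n :: int
  assumes "real_of_int m + real_of_int n * sqrt 2 = 0" shows "m = 0 \<and> n = 0"
proof (rule ccontr)
  assume c: "\<not> ?thesis"
  have "real_of_int m = - (real_of_int n * sqrt 2)" using assms by simp
  then have "(real_of_int m)\<^sup>2 = (real_of_int n)\<^sup>2 * 2" by (simp add: power_mult_distrib)
  then have eq: "m\<^sup>2 = n\<^sup>2 * 2" by (metis of_int_eq_iff of_int_mult of_int_numeral of_int_power)
  with c have nz: "m \<noteq> 0" "n \<noteq> 0" by auto
  have "multiplicity 2 (m\<^sup>2) = 2 * multiplicity 2 m" "multiplicity 2 (n\<^sup>2) = 2 * multiplicity 2 n"
    using nz by (simp_all add: prime_elem_multiplicity_power_distrib)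
  moreover have "multiplicity 2 (n\<^sup>2 * 2) = multiplicity 2 (n\<^sup>2) + 1"
    using nz by (subst prime_elem_multiplicity_mult_distrib) auto
  ultimately have "2 * multiplicity 2 m = 2 * multiplicity 2 n + 1" using eq by simp
  then show False by arith
qed

text \<open>The ring generated by the square root of 2 and 1/2; it contains the coordinates of all
  quaternions in the two groups.\<close>

definition dyad :: "real set" where
  "dyad = {x. \<exists>m n e. x = (real_of_int m + real_of_int n * sqrt 2) / 2 ^ e}"

text \<open>The ring homomorphism from \<open>dyad\<close> sending \<open>sqrt 2\<close> to a square root \<open>r\<close> of 2 in characteristic different from 2.\<close>

definition red :: "'c::field \<Rightarrow> real \<Rightarrow> 'c" where
  "red r x = (THE y. \<exists>m n e. x = (real_of_int m + real_of_int n * sqrt 2) / 2 ^ e \<and>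
     y = (of_int m + of_int n * r) / 2 ^ e)"

text \<open>Independence of the representation: after cross-multiplying by powers of 2, linear
  independence of 1 and \<open>sqrt 2\<close> over the integers identifies the numerators.\<close>

lemma red_eq:
  fixes r :: "'c::field"
  assumes two: "(2::'c) \<noteq> 0"
  shows "red r ((real_of_int m + real_of_int n * sqrt 2) / 2 ^ e) = (of_int m + of_int n * r) / 2 ^ e"
  unfolding red_def
proof (rule the_equality)
  fix y :: 'c
  assume "\<exists>m' n' e'. (real_of_int m + real_of_int n * sqrt 2) / 2 ^ e =
      (real_of_int m' + real_of_int n' * sqrt 2) / 2 ^ e' \<and> y = (of_int m' + of_int n' * r) / 2 ^ e'"
  then obtain m' n' e' where h: "(real_of_int m + real_of_int n * sqrt 2) / 2 ^ e =
      (real_of_int m' + real_of_int n' * sqrt 2) / 2 ^ e'" and y: "y = (of_int m' + of_int n' * r) / 2 ^ e'"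
    by blast
  have "real_of_int (m * 2 ^ e' - m' * 2 ^ e) + real_of_int (n * 2 ^ e' - n' * 2 ^ e) * sqrt 2 = 0"
    using h by (simp add: field_simps)
  from sqrt_2_int_independent[OF this] have mn: "m * 2 ^ e' = m' * 2 ^ e" "n * 2 ^ e' = n' * 2 ^ e" by auto
  have "(of_int m + of_int n * r) * 2 ^ e' = (of_int (m * 2 ^ e') + of_int (n * 2 ^ e') * r :: 'c)"
    by (simp add: algebra_simps)
  also have "\<dots> = (of_int m' + of_int n' * r) * 2 ^ e" unfolding mn by (simp add: algebra_simps)
  finally show "y = (of_int m + of_int n * r) / 2 ^ e"
    using two unfolding y by (simp add: nonzero_divide_eq_eq nonzero_eq_divide_eq)
qed blast

lemma red_ring:
  fixes r :: "'c::field"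
  assumes two: "(2::'c) \<noteq> 0" and r: "r\<^sup>2 = 2" and x: "x \<in> dyad" and y: "y \<in> dyad"
  shows "x + y \<in> dyad \<and> red r (x + y) = red r x + red r y" "x * y \<in> dyad \<and> red r (x * y) = red r x * red r y"
    "- x \<in> dyad \<and> red r (- x) = - red r x"
proof -
  obtain m n e where X: "x = (real_of_int m + real_of_int n * sqrt 2) / 2 ^ e" using x by (auto simp: dyad_def)
  obtain m' n' e' where Y: "y = (real_of_int m' + real_of_int n' * sqrt 2) / 2 ^ e'" using y by (auto simp: dyad_def)
  have p: "(2::'c) ^ i \<noteq> 0" for i using two by simp
  have RX: "red r x = (of_int m + of_int n * r) / 2 ^ e" unfolding X by (rule red_eq[OF two])
  have RY: "red r y = (of_int m' + of_int n' * r) / 2 ^ e'" unfolding Y by (rule red_eq[OF two])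
  have 1: "x + y = (real_of_int (m * 2 ^ e' + m' * 2 ^ e) + real_of_int (n * 2 ^ e' + n' * 2 ^ e) * sqrt 2) / 2 ^ (e + e')"
    unfolding X Y by (simp add: field_simps power_add)
  have "(of_int (m * 2 ^ e' + m' * 2 ^ e) + of_int (n * 2 ^ e' + n' * 2 ^ e) * r) / 2 ^ (e + e')
      = (of_int m + of_int n * r) / 2 ^ e + (of_int m' + of_int n' * r) / 2 ^ e'"
    unfolding add_frac_eq[OF p p] power_add by (simp add: algebra_simps)
  then have "red r (x + y) = red r x + red r y"
    by (simp only: 1 red_eq[OF two] RX RY)
  then show "x + y \<in> dyad \<and> red r (x + y) = red r x + red r y"
    using 1 unfolding dyad_def by blast
  have 2: "x * y = (real_of_int (m * m' + 2 * n * n') + real_of_int (m * n' + n * m') * sqrt 2) / 2 ^ (e + e')"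
    unfolding X Y by (simp add: field_simps power_add)
  have "(of_int (m * m' + 2 * n * n') + of_int (m * n' + n * m') * r) / 2 ^ (e + e')
      = (of_int m + of_int n * r) / 2 ^ e * ((of_int m' + of_int n' * r) / 2 ^ e')"
    using r unfolding times_divide_times_eq power_add power2_eq_square
    by (simp add: algebra_simps)
  then have "red r (x * y) = red r x * red r y"
    by (simp only: 2 red_eq[OF two] RX RY)
  then show "x * y \<in> dyad \<and> red r (x * y) = red r x * red r y"
    using 2 unfolding dyad_def by blast
  have 3: "- x = (real_of_int (- m) + real_of_int (- n) * sqrt 2) / 2 ^ e"
    unfolding X by (simp add: field_simps)
  have "red r (- x) = (of_int (- m) + of_int (- n) * r) / 2 ^ e"
    by (simp only: 3 red_eq[OF two])
  also have "\<dots> = - red r x" by (simp add: RX minus_divide_left)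
  finally have "red r (- x) = - red r x" .
  then show "- x \<in> dyad \<and> red r (- x) = - red r x" using 3 unfolding dyad_def by blast
qed

lemma red_half:
  fixes r :: "'c::field"
  assumes two: "(2::'c) \<noteq> 0"
  shows "real_of_int m / 2 \<in> dyad" "red r (real_of_int m / 2) = of_int m / 2"
    "real_of_int m / sqrt 2 \<in> dyad" "red r (real_of_int m / sqrt 2) = of_int m * r / 2"
    "real_of_int m \<in> dyad" "red r (real_of_int m) = of_int m"
proof -
  have 1: "real_of_int m / 2 = (real_of_int m + real_of_int 0 * sqrt 2) / 2 ^ 1" by simp
  have 2: "real_of_int m / sqrt 2 = (real_of_int 0 + real_of_int m * sqrt 2) / 2 ^ 1"
    by (simp add: real_div_sqrt field_simps)
  have 3: "real_of_int m = (real_of_int m + real_of_int 0 * sqrt 2) / 2 ^ 0" by simp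
  show "real_of_int m / 2 \<in> dyad" "real_of_int m / sqrt 2 \<in> dyad" "real_of_int m \<in> dyad"
    using 1 2 3 unfolding dyad_def by blast+
  show "red r (real_of_int m / 2) = of_int m / 2" unfolding 1 red_eq[OF two] by simp
  show "red r (real_of_int m / sqrt 2) = of_int m * r / 2" unfolding 2 red_eq[OF two] by simp
  show "red r (real_of_int m) = of_int m" by (subst 3, subst red_eq[OF two]) simp
qed

text \<open>The matrix of \<open>a + b i + c j + d k\<close> for \<open>i = (0,1,-1,0)\<close> and \<open>j = (\<alpha>,\<beta>,\<beta>,-\<alpha>)\<close>, where \<open>\<alpha>\<^sup>2 + \<beta>\<^sup>2 = -1\<close>.\<close>

definition quat_mat :: "'c::field \<Rightarrow> 'c \<Rightarrow> 'c \<times> 'c \<times> 'c \<times> 'c \<Rightarrow> 'c \<times> 'c \<times> 'c \<times> 'c" where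
  "quat_mat \<alpha> \<beta> = (\<lambda>(a,b,c,d). (a + c * \<alpha> + d * \<beta>, b + c * \<beta> - d * \<alpha>, - b + c * \<beta> - d * \<alpha>, a - c * \<alpha> - d * \<beta>))"

lemma quat_mat_inj:
  fixes \<alpha> \<beta> :: "'c::field"
  assumes two: "(2::'c) \<noteq> 0" and ab: "\<alpha>\<^sup>2 + \<beta>\<^sup>2 = -1"
  shows "inj (quat_mat \<alpha> \<beta>)"
proof (rule injI)
  fix x y :: "'c \<times> 'c \<times> 'c \<times> 'c"
  assume eq: "quat_mat \<alpha> \<beta> x = quat_mat \<alpha> \<beta> y"
  obtain a b c d where x: "x = (a,b,c,d)" by (cases x)
  obtain a' b' c' d' where y: "y = (a',b',c',d')" by (cases y)
  define A B C D where "A = a - a'" and "B = b - b'" and "C = c - c'" and "D = d - d'"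
  have e: "A + (C * \<alpha> + D * \<beta>) = 0" "B + (C * \<beta> - D * \<alpha>) = 0" "- B + (C * \<beta> - D * \<alpha>) = 0" "A - (C * \<alpha> + D * \<beta>) = 0"
    using eq unfolding x y A_def B_def C_def D_def by (simp_all add: quat_mat_def algebra_simps)
  have AB: "2 * A = 0" "2 * B = 0" using e by (auto simp: algebra_simps mult_2 add_eq_0_iff)
  then have "A = 0" "B = 0" using two by auto
  then have f: "C * \<alpha> + D * \<beta> = 0" "C * \<beta> - D * \<alpha> = 0" using e by auto
  have "\<alpha> * (C * \<alpha> + D * \<beta>) + \<beta> * (C * \<beta> - D * \<alpha>) = C * (\<alpha>\<^sup>2 + \<beta>\<^sup>2)"
    "\<beta> * (C * \<alpha> + D * \<beta>) - \<alpha> * (C * \<beta> - D * \<alpha>) = D * (\<alpha>\<^sup>2 + \<beta>\<^sup>2)"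
    by (simp_all add: power2_eq_square algebra_simps)
  then have "C = 0" "D = 0" unfolding f ab by auto
  with \<open>A = 0\<close> \<open>B = 0\<close> show "x = y" unfolding x y A_def B_def C_def D_def by simp
qed

definition red4 :: "'c::field \<Rightarrow> real \<times> real \<times> real \<times> real \<Rightarrow> 'c \<times> 'c \<times> 'c \<times> 'c" where
  "red4 r = (\<lambda>(a,b,c,d). (red r a, red r b, red r c, red r d))"

lemma quat_mat_mult:
  fixes \<alpha> \<beta> r :: "'c::field"
  assumes two: "(2::'c) \<noteq> 0" and r: "r\<^sup>2 = 2" and ab: "\<alpha>\<^sup>2 + \<beta>\<^sup>2 = -1"
    and x: "x \<in> dyad \<times> dyad \<times> dyad \<times> dyad" and y: "y \<in> dyad \<times> dyad \<times> dyad \<times> dyad"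
  shows "quat_mat \<alpha> \<beta> (red4 r (qmult x y)) = mmul (quat_mat \<alpha> \<beta> (red4 r x)) (quat_mat \<alpha> \<beta> (red4 r y))"
proof -
  obtain a b c d where X: "x = (a,b,c,d)" "a \<in> dyad" "b \<in> dyad" "c \<in> dyad" "d \<in> dyad" using x by auto
  obtain a' b' c' d' where Y: "y = (a',b',c',d')" "a' \<in> dyad" "b' \<in> dyad" "c' \<in> dyad" "d' \<in> dyad" using y by auto
  have rmul: "u \<in> dyad \<Longrightarrow> v \<in> dyad \<Longrightarrow> u * v \<in> dyad \<and> red r (u * v) = red r u * red r v" for u v
    by (rule red_ring(2)[OF two r])
  have radd: "u \<in> dyad \<Longrightarrow> v \<in> dyad \<Longrightarrow> u + v \<in> dyad \<and> red r (u + v) = red r u + red r v" for u v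
    by (rule red_ring(1)[OF two r])
  have rsub: "u \<in> dyad \<Longrightarrow> v \<in> dyad \<Longrightarrow> u - v \<in> dyad \<and> red r (u - v) = red r u - red r v" for u v
    using radd[of u "- v"] red_ring(3)[OF two r, of v v] by simp
  define f where "f = red r"
  have prod: "red4 r (qmult x y) = (f a * f a' - f b * f b' - f c * f c' - f d * f d',
      f a * f b' + f b * f a' + f c * f d' - f d * f c',
      f a * f c' - f b * f d' + f c * f a' + f d * f b',
      f a * f d' + f b * f c' - f c * f b' + f d * f a')"
    unfolding X Y red4_def qmult_def f_def prod.case
    using X(2-) Y(2-) by (simp only: rmul radd rsub)
  have ab': "\<alpha> * \<alpha> = - 1 - \<beta> * \<beta>" using ab by (simp add: power2_eq_square algebra_simps)
  have ab2: "\<alpha> * (\<alpha> * z) = - z - \<beta> * (\<beta> * z)" for z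
    unfolding mult.assoc[symmetric, of \<alpha> \<alpha> z] ab' by (simp add: algebra_simps)
  have id: "quat_mat \<alpha> \<beta> (u * u' - v * v' - w * w' - z * z', u * v' + v * u' + w * z' - z * w',
      u * w' - v * z' + w * u' + z * v', u * z' + v * w' - w * v' + z * u')
    = mmul (quat_mat \<alpha> \<beta> (u,v,w,z)) (quat_mat \<alpha> \<beta> (u',v',w',z'))" for u v w z u' v' w' z'
    by (simp add: quat_mat_def algebra_simps ab' ab2)
  show ?thesis unfolding prod id unfolding X Y red4_def f_def by simp
qed

text \<open>The quaternion norm becomes the determinant, so quaternions of norm 1 land in
  SL2.\<close>

lemma det_quat_mat:
  assumes ab: "\<alpha>\<^sup>2 + \<beta>\<^sup>2 = (-1 :: 'c::field)"
  shows "(a + c * \<alpha> + d * \<beta>) * (a - c * \<alpha> - d * \<beta>) - (b + c * \<beta> - d * \<alpha>) * (- b + c * \<beta> - d * \<alpha>)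
    = a * a + b * b + c * c + d * d"
proof -
  have "(a + c * \<alpha> + d * \<beta>) * (a - c * \<alpha> - d * \<beta>) - (b + c * \<beta> - d * \<alpha>) * (- b + c * \<beta> - d * \<alpha>)
    = a * a + b * b - (c * c + d * d) * (\<alpha>\<^sup>2 + \<beta>\<^sup>2)" by (simp add: power2_eq_square algebra_simps)
  then show ?thesis unfolding ab by simp
qed

lemma sort_map_mono:
  assumes "mono (f :: int \<Rightarrow> real)" shows "sort (map f xs) = map f (sort xs)"
  by (rule properties_for_sort) (simp_all add: sorted_map_mono[OF _ mono_on_subset[OF assms]])

lemma sum_squares_sort:
  fixes a b c d :: real
  assumes "sort [\<bar>a\<bar>,\<bar>b\<bar>,\<bar>c\<bar>,\<bar>d\<bar>] = ys"
  shows "a * a + b * b + c * c + d * d = sum_list (map (\<lambda>x. x * x) ys)"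
    "\<bar>a\<bar> \<in> set ys" "\<bar>b\<bar> \<in> set ys" "\<bar>c\<bar> \<in> set ys" "\<bar>d\<bar> \<in> set ys"
proof -
  have m: "mset ys = mset [\<bar>a\<bar>,\<bar>b\<bar>,\<bar>c\<bar>,\<bar>d\<bar>]" using assms by (metis mset_sort)
  have "sum_list (map (\<lambda>x. x * x) ys) = sum_list (map (\<lambda>x. x * x) [\<bar>a\<bar>,\<bar>b\<bar>,\<bar>c\<bar>,\<bar>d\<bar>])"
    unfolding sum_mset_sum_list[symmetric] mset_map m ..
  then show "a * a + b * b + c * c + d * d = sum_list (map (\<lambda>x. x * x) ys)" by simp
  have "set ys = set [\<bar>a\<bar>,\<bar>b\<bar>,\<bar>c\<bar>,\<bar>d\<bar>]" using m by (metis set_mset_mset)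
  then show "\<bar>a\<bar> \<in> set ys" "\<bar>b\<bar> \<in> set ys" "\<bar>c\<bar> \<in> set ys" "\<bar>d\<bar> \<in> set ys" by auto
qed

section \<open>The two quaternion groups as scaled integer points on spheres\<close>

definition sphere_list :: "int \<Rightarrow> int \<Rightarrow> imat list" where
  "sphere_list b N = filter (\<lambda>(x,y,z,w). x * x + y * y + z * z + w * w = N)
     (List.product [-b..b] (List.product [-b..b] (List.product [-b..b] [-b..b])))"

definition sphere :: "int \<Rightarrow> imat set" where
  "sphere N = {(x,y,z,w). x * x + y * y + z * z + w * w = N}"

lemma set_sphere_list: assumes "N < (b + 1) * (b + 1)" "b \<ge> 0" shows "set (sphere_list b N) = sphere N"
proof -
  have "-b \<le> x \<and> x \<le> b" if "x * x \<le> N" for x :: int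
  proof -
    have "\<bar>x\<bar> * \<bar>x\<bar> < (b + 1) * (b + 1)" using that assms by simp
    then have "\<bar>x\<bar> < b + 1" using assms(2) by (meson abs_ge_zero linorder_not_le mult_mono add_nonneg_nonneg zero_le_one)
    then show ?thesis by auto
  qed
  then have *: "-b \<le> x \<and> x \<le> b" if "x * x + r = N" "r \<ge> 0" for x r :: int
    using that by (metis le_add_same_cancel1)
  have sq: "x * x \<ge> 0" for x :: int by simp
  show ?thesis
    unfolding sphere_list_def sphere_def
    by (auto intro!: *[THEN conjunct1] *[THEN conjunct2])
qed

lemma sphere_lists: "set (sphere_list 1 1) = sphere 1" "set (sphere_list 1 2) = sphere 2"
    "set (sphere_list 2 4) = sphere 4"
  by (rule set_sphere_list; simp)+

lemma card_sphere:
  "card (sphere 1) = 8" "card (sphere 2) = 24" "card (sphere 4) = 24"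
proof -
  have d: "distinct (sphere_list b N)" for b N
    by (simp add: sphere_list_def distinct_product)
  have "length (sphere_list 1 1) = 8" "length (sphere_list 1 2) = 24" "length (sphere_list 2 4) = 24"
    by code_simp+
  then show "card (sphere 1) = 8" "card (sphere 2) = 24" "card (sphere 4) = 24"
    using distinct_card[OF d, of 1 1] distinct_card[OF d, of 1 2] distinct_card[OF d, of 2 4]
      by (simp_all add: sphere_lists)
qed

lemma sphere_sort:
  "(x,y,z,w) \<in> sphere 1 \<Longrightarrow> sort [\<bar>x\<bar>,\<bar>y\<bar>,\<bar>z\<bar>,\<bar>w\<bar>] = [0,0,0,1]"
  "(x,y,z,w) \<in> sphere 2 \<Longrightarrow> sort [\<bar>x\<bar>,\<bar>y\<bar>,\<bar>z\<bar>,\<bar>w\<bar>] = [0,0,1,1]"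
  "(x,y,z,w) \<in> sphere 4 \<Longrightarrow> sort [\<bar>x\<bar>,\<bar>y\<bar>,\<bar>z\<bar>,\<bar>w\<bar>] = [0,0,0,2] \<or>
     sort [\<bar>x\<bar>,\<bar>y\<bar>,\<bar>z\<bar>,\<bar>w\<bar>] = [1,1,1,1]"
proof -
  have "list_all (\<lambda>(x,y,z,w). sort [\<bar>x\<bar>,\<bar>y\<bar>,\<bar>z\<bar>,\<bar>w\<bar>] = [0,0,0,1]) (sphere_list 1 1)"
    "list_all (\<lambda>(x,y,z,w). sort [\<bar>x\<bar>,\<bar>y\<bar>,\<bar>z\<bar>,\<bar>w\<bar>] = [0,0,1,1]) (sphere_list 1 2)"
    "list_all (\<lambda>(x,y,z,w). sort [\<bar>x\<bar>,\<bar>y\<bar>,\<bar>z\<bar>,\<bar>w\<bar>] = [0,0,0,2] \<or>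
      sort [\<bar>x\<bar>,\<bar>y\<bar>,\<bar>z\<bar>,\<bar>w\<bar>] = [1,1,1,1]) (sphere_list 2 4)"
    by code_simp+
  then have "\<forall>(x,y,z,w) \<in> sphere 1. sort [\<bar>x\<bar>,\<bar>y\<bar>,\<bar>z\<bar>,\<bar>w\<bar>] = [0,0,0,1]"
    "\<forall>(x,y,z,w) \<in> sphere 2. sort [\<bar>x\<bar>,\<bar>y\<bar>,\<bar>z\<bar>,\<bar>w\<bar>] = [0,0,1,1]"
    "\<forall>(x,y,z,w) \<in> sphere 4. sort [\<bar>x\<bar>,\<bar>y\<bar>,\<bar>z\<bar>,\<bar>w\<bar>] = [0,0,0,2] \<or>
      sort [\<bar>x\<bar>,\<bar>y\<bar>,\<bar>z\<bar>,\<bar>w\<bar>] = [1,1,1,1]"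
    by (simp_all only: list_all_iff sphere_lists)
  then show "(x,y,z,w) \<in> sphere 1 \<Longrightarrow> sort [\<bar>x\<bar>,\<bar>y\<bar>,\<bar>z\<bar>,\<bar>w\<bar>] = [0,0,0,1]"
    "(x,y,z,w) \<in> sphere 2 \<Longrightarrow> sort [\<bar>x\<bar>,\<bar>y\<bar>,\<bar>z\<bar>,\<bar>w\<bar>] = [0,0,1,1]"
    "(x,y,z,w) \<in> sphere 4 \<Longrightarrow> sort [\<bar>x\<bar>,\<bar>y\<bar>,\<bar>z\<bar>,\<bar>w\<bar>] = [0,0,0,2] \<or>
       sort [\<bar>x\<bar>,\<bar>y\<bar>,\<bar>z\<bar>,\<bar>w\<bar>] = [1,1,1,1]"
    by blast+
qed

definition scale4 :: "real \<Rightarrow> imat \<Rightarrow> real \<times> real \<times> real \<times> real" where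
  "scale4 s = (\<lambda>(x,y,z,w). (x / s, y / s, z / s, w / s))"

lemma scale4_simp [simp]: "scale4 s (x,y,z,w) = (x / s, y / s, z / s, w / s)"
  by (simp add: scale4_def)

lemma sort_scale:
  assumes "s > 0"
  shows "sort [\<bar>x / s\<bar>, \<bar>y / s\<bar>, \<bar>z / s\<bar>, \<bar>w / s\<bar>]
    = map (\<lambda>i. real_of_int i / s) (sort [\<bar>x\<bar>,\<bar>y\<bar>,\<bar>z\<bar>,\<bar>w\<bar>])"
proof -
  have "mono (\<lambda>i. real_of_int i / s)" using assms by (simp add: mono_def divide_right_mono)
  from sort_map_mono[OF this, of "[\<bar>x\<bar>,\<bar>y\<bar>,\<bar>z\<bar>,\<bar>w\<bar>]"] assms show ?thesis by simp
qed

lemma unscale: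
  fixes a b c d :: real
  assumes "\<exists>i::int. a = i / s" "\<exists>i::int. b = i / s" "\<exists>i::int. c = i / s" "\<exists>i::int. d = i / s"
    "a * a + b * b + c * c + d * d = 1" "s \<noteq> 0" "s * s = real_of_int N"
  shows "(a,b,c,d) \<in> scale4 s ` sphere N"
proof -
  obtain i j k l :: int where e: "a = i / s" "b = j / s" "c = k / s" "d = l / s"
    using assms(1-4) by blast
  have "real_of_int (i * i + j * j + k * k + l * l) = s * s * (a * a + b * b + c * c + d * d)"
    using assms(6) unfolding e by (simp add: field_simps)
  then have "i * i + j * j + k * k + l * l = N" using assms(5,7) by (metis mult.right_neutral of_int_eq_iff)
  then show ?thesis using e by (force simp: sphere_def)
qed

lemma carrier_quaternion: "carrier quaternion_group = scale4 1 ` sphere 1"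
proof
  show "scale4 1 ` sphere 1 \<subseteq> carrier quaternion_group"
  proof
    fix g assume "g \<in> scale4 1 ` sphere 1"
    then obtain x y z w where g: "g = scale4 1 (x,y,z,w)" "(x,y,z,w) \<in> sphere 1" by (metis imageE prod_cases4)
    have "map (\<lambda>i. real_of_int i / 1) [0,0,0,1] = [0,0,0,1]" by simp
    with sort_scale[of 1 x y z w] sphere_sort(1)[OF g(2)]
    have "sort [\<bar>x / 1\<bar>, \<bar>y / 1\<bar>, \<bar>z / 1\<bar>, \<bar>w / 1\<bar>] = [0,0,0,1::real]" by (metis zero_less_one)
    then show "g \<in> carrier quaternion_group"
      unfolding g(1) quaternion_group_def scale4_simp
      by (simp only: partial_object.select_convs mem_Collect_eq prod.case)
  qed
  show "carrier quaternion_group \<subseteq> scale4 1 ` sphere 1"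
  proof
    fix g assume "g \<in> carrier quaternion_group"
    then obtain a b c d where g: "g = (a,b,c,d)" "sort [\<bar>a\<bar>,\<bar>b\<bar>,\<bar>c\<bar>,\<bar>d\<bar>] = [0,0,0,1]"
      by (auto simp: quaternion_group_def)
    note s = sum_squares_sort[OF g(2)]
    have h: "\<exists>i::int. u = i / 1" if "\<bar>u\<bar> \<in> set [0,0,0,1]" for u :: real
    proof -
      have "u = real_of_int 0 / 1 \<or> u = real_of_int 1 / 1 \<or> u = real_of_int (-1) / 1" using that by auto
      then show ?thesis by blast
    qed
    show "g \<in> scale4 1 ` sphere 1" unfolding g(1)
        by (rule unscale[OF h[OF s(2)] h[OF s(3)] h[OF s(4)] h[OF s(5)]]) (use s(1) in simp_all)
  qed
qed

text \<open>The first part consists of the 24 Hurwitz units, the second of the remaining coset of 24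
  elements.\<close>

lemma carrier_binary_octahedral:
  "carrier binary_octahedral_group = scale4 2 ` sphere 4 \<union> scale4 (sqrt 2) ` sphere 2"
proof
  show "scale4 2 ` sphere 4 \<union> scale4 (sqrt 2) ` sphere 2 \<subseteq> carrier binary_octahedral_group"
  proof
    fix g assume "g \<in> scale4 2 ` sphere 4 \<union> scale4 (sqrt 2) ` sphere 2"
    then consider x y z w where "g = scale4 2 (x,y,z,w)" "(x,y,z,w) \<in> sphere 4"
      | x y z w where "g = scale4 (sqrt 2) (x,y,z,w)" "(x,y,z,w) \<in> sphere 2" by (metis UnE imageE prod_cases4)
    then show "g \<in> carrier binary_octahedral_group"
    proof cases
      case 1
      have "map (\<lambda>i. real_of_int i / 2) [0,0,0,2] = [0,0,0,1]"
        "map (\<lambda>i. real_of_int i / 2) [1,1,1,1] = [1/2,1/2,1/2,1/2]" by simp_all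
      with sort_scale[of 2 x y z w] sphere_sort(3)[OF 1(2)]
      have "sort [\<bar>x / 2\<bar>, \<bar>y / 2\<bar>, \<bar>z / 2\<bar>, \<bar>w / 2\<bar>] \<in>
          {[0,0,0,1], [1/2,1/2,1/2,1/2], [0,0,1/sqrt 2,1/sqrt 2::real]}" by (metis insertCI zero_less_numeral)
      then show ?thesis
        unfolding 1(1) binary_octahedral_group_def scale4_simp
        by (simp only: partial_object.select_convs mem_Collect_eq prod.case)
    next
      case 2
      have "map (\<lambda>i. real_of_int i / sqrt 2) [0,0,1,1] = [0,0,1/sqrt 2,1/sqrt 2]" by simp
      with sort_scale[of "sqrt 2" x y z w] sphere_sort(2)[OF 2(2)]
      have "sort [\<bar>x / sqrt 2\<bar>, \<bar>y / sqrt 2\<bar>, \<bar>z / sqrt 2\<bar>, \<bar>w / sqrt 2\<bar>] \<in>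
          {[0,0,0,1], [1/2,1/2,1/2,1/2], [0,0,1/sqrt 2,1/sqrt 2::real]}"
        by (metis insertCI real_sqrt_gt_zero zero_less_numeral)
      then show ?thesis
        unfolding 2(1) binary_octahedral_group_def scale4_simp
        by (simp only: partial_object.select_convs mem_Collect_eq prod.case)
    qed
  qed
  show "carrier binary_octahedral_group \<subseteq> scale4 2 ` sphere 4 \<union> scale4 (sqrt 2) ` sphere 2"
  proof
    fix g assume "g \<in> carrier binary_octahedral_group"
    then obtain a b c d where g: "g = (a,b,c,d)" and "sort [\<bar>a\<bar>,\<bar>b\<bar>,\<bar>c\<bar>,\<bar>d\<bar>] \<in>
      {[0,0,0,1], [1/2,1/2,1/2,1/2], [0,0,1/sqrt 2,1/sqrt 2]}"
      by (auto simp: binary_octahedral_group_def)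
    then consider "sort [\<bar>a\<bar>,\<bar>b\<bar>,\<bar>c\<bar>,\<bar>d\<bar>] = [0,0,0,1]" | "sort [\<bar>a\<bar>,\<bar>b\<bar>,\<bar>c\<bar>,\<bar>d\<bar>] = [1/2,1/2,1/2,1/2]"
      | "sort [\<bar>a\<bar>,\<bar>b\<bar>,\<bar>c\<bar>,\<bar>d\<bar>] = [0,0,1/sqrt 2,1/sqrt 2]" by blast
    then show "g \<in> scale4 2 ` sphere 4 \<union> scale4 (sqrt 2) ` sphere 2"
    proof cases
      case 1
      note s = sum_squares_sort[OF 1]
      have h: "\<exists>i::int. u = i / 2" if "\<bar>u\<bar> \<in> set [0,0,0,1]" for u :: real
      proof -
        have "u = real_of_int 0 / 2 \<or> u = real_of_int 2 / 2 \<or> u = real_of_int (-2) / 2" using that by auto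
        then show ?thesis by blast
      qed
      have "g \<in> scale4 2 ` sphere 4" unfolding g
        by (rule unscale[OF h[OF s(2)] h[OF s(3)] h[OF s(4)] h[OF s(5)]]) (use s(1) in simp_all)
      then show ?thesis ..
    next
      case 2
      note s = sum_squares_sort[OF 2]
      have h: "\<exists>i::int. u = i / 2" if "\<bar>u\<bar> \<in> set [1/2,1/2,1/2,1/2]" for u :: real
      proof -
        have "u = real_of_int 1 / 2 \<or> u = real_of_int (-1) / 2" using that by auto
        then show ?thesis by blast
      qed
      have "g \<in> scale4 2 ` sphere 4" unfolding g
        by (rule unscale[OF h[OF s(2)] h[OF s(3)] h[OF s(4)] h[OF s(5)]]) (use s(1) in simp_all)
      then show ?thesis ..
    next
      case 3
      note s = sum_squares_sort[OF 3]
      have h: "\<exists>i::int. u = i / sqrt 2" if "\<bar>u\<bar> \<in> set [0,0,1/sqrt 2,1/sqrt 2]" for u :: real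
      proof -
        have "u = real_of_int 0 / sqrt 2 \<or> u = real_of_int 1 / sqrt 2 \<or> u = real_of_int (-1) / sqrt 2"
          using that by (auto simp: abs_if split: if_splits)
        then show ?thesis by blast
      qed
      have "g \<in> scale4 (sqrt 2) ` sphere 2" unfolding g
        by (rule unscale[OF h[OF s(2)] h[OF s(3)] h[OF s(4)] h[OF s(5)]]) (use s(1) in simp_all)
      then show ?thesis ..
    qed
  qed
qed

definition qint :: "imat \<Rightarrow> imat \<Rightarrow> imat" where
  "qint = (\<lambda>(a1,b1,c1,d1) (a2,b2,c2,d2).
     (a1*a2 - b1*b2 - c1*c2 - d1*d2, a1*b2 + b1*a2 + c1*d2 - d1*c2,
      a1*c2 - b1*d2 + c1*a2 + d1*b2, a1*d2 + b1*c2 - c1*b2 + d1*a2))"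

lemma qint_sphere: "x \<in> sphere M \<Longrightarrow> y \<in> sphere N \<Longrightarrow> qint x y \<in> sphere (M * N)"
  by (auto simp: sphere_def qint_def) (simp add: algebra_simps)

lemma qmult_scale4: "qmult (scale4 s x) (scale4 t y) = scale4 (s * t) (qint x y)"
  by (cases x; cases y) (simp add: qmult_def qint_def add_divide_distrib diff_divide_distrib mult.commute[of t s])

lemma sphere_4_parity:
  assumes "(x,y,z,w) \<in> sphere 4"
  shows "even y = even x" "even z = even x" "even w = even x"
proof -
  have "list_all (\<lambda>(x,y,z,w). even y = even x \<and> even z = even x \<and> even w = even x) (sphere_list 2 4)"
    by code_simp
  then have "\<forall>(x,y,z,w) \<in> sphere 4. even y = even x \<and> even z = even x \<and> even w = even x"
    by (simp only: list_all_iff sphere_lists)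
  from bspec[OF this assms] show "even y = even x" "even z = even x" "even w = even x" by simp_all
qed

lemma sphere_2_parity: assumes "(x,y,z,w) \<in> sphere 2" shows "even w = (even x = (even y = even z))"
proof -
  have "even (x * x + y * y + z * z + w * w)" using assms by (simp add: sphere_def)
  then show ?thesis by auto
qed

definition even4 :: "imat \<Rightarrow> bool" where "even4 = (\<lambda>(x,y,z,w). even x \<and> even y \<and> even z \<and> even w)"

text \<open>A product must be divisible by 2 to return to its proper scale. This holds because the
  coordinates of a point of norm 4 have equal parity and those of a point of norm 2 have even
  sum.\<close>

lemma even4_qint:
  "x \<in> sphere 4 \<Longrightarrow> y \<in> sphere 4 \<Longrightarrow> even4 (qint x y)"
  "x \<in> sphere 4 \<Longrightarrow> y \<in> sphere 2 \<Longrightarrow> even4 (qint x y)"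
  "x \<in> sphere 2 \<Longrightarrow> y \<in> sphere 4 \<Longrightarrow> even4 (qint x y)"
proof -
  obtain a b c d where x: "x = (a,b,c,d)" by (cases x)
  obtain a' b' c' d' where y: "y = (a',b',c',d')" by (cases y)
  show "x \<in> sphere 4 \<Longrightarrow> y \<in> sphere 4 \<Longrightarrow> even4 (qint x y)"
    unfolding x y by (simp add: even4_def qint_def sphere_4_parity[of a b c d] sphere_4_parity[of a' b' c' d'])
  show "x \<in> sphere 4 \<Longrightarrow> y \<in> sphere 2 \<Longrightarrow> even4 (qint x y)"
    unfolding x y
    by (simp add: even4_def qint_def sphere_4_parity[of a b c d] sphere_2_parity[of a' b' c' d']) blast
  show "x \<in> sphere 2 \<Longrightarrow> y \<in> sphere 4 \<Longrightarrow> even4 (qint x y)"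
    unfolding x y
    by (simp add: even4_def qint_def sphere_2_parity[of a b c d] sphere_4_parity[of a' b' c' d']) blast
qed

lemma scale4_even4:
  assumes "even4 x" "x \<in> sphere (4 * N)" shows "scale4 (2 * s) x \<in> scale4 s ` sphere N"
proof -
  obtain a b c d where x: "x = (2 * a, 2 * b, 2 * c, 2 * d)"
    using assms(1) by (cases x) (auto simp: even4_def elim!: evenE)
  then have "scale4 (2 * s) x = scale4 s (a,b,c,d)" by simp
  moreover have "(a,b,c,d) \<in> sphere N" using assms(2) by (simp add: x sphere_def)
  ultimately show ?thesis by blast
qed

lemma quaternion_closed:
  assumes "x \<in> carrier quaternion_group" "y \<in> carrier quaternion_group"
  shows "qmult x y \<in> carrier quaternion_group"
  using assms qint_sphere[of _ 1 _ 1] unfolding carrier_quaternion by (auto simp: qmult_scale4 simp del: scale4_simp)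

lemma octahedral_closed:
  assumes "x \<in> carrier binary_octahedral_group" "y \<in> carrier binary_octahedral_group"
  shows "qmult x y \<in> carrier binary_octahedral_group"
proof -
  let ?C = "scale4 2 ` sphere 4 \<union> scale4 (sqrt 2) ` sphere 2"
  have 1: "qmult (scale4 2 a) (scale4 2 b) \<in> ?C" if "a \<in> sphere 4" "b \<in> sphere 4" for a b
    using scale4_even4[OF even4_qint(1)[OF that], of 4 2] qint_sphere[OF that]
    by (simp add: qmult_scale4 del: scale4_simp)
  have 2: "qmult (scale4 2 a) (scale4 (sqrt 2) b) \<in> ?C" if "a \<in> sphere 4" "b \<in> sphere 2" for a b
    using scale4_even4[OF even4_qint(2)[OF that], of 2 "sqrt 2"] qint_sphere[OF that]
    by (simp add: qmult_scale4 del: scale4_simp)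
  have 3: "qmult (scale4 (sqrt 2) a) (scale4 2 b) \<in> ?C" if "a \<in> sphere 2" "b \<in> sphere 4" for a b
    using scale4_even4[OF even4_qint(3)[OF that], of 2 "sqrt 2"] qint_sphere[OF that]
    by (simp add: qmult_scale4 mult.commute[of "sqrt 2"] del: scale4_simp)
  have 4: "qmult (scale4 (sqrt 2) a) (scale4 (sqrt 2) b) \<in> ?C" if "a \<in> sphere 2" "b \<in> sphere 2" for a b
    using qint_sphere[OF that] by (simp add: qmult_scale4 del: scale4_simp)
  show ?thesis using assms 1 2 3 4 unfolding carrier_binary_octahedral by blast
qed

lemma scale4_inj: assumes "s \<noteq> 0" shows "inj (scale4 s)"
  by (rule injI) (use assms in \<open>auto simp: scale4_def\<close>)

lemma norm_scaled:
  assumes "(a,b,c,d) \<in> scale4 2 ` sphere 4 \<union> scale4 (sqrt 2) ` sphere 2"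
  shows "a * a + b * b + c * c + d * d = 1"
proof -
  have "a * a + b * b + c * c + d * d = 1"
    if s: "(a,b,c,d) = scale4 s (x,y,z,w)" "(x,y,z,w) \<in> sphere N" "s * s = real_of_int N" "s \<noteq> 0" for s x y z w N
  proof -
    have "real_of_int (x * x + y * y + z * z + w * w) = s * s" using s(2,3) by (simp add: sphere_def)
    moreover have "a * a + b * b + c * c + d * d = real_of_int (x * x + y * y + z * z + w * w) / (s * s)"
      using s(1) by (simp add: add_divide_distrib)
    ultimately show ?thesis using s(4) by simp
  qed
  note * = this[of 2 _ _ _ _ 4] this[of "sqrt 2" _ _ _ _ 2]
  from assms obtain u where "(a,b,c,d) = scale4 2 u \<and> u \<in> sphere 4 \<or> (a,b,c,d) = scale4 (sqrt 2) u \<and> u \<in> sphere 2"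
    by blast
  then show ?thesis using * by (cases u) (auto simp del: scale4_simp)
qed

lemma card_quaternion: "card (carrier quaternion_group) = 8"
  using card_sphere(1) unfolding carrier_quaternion by (simp add: card_image inj_on_subset[OF scale4_inj])

lemma card_octahedral: "card (carrier binary_octahedral_group) = 48"
proof -
  have "scale4 2 ` sphere 4 \<inter> scale4 (sqrt 2) ` sphere 2 = {}"
  proof (rule ccontr)
    assume "\<not> ?thesis"
    then obtain g where g: "g \<in> scale4 2 ` sphere 4" "g \<in> scale4 (sqrt 2) ` sphere 2" by blast
    then obtain u v where uv: "u \<in> sphere 4" "v \<in> sphere 2" "scale4 2 u = scale4 (sqrt 2) v" by auto
    obtain x y z w where u: "u = (x,y,z,w)" by (cases u)
    obtain x' y' z' w' where v: "v = (x',y',z',w')" by (cases v)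
    note h = uv[unfolded u v]
    \<comment> \<open>By irrationality of \<open>sqrt 2\<close> the two scalings agree only at 0,
      which lies on no sphere of positive radius.\<close>
    have "i = 0" if "real_of_int i / 2 = real_of_int j / sqrt 2" for i j
    proof -
      have "real_of_int j / sqrt 2 * 2 = real_of_int j * (2 / sqrt 2)" by simp
      then have "real_of_int i = real_of_int j * sqrt 2" using that by (simp add: real_div_sqrt)
      then show ?thesis using sqrt_2_int_independent[of i "- j"] by simp
    qed
    then have "x = 0" "y = 0" "z = 0" "w = 0" using h(3) by auto
    then show False using h(1) by (simp add: sphere_def)
  qed
  moreover have "finite (sphere 4)" "finite (sphere 2)"
    using card_sphere card.infinite by fastforce+
  ultimately show ?thesis
    unfolding carrier_binary_octahedral
    by (simp add: card_Un_disjoint card_image inj_on_subset[OF scale4_inj] card_sphere)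
qed

section \<open>Recognition of regular subgroups and the five models\<close>

context finite_subfield
begin

text \<open>Reduction is injective only on suitable finite sets; \<open>E\<close> is the set of
  coordinates that occur, on which injectivity can be checked directly.\<close>

lemma quaternion_embedding:
  assumes odd: "odd q" and r: "r\<^sup>2 = (2::'c)" and ab: "\<alpha> \<in> k" "\<beta> \<in> k" "\<alpha>\<^sup>2 + \<beta>\<^sup>2 = -1"
    and C: "C \<subseteq> E \<times> E \<times> E \<times> E" "\<And>x y. x \<in> C \<Longrightarrow> y \<in> C \<Longrightarrow> qmult x y \<in> C"
      "\<And>a b c d. (a,b,c,d) \<in> C \<Longrightarrow> a * a + b * b + c * c + d * d = 1"
    and E: "E \<subseteq> dyad" "inj_on (red r) E" "red r ` E \<subseteq> k"
  shows "quat_mat \<alpha> \<beta> \<circ> red4 r \<in> hom \<lparr>carrier = C, monoid.mult = qmult, one = e\<rparr> (SL2 k)"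
    "inj_on (quat_mat \<alpha> \<beta> \<circ> red4 r) C"
proof -
  have two: "(2::'c) \<noteq> 0" by (rule two_nz[OF odd])
  have Cd: "x \<in> dyad \<times> dyad \<times> dyad \<times> dyad" if "x \<in> C" for x using that C(1) E(1) by blast
  have "(quat_mat \<alpha> \<beta> \<circ> red4 r) x \<in> carrier (SL2 k)" if x: "x \<in> C" for x
  proof -
    obtain a b c d where X: "x = (a,b,c,d)" by (cases x)
    then have m: "a \<in> E" "b \<in> E" "c \<in> E" "d \<in> E" using x C(1) by auto
    then have dy: "a \<in> dyad" "b \<in> dyad" "c \<in> dyad" "d \<in> dyad" using E(1) by auto
    have rmul: "u \<in> dyad \<Longrightarrow> v \<in> dyad \<Longrightarrow> u * v \<in> dyad \<and> red r (u * v) = red r u * red r v" for u v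
      by (rule red_ring(2)[OF two r])
    have radd: "u \<in> dyad \<Longrightarrow> v \<in> dyad \<Longrightarrow> u + v \<in> dyad \<and> red r (u + v) = red r u + red r v" for u v
      by (rule red_ring(1)[OF two r])
    have "red r (a * a + b * b + c * c + d * d) =
        red r a * red r a + red r b * red r b + red r c * red r c + red r d * red r d"
      using dy by (simp only: rmul radd)
    moreover have "red r (a * a + b * b + c * c + d * d) = 1"
      using C(3)[of a b c d] x red_half(6)[OF two, of r 1] X by simp
    ultimately have det: "red r a * red r a + red r b * red r b + red r c * red r c + red r d * red r d = 1" by simp
    have "red r a \<in> k" "red r b \<in> k" "red r c \<in> k" "red r d \<in> k" using m E(3) by auto
    then show ?thesis
      using det_quat_mat[OF ab(3), of "red r a" "red r c" "red r d" "red r b"] det ab(1,2)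
      by (simp add: X quat_mat_def red4_def)
  qed
  then show "quat_mat \<alpha> \<beta> \<circ> red4 r \<in> hom \<lparr>carrier = C, monoid.mult = qmult, one = e\<rparr> (SL2 k)"
    using quat_mat_mult[OF two r ab(3)] Cd by (simp add: hom_def)
  show "inj_on (quat_mat \<alpha> \<beta> \<circ> red4 r) C"
  proof (rule comp_inj_on)
    show "inj_on (red4 r) C"
    proof (rule inj_onI)
      fix x y assume xy: "x \<in> C" "y \<in> C" "red4 r x = red4 r y"
      obtain a b c d where X: "x = (a,b,c,d)" by (cases x)
      obtain a' b' c' d' where Y: "y = (a',b',c',d')" by (cases y)
      have m: "a \<in> E" "b \<in> E" "c \<in> E" "d \<in> E" "a' \<in> E" "b' \<in> E" "c' \<in> E" "d' \<in> E"
        using xy(1,2) C(1) unfolding X Y by auto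
      show "x = y" using xy(3) m unfolding X Y by (auto simp: red4_def dest: inj_onD[OF E(2)])
    qed
    show "inj_on (quat_mat \<alpha> \<beta>) (red4 r ` C)"
      using quat_mat_inj[OF two ab(3)] by (rule inj_on_subset) simp
  qed
qed

lemma madj_cancel:
  assumes "g \<in> carrier (SL2 k)" shows "mmul (madj g) (mmul g h) = h"
proof -
  obtain a b c d where g: "g = (a,b,c,d)" by (cases g)
  obtain a' b' c' d' where h: "h = (a',b',c',d')" by (cases h)
  have "a * d - b * c = 1" using assms unfolding g by auto
  then have "mmul (madj g) g = (1,0,0,1)" unfolding g by (simp add: algebra_simps)
  then have "mmul (mmul (madj g) g) h = h" unfolding h by simp
  then show ?thesis by (simp only: mmul_assoc)
qed

lemma mmul_one: "mmul A (1,0,0,1) = (A :: 'c \<times> 'c \<times> 'c \<times> 'c)" by (cases A) simp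

lemma finite_carrier_SL2: "finite (carrier (SL2 k))"
  by (rule finite_subset[of _ "k \<times> k \<times> k \<times> k"]) (auto simp: finite_k)

text \<open>Left multiplication by an element is an injective self-map of a finite set, hence
  surjective.\<close>

lemma closed_imp_inverse_closed:
  assumes sub: "S \<subseteq> carrier (SL2 k)" and mult: "\<And>g h. g \<in> S \<Longrightarrow> h \<in> S \<Longrightarrow> mmul g h \<in> S"
    and ne: "S \<noteq> {}"
  shows "(1,0,0,1) \<in> S" "g \<in> S \<Longrightarrow> madj g \<in> S"
proof -
  have fin: "finite S" using sub finite_carrier_SL2 by (rule finite_subset)
  have adj: "mmul (madj g) (mmul g h) = h" if "g \<in> S" for g h
    using madj_cancel sub that by blast
  have surj: "mmul g ` S = S" if "g \<in> S" for g
  proof (rule endo_inj_surj[OF fin])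
    show "mmul g ` S \<subseteq> S" using mult that by blast
    show "inj_on (mmul g) S" by (metis adj[OF that] inj_onI)
  qed
  show one: "(1,0,0,1) \<in> S"
  proof -
    obtain g where g: "g \<in> S" using ne by blast
    then obtain h where h: "h \<in> S" "mmul g h = g" using surj[OF g] by (metis imageE)
    have "h = mmul (madj g) g" using adj[OF g, of h] h by simp
    also have "\<dots> = (1,0,0,1)" using adj[OF g, of "(1,0,0,1)"] mmul_one by simp
    finally show ?thesis using h by simp
  qed
  show "madj g \<in> S" if g: "g \<in> S" for g
  proof -
    obtain h where h: "h \<in> S" "mmul g h = (1,0,0,1)" using surj[OF g] one by (metis imageE)
    have "h = madj g" using adj[OF g, of h] h mmul_one by simp
    with h show ?thesis by simp
  qed
qed

text \<open>A nontrivial transvection would have order p, which does not divide q^2 - 1. So matrices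
  are determined by their first columns, and counting shows that all q^2 - 1 nonzero vectors
  occur.\<close>

lemma regular_of_card:
  assumes sub: "S \<subseteq> carrier (SL2 k)" and mult: "\<And>g h. g \<in> S \<Longrightarrow> h \<in> S \<Longrightarrow> mmul g h \<in> S"
    and card: "card S = q\<^sup>2 - 1"
  shows "regular_subgroup k S"
proof -
  have q4: "q\<^sup>2 \<ge> 4" using q_gt_1 power_mono[of 2 q 2] by simp
  then have ne: "S \<noteq> {}" using card by auto
  have one: "(1,0,0,1) \<in> S"
    by (rule closed_imp_inverse_closed(1)[OF sub _ ne]) (rule mult)
  have inv: "madj g \<in> S" if "g \<in> S" for g
    by (rule closed_imp_inverse_closed(2)[OF sub _ ne that]) (rule mult)
  have adj: "mmul (madj g) (mmul g h) = h" if "g \<in> S" for g h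
    using madj_cancel sub that by blast
  note mr = mmul_one
  define G where "G = (SL2 k)\<lparr>carrier := S\<rparr>"
  have Gs: "carrier G = S" "monoid.mult G = mmul" "one G = (1,0,0,1)" by (simp_all add: G_def)
  have "group G"
  proof (rule groupI)
    fix x assume x: "x \<in> carrier G"
    then have "mmul (madj x) x = (1,0,0,1)" using adj[of x "(1,0,0,1)"] mr by (simp add: Gs)
    moreover have "madj x \<in> S" using inv x by (simp only: Gs)
    ultimately show "\<exists>y\<in>carrier G. y \<otimes>\<^bsub>G\<^esub> x = \<one>\<^bsub>G\<^esub>" unfolding Gs by blast
  next
    fix x assume "x \<in> carrier G"
    show "\<one>\<^bsub>G\<^esub> \<otimes>\<^bsub>G\<^esub> x = x" by (cases x) (simp add: Gs)
  qed (auto simp: Gs one mult mmul_assoc)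
  then interpret group G .
  have unip: "c = 0" if c: "(1,c,0,1) \<in> S" for c
  proof (rule ccontr)
    assume c0: "c \<noteq> 0"
    have p0: "p > 0" using prime_p by (rule prime_gt_0_nat)
    \<comment> \<open>The powers of the transvection; p of them suffice because exponents count
      modulo p.\<close>
    define H :: "('c \<times> 'c \<times> 'c \<times> 'c) set" where "H = (\<lambda>i. (1, of_nat i * c, 0, 1)) ` {..<p}"
    have Hmem: "(1, of_nat i * c, 0, 1) \<in> H" for i
    proof -
      have "(of_nat i :: 'c) = of_nat (i mod p)" using char_p by (simp add: of_nat_eq_iff_cong_CHAR cong_def)
      then show ?thesis unfolding H_def using p0 by (intro image_eqI[of _ _ "i mod p"]) simp_all
    qed
    have "(1, of_nat i * c, 0, 1) \<in> S" for i
    proof (induction i)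
      case (Suc i)
      then show ?case using mult[OF Suc c] by (simp add: algebra_simps)
    qed (simp add: one)
    then have HS: "H \<subseteq> S" by (auto simp: H_def)
    have Hm: "mmul g h \<in> H" if "g \<in> H" "h \<in> H" for g h
    proof -
      obtain i j where "g = (1, of_nat i * c, 0, 1)" "h = (1, of_nat j * c, 0, 1)" using \<open>g \<in> H\<close> \<open>h \<in> H\<close>
        by (auto simp: H_def)
      then have "mmul g h = (1, of_nat (j + i) * c, 0, 1)" by (simp add: algebra_simps)
      then show ?thesis by (simp only: Hmem)
    qed
    have Hi: "madj g \<in> H" if "g \<in> H" for g
      by (rule closed_imp_inverse_closed(2)[OF _ _ _ that]) (use HS sub Hm that in auto)
    have "subgroup H G"
    proof (rule subgroupI)
      show "H \<subseteq> carrier G" "H \<noteq> {}" using HS Hmem by (auto simp: Gs)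
    next
      fix g assume g: "g \<in> H"
      have "mmul (madj g) g = (1,0,0,1)" using adj[of g "(1,0,0,1)"] mr g HS by auto
      then have "inv\<^bsub>G\<^esub> g = madj g" using Hi[OF g] g HS by (intro inv_equality) (auto simp: Gs)
      then show "inv\<^bsub>G\<^esub> g \<in> H" using Hi[OF g] by simp
    qed (simp add: Gs Hm)
    from lagrange[OF this] have "card H dvd q\<^sup>2 - 1" using card by (metis Gs(1) dvd_triv_right order_def)
    moreover have "card H = p"
    proof -
      have "inj_on (\<lambda>i. (1::'c, of_nat i * c, 0::'c, 1::'c)) {..<p}"
        using c0 char_p by (auto intro!: inj_onI simp: of_nat_eq_iff_cong_CHAR cong_def)
      then show ?thesis by (simp add: H_def card_image)
    qed
    ultimately have "p dvd q\<^sup>2 - 1" by simp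
    moreover have "p dvd q" using q_eq n_pos by simp
    then have "p dvd q\<^sup>2" by (simp add: power2_eq_square)
    ultimately have "p dvd 1" using q4 by (metis dvd_diffD1 le_trans one_le_numeral)
    then show False using prime_p by simp
  qed
  define col :: "'c \<times> 'c \<times> 'c \<times> 'c \<Rightarrow> 'c \<times> 'c" where "col = (\<lambda>(x,z,y,w). (x,y))"
  have "inj_on col S"
  proof (rule inj_onI)
    fix g h assume gh: "g \<in> S" "h \<in> S" "col g = col h"
    obtain x z y w where g: "g = (x,z,y,w)" by (cases g)
    obtain z' w' where h: "h = (x,z',y,w')" using gh(3) unfolding g by (cases h) (auto simp: col_def)
    have d: "x * w - z * y = 1" "x * w' - z' * y = 1" using gh sub unfolding g h by auto
    have "mmul (madj g) h \<in> S" using gh inv mult by blast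
    then have "(1, w * z' - z * w', 0, 1) \<in> S" using d unfolding g h by (simp add: algebra_simps)
    then have "w * z' - z * w' = 0" by (rule unip)
    then have "mmul (madj g) h = (1,0,0,1)" using d unfolding g h by (simp add: algebra_simps)
    moreover have "mmul (madj g) g = (1,0,0,1)" using adj[OF gh(1), of "(1,0,0,1)"] mr by simp
    ultimately have "mmul (madj (madj g)) (mmul (madj g) h) = mmul (madj (madj g)) (mmul (madj g) g)" by simp
    then show "g = h" using adj[OF inv[OF gh(1)]] by simp
  qed
  then have "card (col ` S) = q\<^sup>2 - 1" using card by (simp add: card_image)
  moreover have "card (k \<times> k - {(0,0)}) = q\<^sup>2 - 1"
    using card_k finite_k by (simp add: card_cartesian_product power2_eq_square)
  moreover have "col ` S \<subseteq> k \<times> k - {(0,0)}" using sub by (auto simp: col_def)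
  ultimately have cols: "col ` S = k \<times> k - {(0,0)}"
    by (intro card_subset_eq) (auto simp: finite_k)
  have "\<exists>z w. (x,z,y,w) \<in> S" if "x \<in> k" "y \<in> k" "x \<noteq> 0 \<or> y \<noteq> 0" for x y
  proof -
    have "(x,y) \<in> col ` S" unfolding cols using that by auto
    then show ?thesis by (auto simp: col_def)
  qed
  then show ?thesis
    using sub mult inv unip unfolding regular_subgroup_def transitive_subgroup_def by simp
qed

text \<open>\<open>H\<close> is an arbitrary monoid record, so closure is part of the condition: it
  is what lets products be pulled back through the embedding.\<close>

definition regular_model :: "('g, 'x) monoid_scheme \<Rightarrow> bool" where
  "regular_model H \<longleftrightarrow> (\<forall>x \<in> carrier H. \<forall>y \<in> carrier H. x \<otimes>\<^bsub>H\<^esub> y \<in> carrier H) \<and>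
     (\<exists>\<phi> \<in> hom H (SL2 k). inj_on \<phi> (carrier H) \<and> regular_subgroup k (\<phi> ` carrier H))"

lemma regular_modelI:
  assumes "\<And>x y. x \<in> carrier H \<Longrightarrow> y \<in> carrier H \<Longrightarrow> x \<otimes>\<^bsub>H\<^esub> y \<in> carrier H"
    "\<phi> \<in> hom H (SL2 k)" "inj_on \<phi> (carrier H)" "card (carrier H) = q\<^sup>2 - 1"
  shows "regular_model H"
proof -
  have "regular_subgroup k (\<phi> ` carrier H)"
  proof (rule regular_of_card)
    show "\<phi> ` carrier H \<subseteq> carrier (SL2 k)" using assms(2) by (rule hom_carrier)
    show "mmul g h \<in> \<phi> ` carrier H" if gh: "g \<in> \<phi> ` carrier H" "h \<in> \<phi> ` carrier H" for g h
    proof -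
      obtain x y where "x \<in> carrier H" "y \<in> carrier H" "g = \<phi> x" "h = \<phi> y" using gh by blast
      then have "mmul g h = \<phi> (x \<otimes>\<^bsub>H\<^esub> y)" using hom_mult[OF assms(2)] by simp
      then show ?thesis using assms(1) \<open>x \<in> carrier H\<close> \<open>y \<in> carrier H\<close> by blast
    qed
    show "card (\<phi> ` carrier H) = q\<^sup>2 - 1" using assms(3,4) by (simp add: card_image)
  qed
  with assms show ?thesis unfolding regular_model_def by blast
qed

lemma prime_q_zero: assumes "prime q" shows "CHAR('c) = q" "of_nat q = (0::'c)"
proof -
  have "p dvd q" using q_eq n_pos by simp
  then have "p = q" using assms prime_p primes_dvd_imp_eq by blast
  then show "CHAR('c) = q" "of_nat q = (0::'c)" using char_p of_nat_p by auto
qed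

lemma of_int_k: "of_int i \<in> k" by (cases i) auto

lemma regular_model_cyclic: assumes q: "q = 2" shows "regular_model (integer_mod_group 3)"
proof (rule regular_modelI)
  have z: "(2::'c) = 0" using prime_q_zero(2) q by simp
  have m1: "(-1::'c) = 1" using z by (metis add_eq_0_iff one_add_one)
  \<comment> \<open>\<open>(0,1,1,1)\<close> has order 3 in SL(2,2), and \<open>(1,1,1,0)\<close> is
    its square.\<close>
  define \<phi> :: "int \<Rightarrow> 'c \<times> 'c \<times> 'c \<times> 'c" where
    "\<phi> i = (if i = 0 then (1,0,0,1) else if i = 1 then (0,1,1,1) else (1,1,1,0))" for i
  have c: "carrier (integer_mod_group 3) = {0,1,2}" by (auto simp: carrier_integer_mod_group)
  show "\<phi> \<in> hom (integer_mod_group 3) (SL2 k)"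
    unfolding hom_def c by (auto simp: \<phi>_def z m1)
  show "inj_on \<phi> (carrier (integer_mod_group 3))" unfolding c by (auto simp: inj_on_def \<phi>_def)
  show "card (carrier (integer_mod_group 3)) = q\<^sup>2 - 1" unfolding c q by simp
qed (auto simp: carrier_integer_mod_group)

lemma regular_model_quaternion: assumes q: "q = 3" shows "regular_model quaternion_group"
proof -
  have z: "(3::'c) = 0" using prime_q_zero(2) q by simp
  \<comment> \<open>2 is a nonsquare modulo 3, so \<open>r\<close> lies outside \<open>k\<close>;
    the coordinates here are integers and their reductions do not involve it.\<close>
  obtain r :: 'c where r: "r\<^sup>2 = 2" using nth_root_exists[of 2] by auto
  have odd: "odd q" using q by simp
  have two: "(2::'c) \<noteq> 0" by (rule two_nz[OF odd])
  have "(1::'c)\<^sup>2 + 1\<^sup>2 = 3 - 1" by simp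
  then have ab: "(1::'c)\<^sup>2 + 1\<^sup>2 = -1" unfolding z by simp
  let ?E = "real_of_int ` {-1,0,1}"
  have red: "red r (real_of_int i) = of_int i" for i by (rule red_half(6)[OF two])
  have E: "?E \<subseteq> dyad" "inj_on (red r) ?E" "red r ` ?E \<subseteq> k"
  proof -
    show "?E \<subseteq> dyad" using red_half(5)[OF two] by blast
    have inj: "i = j" if "(of_int i :: 'c) = of_int j" "i \<in> {-1,0,1}" "j \<in> {-1,0,1}" for i j
      using that neg_one_ne[OF odd] by auto
    show "inj_on (red r) ?E"
    proof (rule inj_onI)
      fix x y assume xy: "x \<in> ?E" "y \<in> ?E" "red r x = red r y"
      then obtain i j where ij: "x = real_of_int i" "y = real_of_int j" "i \<in> {-1,0,1}" "j \<in> {-1,0,1}" by blast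
      have "i = j" by (rule inj[OF _ ij(3,4)]) (use xy(3) in \<open>simp only: ij red\<close>)
      then show "x = y" using ij by simp
    qed
    show "red r ` ?E \<subseteq> k" unfolding image_image red using of_int_k by blast
  qed
  have sph: "x \<in> {-1,0,1} \<and> y \<in> {-1,0,1} \<and> z \<in> {-1,0,1} \<and> w \<in> {-1,0,1}"
    if "(x,y,z,w) \<in> sphere 1" for x y z w
  proof -
    have "set (sphere_list 1 1) \<subseteq> {-1..1} \<times> {-1..1} \<times> {-1..1} \<times> {-1..1}"
      by (auto simp: sphere_list_def)
    then show ?thesis using that unfolding sphere_lists by force
  qed
  have C: "carrier quaternion_group \<subseteq> ?E \<times> ?E \<times> ?E \<times> ?E"
    unfolding carrier_quaternion using sph by (fastforce simp: scale4_def)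
  have N: "a * a + b * b + c * c + d * d = 1" if "(a,b,c,d) \<in> carrier quaternion_group" for a b c d
    using that sum_squares_sort(1)[of a b c d "[0,0,0,1]"] by (simp add: quaternion_group_def del: sort_key_simps)
  note emb = quaternion_embedding[OF odd r _ _ ab C quaternion_closed N E]
  have Q: "monoid.mult quaternion_group = qmult" by (simp add: quaternion_group_def)
  have g1: "quat_mat 1 1 \<circ> red4 r \<in> hom quaternion_group (SL2 k)" using emb(1) by (simp add: hom_def Q)
  have g2: "inj_on (quat_mat 1 1 \<circ> red4 r) (carrier quaternion_group)" using emb(2) by simp
  have g3: "card (carrier quaternion_group) = q\<^sup>2 - 1" by (simp add: card_quaternion q)
  have g0: "x \<otimes>\<^bsub>quaternion_group\<^esub> y \<in> carrier quaternion_group"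
    if "x \<in> carrier quaternion_group" "y \<in> carrier quaternion_group" for x y
    using quaternion_closed[OF that] by (simp add: Q)
  from g0 g1 g2 g3 show ?thesis by (rule regular_modelI)
qed

lemma regular_model_octahedral: assumes q: "q = 7" shows "regular_model binary_octahedral_group"
proof -
  have pq: "prime q" using q by simp
  have z: "(7::'c) = 0" using prime_q_zero(2)[OF pq] q by simp
  have odd: "odd q" using q by simp
  have two: "(2::'c) \<noteq> 0" by (rule two_nz[OF odd])
  have inj: "x = y" if "(of_nat x :: 'c) = of_nat y" "x < 7" "y < 7" for x y :: nat
    using that prime_q_zero(1)[OF pq] q by (simp add: of_nat_eq_iff_cong_CHAR cong_def)
  \<comment> \<open>Modulo 7 the root of 2 is 3, and 2, 3 serve as the entries of \<open>j\<close>,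
    since 4 + 9 = -1.\<close>
  have "(3::'c)\<^sup>2 = 2 + 7" by simp
  then have r: "(3::'c)\<^sup>2 = 2" unfolding z by simp
  have "(2::'c)\<^sup>2 + 3\<^sup>2 = 2 * 7 - 1" by simp
  then have ab: "(2::'c)\<^sup>2 + 3\<^sup>2 = -1" unfolding z by simp
  have half: "x / 2 = 4 * x" for x :: 'c
  proof -
    have "4 * x * 2 = 7 * x + x" by simp
    then have "4 * x * 2 = x" unfolding z by simp
    then show ?thesis using two by (simp add: nonzero_divide_eq_eq)
  qed
  \<comment> \<open>The seven coordinate values 0, 1, -1/sqrt 2, -1/2, 1/2, 1/sqrt 2, -1 reduce to
    the residues 0, ..., 6 in this order; \<open>h\<close> lists the numerators.\<close>
  define h :: "nat \<Rightarrow> int" where "h i = [0,2,-1,-1,1,1,-2] ! i" for i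
  define e :: "nat \<Rightarrow> real" where
    "e i = (if i = 2 \<or> i = 5 then real_of_int (h i) / sqrt 2 else real_of_int (h i) / 2)" for i
  have numeral7: "i = 0 \<or> i = 1 \<or> i = 2 \<or> i = 3 \<or> i = 4 \<or> i = 5 \<or> i = 6" if "i < 7" for i :: nat
    using that by linarith
  have h: "(if i = 2 \<or> i = 5 then 12 * h i else 4 * h i) mod 7 = int i mod 7" if "i < 7" for i
    using numeral7[OF that] by (elim disjE) (simp_all add: h_def)
  have red: "red (3::'c) (e i) = of_nat i" if "i < 7" for i
  proof -
    have "red (3::'c) (e i) = of_int (if i = 2 \<or> i = 5 then 12 * h i else 4 * h i)"
      unfolding e_def by (simp add: red_half(2,4)[OF two] half)
    also have "\<dots> = of_int (int i)"
      unfolding of_int_eq_iff_cong_CHAR cong_def using h[OF that] prime_q_zero(1)[OF pq] q by simp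
    finally show ?thesis by simp
  qed
  let ?E = "e ` {..<7}"
  have E: "?E \<subseteq> dyad" "inj_on (red (3::'c)) ?E" "red (3::'c) ` ?E \<subseteq> k"
  proof -
    show "?E \<subseteq> dyad" unfolding e_def using red_half(1,3)[OF two] by auto
    show "inj_on (red (3::'c)) ?E" by (rule inj_onI) (auto simp: red dest: inj)
    show "red (3::'c) ` ?E \<subseteq> k" by (auto simp: red)
  qed
  have E2: "real_of_int x / 2 \<in> ?E" if "x \<in> {-2..2}" for x
  proof -
    have "x = 0 \<or> x = 1 \<or> x = 2 \<or> x = -1 \<or> x = -2" using that by auto
    then have "real_of_int x / 2 = e 0 \<or> real_of_int x / 2 = e 4 \<or> real_of_int x / 2 = e 1
      \<or> real_of_int x / 2 = e 3 \<or> real_of_int x / 2 = e 6"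
      unfolding e_def h_def by (elim disjE) simp_all
    then show ?thesis by (elim disjE) simp_all
  qed
  have E3: "real_of_int x / sqrt 2 \<in> ?E" if "x \<in> {-1..1}" for x
  proof -
    have "x = 0 \<or> x = 1 \<or> x = -1" using that by auto
    then have "real_of_int x / sqrt 2 = e 0 \<or> real_of_int x / sqrt 2 = e 5 \<or> real_of_int x / sqrt 2 = e 2"
      unfolding e_def h_def by (elim disjE) simp_all
    then show ?thesis by (elim disjE) simp_all
  qed
  have "set (sphere_list b N) \<subseteq> {-b..b} \<times> {-b..b} \<times> {-b..b} \<times> {-b..b}" for b N
    by (auto simp: sphere_list_def)
  note sub = this[of 2 4, unfolded sphere_lists] this[of 1 2, unfolded sphere_lists]
  have C: "carrier binary_octahedral_group \<subseteq> ?E \<times> ?E \<times> ?E \<times> ?E"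
  proof -
    have "scale4 2 ` sphere 4 \<subseteq> ?E \<times> ?E \<times> ?E \<times> ?E"
    proof (rule image_subsetI)
      fix u assume "u \<in> sphere 4"
      moreover obtain x y z w where u: "u = (x,y,z,w)" by (cases u)
      ultimately show "scale4 2 u \<in> ?E \<times> ?E \<times> ?E \<times> ?E"
        using subsetD[OF sub(1), of u] unfolding u scale4_simp mem_Sigma_iff by (simp only: E2 simp_thms)
    qed
    moreover have "scale4 (sqrt 2) ` sphere 2 \<subseteq> ?E \<times> ?E \<times> ?E \<times> ?E"
    proof (rule image_subsetI)
      fix u assume "u \<in> sphere 2"
      moreover obtain x y z w where u: "u = (x,y,z,w)" by (cases u)
      ultimately show "scale4 (sqrt 2) u \<in> ?E \<times> ?E \<times> ?E \<times> ?E"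
        using subsetD[OF sub(2), of u] unfolding u scale4_simp mem_Sigma_iff by (simp only: E3 simp_thms)
    qed
    ultimately show ?thesis unfolding carrier_binary_octahedral by blast
  qed
  have N: "a * a + b * b + c * c + d * d = 1" if "(a,b,c,d) \<in> carrier binary_octahedral_group" for a b c d
    using that unfolding carrier_binary_octahedral by (rule norm_scaled)
  note emb = quaternion_embedding[OF odd r _ _ ab C octahedral_closed N E]
  have Q: "monoid.mult binary_octahedral_group = qmult" by (simp add: binary_octahedral_group_def)
  have g1: "quat_mat 2 3 \<circ> red4 3 \<in> hom binary_octahedral_group (SL2 k)" using emb(1) by (simp add: hom_def Q)
  have g2: "inj_on (quat_mat 2 (3::'c) \<circ> red4 3) (carrier binary_octahedral_group)" using emb(2) by simp
  have g3: "card (carrier binary_octahedral_group) = q\<^sup>2 - 1" by (simp add: card_octahedral q)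
  have g0: "x \<otimes>\<^bsub>binary_octahedral_group\<^esub> y \<in> carrier binary_octahedral_group"
    if "x \<in> carrier binary_octahedral_group" "y \<in> carrier binary_octahedral_group" for x y
    using octahedral_closed[OF that] by (simp add: Q)
  from g0 g1 g2 g3 show ?thesis by (rule regular_modelI)
qed

lemma SL2_UNIV_closed:
  assumes "x \<in> carrier (SL2 (UNIV :: 'k::comm_ring_1 set))" "y \<in> carrier (SL2 (UNIV :: 'k set))"
  shows "x \<otimes>\<^bsub>SL2 (UNIV :: 'k set)\<^esub> y \<in> carrier (SL2 (UNIV :: 'k set))"
proof -
  obtain a b c d where x: "x = (a,b,c,d)" by (cases x)
  obtain a' b' c' d' where y: "y = (a',b',c',d')" by (cases y)
  have "(a*a' + b*c') * (c*b' + d*d') - (a*b' + b*d') * (c*a' + d*c') = (a * d - b * c) * (a' * d' - b' * c')"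
    by (simp add: algebra_simps)
  then show ?thesis using assms unfolding x y by simp
qed

lemma regular_model_SL2_3: assumes q: "q = 5" shows "regular_model (SL2 (UNIV :: 3 set))"
proof -
  have "prime q" using q by simp
  then have "CHAR('c) = 5" using prime_q_zero(1) q by simp
  then obtain \<psi> where "\<psi> \<in> hom (SL2 (UNIV :: 3 set)) (SL2 k)" "inj_on \<psi> (carrier (SL2 (UNIV :: 3 set)))"
    using SL2_3_5[of k] of_int_k by auto
  then show ?thesis using SL2_UNIV_closed card_SL2_3 q by (intro regular_modelI) auto
qed

lemma regular_model_SL2_5: assumes q: "q = 11" shows "regular_model (SL2 (UNIV :: 5 set))"
proof -
  have "prime q" using q by simp
  then have "CHAR('c) = 11" using prime_q_zero(1) q by simp
  then obtain \<psi> where "\<psi> \<in> hom (SL2 (UNIV :: 5 set)) (SL2 k)" "inj_on \<psi> (carrier (SL2 (UNIV :: 5 set)))"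
    using SL2_5_11[of k] of_int_k by auto
  then show ?thesis using SL2_UNIV_closed card_SL2_5 q by (intro regular_modelI) auto
qed

text \<open>After conjugation the two embeddings into SL2 have the same image, so one composed with
  the inverse of the other is the isomorphism.\<close>

lemma iso_regular_model:
  assumes H: "regular_model H" and \<phi>: "\<phi> \<in> hom G (SL2 k)" "inj_on \<phi> (carrier G)"
    and R: "regular_subgroup k (\<phi> ` carrier G)"
  shows "G \<cong> H"
proof -
  obtain \<psi> where cl: "\<And>x y. x \<in> carrier H \<Longrightarrow> y \<in> carrier H \<Longrightarrow> x \<otimes>\<^bsub>H\<^esub> y \<in> carrier H"
    and \<psi>: "\<psi> \<in> hom H (SL2 k)" "inj_on \<psi> (carrier H)" "regular_subgroup k (\<psi> ` carrier H)"
    using H unfolding regular_model_def by blast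
  obtain f g where fg: "f \<in> hom (SL2 k) (SL2 k)" "g \<in> hom (SL2 k) (SL2 k)" "inj f" "inj g"
    "f ` \<phi> ` carrier G = g ` \<psi> ` carrier H"
    using regular_subgroups_conjugate[OF R \<psi>(3)] by blast
  define F where "F = f \<circ> \<phi>"
  define K where "K = g \<circ> \<psi>"
  have F: "F \<in> hom G (SL2 k)" "inj_on F (carrier G)"
    unfolding F_def using hom_compose[OF \<phi>(1) fg(1)] comp_inj_on[OF \<phi>(2)] fg(3) inj_on_subset by blast+
  have K: "K \<in> hom H (SL2 k)" "inj_on K (carrier H)"
    unfolding K_def using hom_compose[OF \<psi>(1) fg(2)] comp_inj_on[OF \<psi>(2)] fg(4) inj_on_subset by blast+
  have im: "F ` carrier G = K ` carrier H" using fg(5) by (simp add: F_def K_def image_comp)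
  let ?h = "inv_into (carrier H) K \<circ> F"
  have "bij_betw F (carrier G) (K ` carrier H)" using F(2) im by (simp add: bij_betw_def)
  moreover have "bij_betw (inv_into (carrier H) K) (K ` carrier H) (carrier H)"
    using K(2) by (intro bij_betw_inv_into) (simp add: bij_betw_def)
  ultimately have bij: "bij_betw ?h (carrier G) (carrier H)" by (rule bij_betw_trans)
  have Kh: "K (?h x) = F x" if "x \<in> carrier G" for x
    using that im by (metis comp_apply f_inv_into_f imageI)
  have "?h (x \<otimes>\<^bsub>G\<^esub> y) = ?h x \<otimes>\<^bsub>H\<^esub> ?h y" if xy: "x \<in> carrier G" "y \<in> carrier G" for x y
  proof -
    have m: "?h x \<in> carrier H" "?h y \<in> carrier H" using bij_betwE[OF bij] xy by blast+
    have "F (x \<otimes>\<^bsub>G\<^esub> y) = mmul (F x) (F y)" using hom_mult[OF F(1) xy] by simp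
    also have "\<dots> = K (?h x \<otimes>\<^bsub>H\<^esub> ?h y)" using hom_mult[OF K(1) m] Kh xy by simp
    finally show ?thesis using inv_into_f_f[OF K(2) cl[OF m]] by simp
  qed
  then have "?h \<in> iso G H" using bij bij_betwE[OF bij] by (auto simp: iso_def hom_def)
  then show ?thesis by (rule is_isoI)
qed

end

section \<open>Simple extensions and embeddings\<close>

lemma is_subfieldD:
  assumes "is_subfield K"
  shows "0 \<in> K" "1 \<in> K" "x \<in> K \<Longrightarrow> y \<in> K \<Longrightarrow> x + y \<in> K" "x \<in> K \<Longrightarrow> y \<in> K \<Longrightarrow> x * y \<in> K"
    "x \<in> K \<Longrightarrow> - x \<in> K" "x \<in> K \<Longrightarrow> y \<in> K \<Longrightarrow> x - y \<in> K" "x \<in> K \<Longrightarrow> inverse x \<in> K"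
    "x \<in> K \<Longrightarrow> y \<in> K \<Longrightarrow> x / y \<in> K" "x \<in> K \<Longrightarrow> x ^ n \<in> K"
proof -
  have *: "0 \<in> K" "1 \<in> K" "\<And>x y. x \<in> K \<Longrightarrow> y \<in> K \<Longrightarrow> x + y \<in> K"
    "\<And>x y. x \<in> K \<Longrightarrow> y \<in> K \<Longrightarrow> x * y \<in> K" "\<And>x. x \<in> K \<Longrightarrow> - x \<in> K"
    "\<And>x. x \<in> K \<Longrightarrow> x \<noteq> 0 \<Longrightarrow> inverse x \<in> K"
    using assms unfolding is_subfield_def by simp_all
  have i: "inverse x \<in> K" if "x \<in> K" for x using * that by (cases "x = 0") auto
  show "0 \<in> K" "1 \<in> K" "x \<in> K \<Longrightarrow> y \<in> K \<Longrightarrow> x + y \<in> K" "x \<in> K \<Longrightarrow> y \<in> K \<Longrightarrow> x * y \<in> K"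
    "x \<in> K \<Longrightarrow> - x \<in> K" "x \<in> K \<Longrightarrow> inverse x \<in> K" by (simp_all add: * i)
  show "x \<in> K \<Longrightarrow> y \<in> K \<Longrightarrow> x - y \<in> K" using *(3)[of x "- y"] *(5)[of y] by simp
  show "x \<in> K \<Longrightarrow> y \<in> K \<Longrightarrow> x / y \<in> K" using *(4)[of x "inverse y"] i[of y] by (simp add: divide_inverse)
  show "x \<in> K \<Longrightarrow> x ^ n \<in> K" using *(2,4) by (induction n) auto
qed

lemma subfield_sum: "is_subfield K \<Longrightarrow> (\<And>i. i \<in> A \<Longrightarrow> f i \<in> K) \<Longrightarrow> sum f A \<in> K"
  by (induction A rule: infinite_finite_induct) (auto simp: is_subfieldD)

lemma gen_field_subfield: "is_subfield (gen_field S)"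
  unfolding is_subfield_def gen_field_def by (auto simp: is_subfieldD)

lemma gen_field_contains: "S \<subseteq> gen_field S"
  by (auto simp: gen_field_def)

lemma gen_field_least: "is_subfield K \<Longrightarrow> S \<subseteq> K \<Longrightarrow> gen_field S \<subseteq> K"
  by (auto simp: gen_field_def)

lemma poly_over_simps [simp]:
  assumes "is_subfield K"
  shows "poly_over K 0" "poly_over K 1" "poly_over K (pCons a p) \<longleftrightarrow> a \<in> K \<and> poly_over K p"
  using is_subfieldD(1,2)[OF assms]
  by (auto simp: poly_over_def coeff_pCons split: nat.split)

lemma poly_over_add: "is_subfield K \<Longrightarrow> poly_over K p \<Longrightarrow> poly_over K r \<Longrightarrow> poly_over K (p + r)"
  by (simp add: poly_over_def is_subfieldD)

lemma poly_over_diff: "is_subfield K \<Longrightarrow> poly_over K p \<Longrightarrow> poly_over K r \<Longrightarrow> poly_over K (p - r)"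
  by (simp add: poly_over_def is_subfieldD)

lemma poly_over_uminus: "is_subfield K \<Longrightarrow> poly_over K p \<Longrightarrow> poly_over K (- p)"
  by (simp add: poly_over_def is_subfieldD)

lemma poly_over_mult: "is_subfield K \<Longrightarrow> poly_over K p \<Longrightarrow> poly_over K r \<Longrightarrow> poly_over K (p * r)"
  by (simp add: poly_over_def coeff_mult is_subfieldD subfield_sum)

lemma poly_over_monom: "is_subfield K \<Longrightarrow> a \<in> K \<Longrightarrow> poly_over K (monom a n)"
  by (auto simp: poly_over_def is_subfieldD coeff_monom)

lemma poly_over_mono: "poly_over K p \<Longrightarrow> K \<subseteq> K' \<Longrightarrow> poly_over K' p"
  by (auto simp: poly_over_def)

lemma poly_over_eval: "is_subfield K \<Longrightarrow> poly_over K p \<Longrightarrow> x \<in> K \<Longrightarrow> poly p x \<in> K"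
  by (induction p) (simp_all add: is_subfieldD)

text \<open>Division inside K[X]: the point is that quotient and remainder keep their coefficients
  in \<open>K\<close>.\<close>

lemma poly_over_division:
  assumes K: "is_subfield K" and m: "poly_over K m" "m \<noteq> 0"
  shows "poly_over K P \<Longrightarrow> \<exists>h r. poly_over K h \<and> poly_over K r \<and> P = m * h + r \<and> (r = 0 \<or> degree r < degree m)"
proof (induction "degree P" arbitrary: P rule: less_induct)
  case less
  show ?case
  proof (cases "P = 0 \<or> degree P < degree m")
    case True
    then show ?thesis using less.prems K by (intro exI[of _ 0] exI[of _ P]) auto
  next
    case False
    define c where "c = lead_coeff P / lead_coeff m"
    define h where "h = monom c (degree P - degree m)"
    have "c \<in> K" using less.prems m K by (simp add: c_def is_subfieldD poly_over_def)
    then have h: "poly_over K h" by (simp add: h_def poly_over_monom K)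
    have P': "poly_over K (P - m * h)"
      using less.prems h m K by (simp add: poly_over_diff poly_over_mult)
    have c0: "c \<noteq> 0" using False m by (simp add: c_def)
    have deg: "degree (m * h) = degree P"
    proof -
      have "degree h = degree P - degree m" unfolding h_def by (rule degree_monom_eq[OF c0])
      moreover have "h \<noteq> 0" using c0 by (simp add: h_def)
      ultimately show ?thesis using m(2) False by (simp add: degree_mult_eq)
    qed
    have "lead_coeff (m * h) = lead_coeff P"
    proof -
      have "lead_coeff h = c" unfolding h_def degree_monom_eq[OF c0] by simp
      then have "lead_coeff (m * h) = lead_coeff m * c" by (simp add: lead_coeff_mult)
      then show ?thesis using m(2) by (simp add: c_def)
    qed
    then have "P - m * h = 0 \<or> degree (P - m * h) < degree P"
    proof -
      assume lc: "lead_coeff (m * h) = lead_coeff P"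
      have le: "degree (P - m * h) \<le> degree P" using deg by (metis degree_diff_le order_refl)
      have "coeff (P - m * h) (degree P) = 0" using lc deg by simp
      then show ?thesis using le by (metis leading_coeff_0_iff le_neq_implies_less)
    qed
    then show ?thesis
    proof
      assume "P - m * h = 0"
      then show ?thesis using h K by (intro exI[of _ h] exI[of _ 0]) auto
    next
      assume "degree (P - m * h) < degree P"
      from less.hyps[OF this P'] obtain h' r where
        "poly_over K h'" "poly_over K r" "P - m * h = m * h' + r" "r = 0 \<or> degree r < degree m" by blast
      then show ?thesis
        using h K by (intro exI[of _ "h + h'"] exI[of _ r]) (auto simp: poly_over_add algebra_simps)
    qed
  qed
qed

lemma minimal_polynomial:
  assumes K: "is_subfield K" and alg: "poly_over K P" "P \<noteq> 0" "poly P \<alpha> = 0"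
  obtains m where "poly_over K m" "m \<noteq> 0" "poly m \<alpha> = 0"
    "\<And>r. poly_over K r \<Longrightarrow> poly r \<alpha> = 0 \<Longrightarrow> r \<noteq> 0 \<Longrightarrow> degree m \<le> degree r"
    "\<And>r. poly_over K r \<Longrightarrow> poly r \<alpha> = 0 \<Longrightarrow> \<exists>h. poly_over K h \<and> r = m * h"
proof -
  define S where "S m \<longleftrightarrow> poly_over K m \<and> m \<noteq> 0 \<and> poly m \<alpha> = 0" for m
  have "S P" using alg by (simp add: S_def)
  then obtain m where m: "S m" and min: "\<And>r. S r \<Longrightarrow> degree m \<le> degree r"
    using ex_has_least_nat[of S P degree] by blast
  have dvd: "\<exists>h. poly_over K h \<and> r = m * h" if r: "poly_over K r" "poly r \<alpha> = 0" for r
  proof -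
    obtain h s where h: "poly_over K h" "poly_over K s" "r = m * h + s" "s = 0 \<or> degree s < degree m"
      using poly_over_division[OF K _ _ r(1), of m] m by (auto simp: S_def)
    have "poly s \<alpha> = 0" using h(3) r(2) m by (simp add: S_def)
    then have "s = 0" using h(2,4) min[of s] by (metis S_def linorder_not_le)
    with h show ?thesis by auto
  qed
  show ?thesis by (rule that[of m]) (use m min dvd in \<open>auto simp: S_def\<close>)
qed

text \<open>The ring K[alpha], which is the field K(alpha) as soon as alpha is algebraic over the
  subfield \<open>K\<close>.\<close>

definition adj :: "'c::field set \<Rightarrow> 'c \<Rightarrow> 'c set" where
  "adj K \<alpha> = {poly P \<alpha> | P. poly_over K P}"

lemma adj_contains: assumes "is_subfield K" shows "K \<subseteq> adj K \<alpha>" "\<alpha> \<in> adj K \<alpha>"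
proof -
  show "K \<subseteq> adj K \<alpha>"
  proof
    fix x assume "x \<in> K"
    then have "poly_over K [:x:]" "x = poly [:x:] \<alpha>" using assms by simp_all
    then show "x \<in> adj K \<alpha>" unfolding adj_def by blast
  qed
  have "poly_over K [:0,1:]" "\<alpha> = poly [:0,1:] \<alpha>" using assms by (simp_all add: is_subfieldD)
  then show "\<alpha> \<in> adj K \<alpha>" unfolding adj_def by blast
qed

lemma adj_least: "is_subfield K' \<Longrightarrow> K \<subseteq> K' \<Longrightarrow> \<alpha> \<in> K' \<Longrightarrow> adj K \<alpha> \<subseteq> K'"
  unfolding adj_def using poly_over_eval poly_over_mono by blast

text \<open>Inverses come from Euclid's algorithm: dividing the minimal polynomial by
  \<open>r\<close> replaces \<open>r\<close> by a remainder of smaller degree, whose inverse is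
  known by induction.\<close>

lemma adj_subfield:
  assumes K: "is_subfield K" and alg: "poly_over K P" "P \<noteq> 0" "poly P \<alpha> = 0"
  shows "is_subfield (adj K \<alpha>)"
proof -
  obtain m where m: "poly_over K m" "m \<noteq> 0" "poly m \<alpha> = 0"
    and min: "\<And>r. poly_over K r \<Longrightarrow> poly r \<alpha> = 0 \<Longrightarrow> r \<noteq> 0 \<Longrightarrow> degree m \<le> degree r"
    using minimal_polynomial[OF assms] by metis
  have inv: "\<exists>s. poly_over K s \<and> poly r \<alpha> * poly s \<alpha> = 1"
    if "poly_over K r" "poly r \<alpha> \<noteq> 0" "degree r < degree m" for r
    using that
  proof (induction "degree r" arbitrary: r rule: less_induct)
    case less
    have r0: "r \<noteq> 0" using less.prems by auto
    show ?case
    proof (cases "degree r = 0")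
      case True
      then obtain c where c: "r = [:c:]" by (metis degree_eq_zeroE)
      then have "c \<in> K" "c \<noteq> 0" using less.prems K by simp_all
      then show ?thesis using K c by (intro exI[of _ "[:inverse c:]"]) (simp add: is_subfieldD)
    next
      case False
      obtain h s where h: "poly_over K h" "poly_over K s" "m = r * h + s" "s = 0 \<or> degree s < degree r"
        using poly_over_division[OF K less.prems(1) r0 m(1)] by blast
      have eq: "poly r \<alpha> * poly h \<alpha> + poly s \<alpha> = 0"
        using m(3) unfolding h(3) by simp
      show ?thesis
      proof (cases "poly s \<alpha> = 0")
        case True
        \<comment> \<open>A remainder vanishing at \<open>\<alpha>\<close> must be 0; then
          \<open>h\<close> would vanish at \<open>\<alpha>\<close> with degree below that of
          \<open>m\<close>.\<close>
        have "s = 0" using min[OF h(2) True] h(4) less.prems(3) by linarith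
        then have "poly h \<alpha> = 0" "h \<noteq> 0" "degree m = degree r + degree h"
          using eq less.prems(2) h(3) m(2) r0 by (auto simp: degree_mult_eq)
        then show ?thesis using min[OF h(1)] False by simp
      next
        case s: False
        then have ds: "degree s < degree r" using h(4) by auto
        then obtain t where t: "poly_over K t" "poly s \<alpha> * poly t \<alpha> = 1"
          using less.hyps[OF ds h(2) s] less.prems(3) by auto
        have "poly r \<alpha> * poly (- (h * t)) \<alpha> = - (poly r \<alpha> * poly h \<alpha>) * poly t \<alpha>" by simp
        also have "- (poly r \<alpha> * poly h \<alpha>) = poly s \<alpha>" using eq by (simp add: add_eq_0_iff)
        finally show ?thesis
          using t h(1) K by (intro exI[of _ "- (h * t)"]) (simp add: poly_over_uminus poly_over_mult)
      qed
    qed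
  qed
  have "inverse x \<in> adj K \<alpha>" if "x \<in> adj K \<alpha>" "x \<noteq> 0" for x
  proof -
    obtain r where r: "poly_over K r" "x = poly r \<alpha>" using \<open>x \<in> adj K \<alpha>\<close> by (auto simp: adj_def)
    obtain h s where h: "poly_over K h" "poly_over K s" "r = m * h + s" "s = 0 \<or> degree s < degree m"
      using poly_over_division[OF K m(1,2) r(1)] by blast
    have xs: "x = poly s \<alpha>" unfolding r(2) h(3) by (simp add: m(3))
    then have "s \<noteq> 0" using \<open>x \<noteq> 0\<close> by auto
    then obtain t where "poly_over K t" "x * poly t \<alpha> = 1" using inv[of s] h \<open>x \<noteq> 0\<close> xs by auto
    then have "inverse x = poly t \<alpha>" by (simp add: inverse_unique)
    then show ?thesis using \<open>poly_over K t\<close> by (auto simp: adj_def)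
  qed
  moreover have "x + y \<in> adj K \<alpha>" "x * y \<in> adj K \<alpha>" "- x \<in> adj K \<alpha>"
    if xy: "x \<in> adj K \<alpha>" "y \<in> adj K \<alpha>" for x y
  proof -
    obtain r s where rs: "poly_over K r" "x = poly r \<alpha>" "poly_over K s" "y = poly s \<alpha>"
      using xy by (auto simp: adj_def)
    then have "poly_over K (r + s)" "x + y = poly (r + s) \<alpha>" "poly_over K (r * s)" "x * y = poly (r * s) \<alpha>"
      "poly_over K (- r)" "- x = poly (- r) \<alpha>"
      using K by (simp_all add: poly_over_add poly_over_mult poly_over_uminus)
    then show "x + y \<in> adj K \<alpha>" "x * y \<in> adj K \<alpha>" "- x \<in> adj K \<alpha>"
      unfolding adj_def by blast+
  qed
  moreover have "0 \<in> adj K \<alpha>" "1 \<in> adj K \<alpha>"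
    using adj_contains(1)[OF K, of \<alpha>] is_subfieldD(1,2)[OF K] by blast+
  ultimately show ?thesis unfolding is_subfield_def by simp
qed

text \<open>Only the values on \<open>K\<close> are constrained, though the map is total; the value
  at 1 excludes the zero map.\<close>

definition embedding :: "'c::field set \<Rightarrow> ('c \<Rightarrow> 'c) \<Rightarrow> bool" where
  "embedding K \<sigma> \<longleftrightarrow> (\<forall>x\<in>K. \<forall>y\<in>K. \<sigma> (x + y) = \<sigma> x + \<sigma> y \<and> \<sigma> (x * y) = \<sigma> x * \<sigma> y) \<and> \<sigma> 1 = 1"

lemma embeddingD:
  assumes "is_subfield K" "embedding K \<sigma>"
  shows "x \<in> K \<Longrightarrow> y \<in> K \<Longrightarrow> \<sigma> (x + y) = \<sigma> x + \<sigma> y" "x \<in> K \<Longrightarrow> y \<in> K \<Longrightarrow> \<sigma> (x * y) = \<sigma> x * \<sigma> y"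
    "\<sigma> 0 = 0" "\<sigma> 1 = 1" "x \<in> K \<Longrightarrow> \<sigma> (- x) = - \<sigma> x" "x \<in> K \<Longrightarrow> y \<in> K \<Longrightarrow> \<sigma> (x - y) = \<sigma> x - \<sigma> y"
    "x \<in> K \<Longrightarrow> \<sigma> x = 0 \<longleftrightarrow> x = 0" "x \<in> K \<Longrightarrow> \<sigma> (inverse x) = inverse (\<sigma> x)" "x \<in> K \<Longrightarrow> \<sigma> (x ^ n) = \<sigma> x ^ n"
proof -
  note K = is_subfieldD[OF assms(1)]
  have add: "\<sigma> (x + y) = \<sigma> x + \<sigma> y" and mult: "\<sigma> (x * y) = \<sigma> x * \<sigma> y" if "x \<in> K" "y \<in> K" for x y
    using assms(2) that by (auto simp: embedding_def)
  show "x \<in> K \<Longrightarrow> y \<in> K \<Longrightarrow> \<sigma> (x + y) = \<sigma> x + \<sigma> y" "x \<in> K \<Longrightarrow> y \<in> K \<Longrightarrow> \<sigma> (x * y) = \<sigma> x * \<sigma> y"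
    by (simp_all add: add mult)
  show zero: "\<sigma> 0 = 0" using add[OF K(1) K(1)] by (metis add_0 add_cancel_right_right)
  show one: "\<sigma> 1 = 1" using assms(2) by (simp add: embedding_def)
  have neg: "\<sigma> (- x) = - \<sigma> x" if "x \<in> K" for x
    using add[OF that K(5)[OF that]] zero by (simp add: add_eq_0_iff)
  then show "x \<in> K \<Longrightarrow> \<sigma> (- x) = - \<sigma> x" .
  show "x \<in> K \<Longrightarrow> y \<in> K \<Longrightarrow> \<sigma> (x - y) = \<sigma> x - \<sigma> y"
    using add[of x "- y"] neg[of y] K(5)[of y] by simp
  have inv: "\<sigma> x * \<sigma> (inverse x) = 1" if "x \<in> K" "x \<noteq> 0" for x
    using mult[OF that(1) K(7)[OF that(1)]] that(2) one by simp
  show "x \<in> K \<Longrightarrow> \<sigma> x = 0 \<longleftrightarrow> x = 0" using inv zero by force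
  show "x \<in> K \<Longrightarrow> \<sigma> (inverse x) = inverse (\<sigma> x)"
    using inv[of x] zero by (cases "x = 0") (auto simp: inverse_unique)
  show "x \<in> K \<Longrightarrow> \<sigma> (x ^ n) = \<sigma> x ^ n"
    using mult K(9) one by (induction n) auto
qed

lemma embedding_inj: assumes "is_subfield K" "embedding K \<sigma>" shows "inj_on \<sigma> K"
proof (rule inj_onI)
  fix x y assume xy: "x \<in> K" "y \<in> K" "\<sigma> x = \<sigma> y"
  then have "\<sigma> (x - y) = 0" using embeddingD(6)[OF assms] by simp
  then show "x = y" using embeddingD(7)[OF assms, of "x - y"] is_subfieldD(6)[OF assms(1)] xy by simp
qed

lemma embedding_sum:
  assumes "is_subfield K" "embedding K \<sigma>" "\<And>i. i \<in> A \<Longrightarrow> f i \<in> K"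
  shows "\<sigma> (sum f A) = (\<Sum>i\<in>A. \<sigma> (f i))"
  using assms(3)
proof (induction A rule: infinite_finite_induct)
  case (insert x A)
  then show ?case
    using embeddingD(1)[OF assms(1,2), of "f x" "sum f A"] subfield_sum[OF assms(1), of A f] by simp
qed (use embeddingD(3)[OF assms(1,2)] in auto)

lemma embedding_map_poly:
  assumes K: "is_subfield K" "embedding K \<sigma>" and P: "poly_over K P" "poly_over K R"
  shows "map_poly \<sigma> (P + R) = map_poly \<sigma> P + map_poly \<sigma> R" "map_poly \<sigma> (P * R) = map_poly \<sigma> P * map_poly \<sigma> R"
    "degree (map_poly \<sigma> P) = degree P" "x \<in> K \<Longrightarrow> \<sigma> (poly P x) = poly (map_poly \<sigma> P) (\<sigma> x)"
proof -
  note D = embeddingD[OF K]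
  have c: "coeff P i \<in> K" "coeff R i \<in> K" for i using P by (auto simp: poly_over_def)
  have m: "coeff (map_poly \<sigma> S) i = \<sigma> (coeff S i)" for S i by (rule coeff_map_poly) (rule D(3))
  show "map_poly \<sigma> (P + R) = map_poly \<sigma> P + map_poly \<sigma> R"
    by (rule poly_eqI) (simp add: m D(1) c)
  show "map_poly \<sigma> (P * R) = map_poly \<sigma> P * map_poly \<sigma> R"
  proof (rule poly_eqI)
    fix i
    show "coeff (map_poly \<sigma> (P * R)) i = coeff (map_poly \<sigma> P * map_poly \<sigma> R) i"
      unfolding m coeff_mult
      by (subst embedding_sum[OF K]) (simp_all add: c is_subfieldD[OF K(1)] D(2))
  qed
  show "degree (map_poly \<sigma> P) = degree P"
  proof (cases "P = 0")
    case False
    then have "\<sigma> (lead_coeff P) \<noteq> 0" using D(7)[OF c(1)] by simp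
    then show ?thesis by (rule map_poly_degree_eq)
  qed simp
  show "\<sigma> (poly P x) = poly (map_poly \<sigma> P) (\<sigma> x)" if "x \<in> K"
    using P(1)
  proof (induction P)
    case (pCons a P)
    then have "a \<in> K" "poly_over K P" using K(1) by simp_all
    then show ?case
      using pCons.IH that D is_subfieldD[OF K(1)] poly_over_eval[OF K(1)]
      by (simp add: map_poly_pCons)
  qed (simp add: D(3))
qed

text \<open>P(alpha) is sent to the value of the transported polynomial at the new element; that
  relations persist is exactly independence of the choice of P.\<close>

lemma embedding_extend:
  assumes K: "is_subfield K" "embedding K \<sigma>"
    and rel: "\<And>P. poly_over K P \<Longrightarrow> poly P \<alpha> = 0 \<Longrightarrow> poly (map_poly \<sigma> P) \<alpha>' = 0"
  obtains \<tau> where "embedding (adj K \<alpha>) \<tau>" "\<And>x. x \<in> K \<Longrightarrow> \<tau> x = \<sigma> x" "\<tau> \<alpha> = \<alpha>'"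
proof -
  note D = embeddingD[OF K]
  have wd: "poly (map_poly \<sigma> P) \<alpha>' = poly (map_poly \<sigma> R) \<alpha>'"
    if "poly_over K P" "poly_over K R" "poly P \<alpha> = poly R \<alpha>" for P R
  proof -
    have "poly_over K (P - R)" using that K by (simp add: poly_over_diff)
    then have "poly (map_poly \<sigma> (P - R)) \<alpha>' = 0" using rel that by simp
    moreover have "map_poly \<sigma> P = map_poly \<sigma> (P - R) + map_poly \<sigma> R"
      using embedding_map_poly(1)[OF K \<open>poly_over K (P - R)\<close> that(2)] by simp
    ultimately show ?thesis by simp
  qed
  define \<tau> where "\<tau> x = poly (map_poly \<sigma> (SOME P. poly_over K P \<and> poly P \<alpha> = x)) \<alpha>'" for x
  have \<tau>: "\<tau> (poly P \<alpha>) = poly (map_poly \<sigma> P) \<alpha>'" if "poly_over K P" for P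
  proof -
    let ?Q = "SOME Q. poly_over K Q \<and> poly Q \<alpha> = poly P \<alpha>"
    have "poly_over K ?Q \<and> poly ?Q \<alpha> = poly P \<alpha>" by (rule someI[of _ P]) (simp add: that)
    then show ?thesis unfolding \<tau>_def using wd that by blast
  qed
  have base: "\<tau> x = \<sigma> x" if "x \<in> K" for x
    using \<tau>[of "[:x:]"] that K(1) D(3) by (simp add: map_poly_pCons)
  have "embedding (adj K \<alpha>) \<tau>"
    unfolding embedding_def
  proof (intro conjI ballI)
    fix x y assume "x \<in> adj K \<alpha>" "y \<in> adj K \<alpha>"
    then obtain P R where PR: "poly_over K P" "x = poly P \<alpha>" "poly_over K R" "y = poly R \<alpha>"
      by (auto simp: adj_def)
    show "\<tau> (x + y) = \<tau> x + \<tau> y"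
      using \<tau>[OF poly_over_add[OF K(1) PR(1,3)]] \<tau>[OF PR(1)] \<tau>[OF PR(3)]
        embedding_map_poly(1)[OF K PR(1,3)] unfolding PR(2,4) by simp
    show "\<tau> (x * y) = \<tau> x * \<tau> y"
      using \<tau>[OF poly_over_mult[OF K(1) PR(1,3)]] \<tau>[OF PR(1)] \<tau>[OF PR(3)]
        embedding_map_poly(2)[OF K PR(1,3)] unfolding PR(2,4) by simp
  next
    show "\<tau> 1 = 1" using base[of 1] D(4) is_subfieldD(2)[OF K(1)] by simp
  qed
  moreover have "\<tau> \<alpha> = \<alpha>'"
    using \<tau>[of "[:0,1:]"] K(1) D(3,4) is_subfieldD(1,2)[OF K(1)] by (simp add: map_poly_pCons)
  ultimately show ?thesis using that base by blast
qed

lemma embedding_image_subfield: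
  assumes K: "is_subfield K" "embedding K \<sigma>" shows "is_subfield (\<sigma> ` K)"
  unfolding is_subfield_def
proof (intro conjI ballI impI)
  note D = embeddingD[OF K] and S = is_subfieldD[OF K(1)]
  show "0 \<in> \<sigma> ` K" "1 \<in> \<sigma> ` K" using D(3,4) S(1,2) by (metis imageI)+
  fix x assume "x \<in> \<sigma> ` K"
  then obtain a where a: "a \<in> K" "x = \<sigma> a" by blast
  show "- x \<in> \<sigma> ` K" "inverse x \<in> \<sigma> ` K"
    using D(5,8)[OF a(1)] S(5,7)[OF a(1)] a(2) by (metis imageI)+
  fix y assume "y \<in> \<sigma> ` K"
  then obtain c where c: "c \<in> K" "y = \<sigma> c" by blast
  show "x + y \<in> \<sigma> ` K" "x * y \<in> \<sigma> ` K"
    using D(1,2)[OF a(1) c(1)] S(3,4)[OF a(1) c(1)] a(2) c(2) by (metis imageI)+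
qed

lemma embedding_preimage_subfield:
  assumes K: "is_subfield K" "embedding K \<sigma>" and K': "is_subfield K'"
  shows "is_subfield {x \<in> K. \<sigma> x \<in> K'}"
  unfolding is_subfield_def
  by (auto simp: is_subfieldD[OF K(1)] is_subfieldD[OF K'] embeddingD[OF K])

lemma embedding_equalizer_subfield:
  assumes K: "is_subfield K" "embedding K \<sigma>" "embedding K \<tau>"
  shows "is_subfield {x \<in> K. \<sigma> x = \<tau> x}"
  unfolding is_subfield_def
  by (auto simp: is_subfieldD[OF K(1)] embeddingD[OF K(1,2)] embeddingD[OF K(1,3)])

section \<open>The Galois group as a matrix group\<close>

lemma Lpoly_eq: "Lpoly q b = [:0,1:] * (monom 1 (q\<^sup>2 - 1) + monom b (q - 1) + 1)" if "q > 0"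
proof -
  have "[:0,1:] * monom c m = monom c (Suc m)" for c :: 'a and m
    by (simp add: monom_Suc)
  then have "[:0,1:] * (monom 1 (q\<^sup>2 - 1) + monom b (q - 1) + 1) = monom 1 (Suc (q\<^sup>2 - 1)) + monom b (Suc (q - 1)) + monom 1 (Suc 0)"
    unfolding distrib_left by (metis monom_0 one_poly_eq_simps(1) mult.right_neutral monom_eq_1)
  then show ?thesis using that by (simp add: Lpoly_def)
qed

lemma Lpoly_div: "q > 0 \<Longrightarrow> Lpoly q b div [:0,1:] = monom 1 (q\<^sup>2 - 1) + monom b (q - 1) + (1 :: 'c::field poly)"
  by (subst Lpoly_eq, assumption) (rule nonzero_mult_div_cancel_left, simp)

lemma poly_Lpoly: "poly (Lpoly q b) x = x ^ q\<^sup>2 + b * x ^ q + x"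
  by (simp add: Lpoly_def poly_monom)

context finite_subfield
begin

lemma k_subfield: "is_subfield k"
  unfolding is_subfield_def by auto

text \<open>The Moore determinant of \<open>x\<close>, \<open>y\<close>: an alternating form that is
  bilinear over \<open>k\<close>.\<close>

definition \<Delta> :: "'c \<Rightarrow> 'c \<Rightarrow> 'c" where "\<Delta> x y = x * y ^ q - x ^ q * y"

lemma \<Delta>_add: "\<Delta> (x + y) z = \<Delta> x z + \<Delta> y z" "\<Delta> z (x + y) = \<Delta> z x + \<Delta> z y"
  by (simp_all add: \<Delta>_def frob_add algebra_simps)

lemma \<Delta>_scale: assumes "c \<in> k" shows "\<Delta> (c * x) z = c * \<Delta> x z" "\<Delta> z (c * x) = c * \<Delta> z x"
  using assms by (simp_all add: \<Delta>_def k_iff power_mult_distrib algebra_simps)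

lemma \<Delta>_self [simp]: "\<Delta> x x = 0" by (simp add: \<Delta>_def)

lemma \<Delta>_swap: "\<Delta> y x = - \<Delta> x y" by (simp add: \<Delta>_def)

text \<open>Cramer's rule as an identity for arbitrary elements; with
  \<open>\<Delta> u v = 1\<close> it gives coordinates with respect to \<open>u\<close>,
  \<open>v\<close>.\<close>

lemma cramer: "\<Delta> r v * u + \<Delta> u r * v = \<Delta> u v * r"
  by (simp add: \<Delta>_def algebra_simps)

lemma Lpoly_nz: "Lpoly q b div [:0,1:] \<noteq> 0" "degree (Lpoly q b div [:0,1:] :: 'c poly) = q\<^sup>2 - 1"
  "poly (Lpoly q b div [:0,1:]) 0 = (1 :: 'c)"
proof -
  have q2: "q - 1 < q\<^sup>2 - 1" using q_gt_1 by (simp add: power2_eq_square diff_less_mono)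
  let ?P = "Lpoly q b div [:0,1:] :: 'c poly"
  have P: "?P = monom 1 (q\<^sup>2 - 1) + (monom b (q - 1) + 1)" using q_gt_1 by (simp add: Lpoly_div add.assoc)
  have "degree (monom b (q - 1) + 1 :: 'c poly) \<le> q - 1"
    by (rule degree_add_le) (auto simp: degree_monom_le)
  then have "degree (monom b (q - 1) + 1 :: 'c poly) < degree (monom (1::'c) (q\<^sup>2 - 1))"
    using q2 by (simp add: degree_monom_eq)
  then show d: "degree ?P = q\<^sup>2 - 1" unfolding P by (subst degree_add_eq_left) (simp_all add: degree_monom_eq)
  show "?P \<noteq> 0" using d q2 by force
  have "q\<^sup>2 - 1 \<noteq> 0" "q - 1 \<noteq> 0" using q2 q_gt_1 by auto
  then show "poly ?P 0 = (1 :: 'c)" unfolding P by (simp add: poly_monom power_0_left)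
qed

lemma root_iff: "x \<noteq> 0 \<Longrightarrow> poly (Lpoly q b div [:0,1:]) x = 0 \<longleftrightarrow> poly (Lpoly q b) x = (0::'c)"
  using q_gt_1 Lpoly_eq[of q b] Lpoly_div[of q b] by (simp del: mult_pCons_left)

end

text \<open>That \<open>v\<close> is a root too follows from \<open>\<Delta> u v = 1\<close>. Such a
  normalised basis of the root space makes Cramer's rule free of denominators.\<close>

locale trinomial = finite_subfield p n q k
  for p n q :: nat and k :: "'c::alg_closed_field set" +
  fixes F :: "'c set" and b u v :: 'c
  assumes F: "is_subfield F" "k \<subseteq> F" "b \<in> F"
    and u: "poly (Lpoly q b) u = 0" "u \<noteq> 0" and uv: "\<Delta> u v = 1"
begin

definition V :: "'c set" where "V = {x. poly (Lpoly q b) x = 0}"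

definition K :: "'c set" where "K = splitting_field F (Lpoly q b)"

abbreviation G :: "('c \<Rightarrow> 'c) monoid" where "G \<equiv> galois_group F (Lpoly q b)"

lemma V_iff: "x \<in> V \<longleftrightarrow> x ^ q\<^sup>2 = - b * x ^ q - x"
  by (auto simp: V_def poly_Lpoly eq_neg_iff_add_eq_0 algebra_simps)

lemma uV: "u \<in> V" using u by (simp add: V_def)

text \<open>Take the q-th power of \<open>\<Delta> x y\<close>, which leaves it unchanged, and
  eliminate x^(q^2) by the equation for \<open>x\<close>: what remains is x^q L(y) = 0.\<close>

lemma V_of_\<Delta>: assumes x: "x \<in> V" "x \<noteq> 0" and "\<Delta> x y \<in> k" shows "y \<in> V"
proof -
  have qq: "(z ^ q) ^ q = z ^ q\<^sup>2" for z :: 'c by (simp add: power2_eq_square flip: power_mult)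
  have "x ^ q * y ^ q\<^sup>2 - x ^ q\<^sup>2 * y ^ q = (\<Delta> x y) ^ q"
    by (simp add: \<Delta>_def frob_diff power_mult_distrib qq)
  also have "\<dots> = x * y ^ q - x ^ q * y" using assms(3) by (simp add: k_iff) (simp add: \<Delta>_def)
  finally have "x ^ q * (y ^ q\<^sup>2 + b * y ^ q + y) = 0"
    using x(1) unfolding V_iff by (simp add: algebra_simps)
  then show ?thesis using x(2) by (simp add: V_def poly_Lpoly)
qed

lemma vV: "v \<in> V" using V_of_\<Delta>[OF uV u(2), of v] uv by simp

text \<open>Here the coefficient 1 of x in L matters: it makes the form invariant under the q-th
  power, whereas a coefficient a would multiply it by a.\<close>

lemma \<Delta>_k: assumes "x \<in> V" "y \<in> V" shows "\<Delta> x y \<in> k"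
proof -
  have qq: "(z ^ q) ^ q = z ^ q\<^sup>2" for z :: 'c by (simp add: power2_eq_square flip: power_mult)
  have "(\<Delta> x y) ^ q = x ^ q * y ^ q\<^sup>2 - x ^ q\<^sup>2 * y ^ q"
    by (simp add: \<Delta>_def frob_diff power_mult_distrib qq)
  also have "\<dots> = \<Delta> x y"
    unfolding assms(1)[unfolded V_iff] assms(2)[unfolded V_iff] by (simp add: \<Delta>_def algebra_simps)
  finally show ?thesis by (simp add: k_iff)
qed

lemma V_lin: assumes "x \<in> k" "y \<in> k" shows "x * u + y * v \<in> V"
proof (rule V_of_\<Delta>[OF uV u(2)])
  show "\<Delta> u (x * u + y * v) \<in> k" using assms uv by (simp add: \<Delta>_add \<Delta>_scale)
qed

lemma coords: "r = \<Delta> r v * u + \<Delta> u r * v"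
  using cramer[of r v u] uv by simp

lemma coords_lin: assumes "x \<in> k" "y \<in> k"
  shows "\<Delta> (x * u + y * v) v = x" "\<Delta> u (x * u + y * v) = y"
  using assms uv by (simp_all add: \<Delta>_add \<Delta>_scale)

lemma K_subfield: "is_subfield K" unfolding K_def splitting_field_def by (rule gen_field_subfield)

lemma K_contains: "F \<subseteq> K" "V \<subseteq> K" "u \<in> K" "v \<in> K" "k \<subseteq> K"
proof -
  show 1: "F \<subseteq> K" "V \<subseteq> K" unfolding K_def splitting_field_def V_def
    using gen_field_contains[of "F \<union> {x. poly (Lpoly q b) x = 0}"] by simp_all
  then show "u \<in> K" "v \<in> K" "k \<subseteq> K" using uV vV F(2) by (simp_all add: subset_iff)
qed

text \<open>By Cramer's rule a normalised pair of roots produces all others with coefficients in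
  \<open>k\<close>. This is how every later inclusion of \<open>K\<close> in a field is
  obtained.\<close>

lemma K_least: assumes K': "is_subfield K'" "F \<subseteq> K'" and xy: "x \<in> K'" "y \<in> K'" "x \<in> V" "y \<in> V" "\<Delta> x y = 1"
  shows "K \<subseteq> K'"
proof -
  have "V \<subseteq> K'"
  proof
    fix r assume "r \<in> V"
    then have "\<Delta> r y \<in> K'" "\<Delta> x r \<in> K'" using \<Delta>_k xy F(2) K'(2) by blast+
    then have "\<Delta> r y * x + \<Delta> x r * y \<in> K'" using xy K' by (simp add: is_subfieldD)
    then show "r \<in> K'" using cramer[of r y x] xy by simp
  qed
  then show ?thesis unfolding K_def splitting_field_def using K' by (intro gen_field_least) (auto simp: V_def)
qed

lemma G_iff: "\<sigma> \<in> carrier G \<longleftrightarrow> bij_betw \<sigma> K K \<and>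
    (\<forall>x\<in>K. \<forall>y\<in>K. \<sigma> (x + y) = \<sigma> x + \<sigma> y \<and> \<sigma> (x * y) = \<sigma> x * \<sigma> y) \<and>
    (\<forall>x\<in>F. \<sigma> x = x) \<and> (\<forall>x. x \<notin> K \<longrightarrow> \<sigma> x = x)"
  by (simp add: galois_group_def aut_group_def K_def)

lemma G_mult: "\<sigma> \<otimes>\<^bsub>G\<^esub> \<tau> = \<sigma> \<circ> \<tau>"
  by (simp add: galois_group_def aut_group_def)

lemma G_embedding: assumes "\<sigma> \<in> carrier G" shows "embedding K \<sigma>" "x \<in> F \<Longrightarrow> \<sigma> x = x" "x \<in> K \<Longrightarrow> \<sigma> x \<in> K"
  using assms is_subfieldD(2)[OF F(1)] unfolding G_iff embedding_def bij_betw_def by auto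

lemma G_comp: assumes "\<sigma> \<in> carrier G" "\<tau> \<in> carrier G" shows "\<sigma> \<circ> \<tau> \<in> carrier G"
  using assms unfolding G_iff by (auto intro: bij_betw_trans simp: bij_betwE)

lemma G_poly: assumes "\<sigma> \<in> carrier G" "poly_over F P" "x \<in> K" shows "\<sigma> (poly P x) = poly P (\<sigma> x)"
proof -
  note e = G_embedding[OF assms(1)]
  have "map_poly \<sigma> P = P"
    using e(2) assms(2) embeddingD(3)[OF K_subfield e(1)]
    by (intro poly_eqI) (simp add: coeff_map_poly poly_over_def)
  then show ?thesis
    using embedding_map_poly(4)[OF K_subfield e(1) poly_over_mono[OF assms(2) K_contains(1)], of 0 x] assms(3)
      is_subfieldD(1)[OF K_subfield] poly_over_simps(1)[OF K_subfield] 
      embedding_map_poly(4)[OF K_subfield e(1) poly_over_mono[OF assms(2) K_contains(1)] poly_over_simps(1)[OF K_subfield] assms(3)]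
    by simp
qed

lemma L_over: "poly_over F (Lpoly q b)"
  unfolding Lpoly_def using F by (intro poly_over_add poly_over_monom) (auto simp: is_subfieldD)

lemma G_V: assumes "\<sigma> \<in> carrier G" "x \<in> V" shows "\<sigma> x \<in> V"
  using G_poly[OF assms(1) L_over, of x] assms K_contains(2) embeddingD(3)[OF K_subfield G_embedding(1)[OF assms(1)]]
  by (auto simp: V_def)

lemma G_lin: assumes "\<sigma> \<in> carrier G" "x \<in> k" "y \<in> k" shows "\<sigma> (x * u + y * v) = x * \<sigma> u + y * \<sigma> v"
proof -
  note E = embeddingD[OF K_subfield G_embedding(1)[OF assms(1)]]
  have "x \<in> K" "y \<in> K" "\<sigma> x = x" "\<sigma> y = y" using assms K_contains F G_embedding(2)[OF assms(1)] by auto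
  then show ?thesis using E(1,2) K_contains(3,4) is_subfieldD(4)[OF K_subfield] by simp
qed

lemma G_\<Delta>: assumes "\<sigma> \<in> carrier G" "x \<in> K" "y \<in> K" shows "\<Delta> (\<sigma> x) (\<sigma> y) = \<sigma> (\<Delta> x y)"
proof -
  note E = embeddingD[OF K_subfield G_embedding(1)[OF assms(1)]]
  show ?thesis unfolding \<Delta>_def using assms(2,3) is_subfieldD[OF K_subfield]
    by (simp add: E(6) E(2) E(9))
qed

text \<open>The matrix of \<open>\<sigma>\<close> on the root space in the basis \<open>u\<close>,
  \<open>v\<close>, with columns the coordinates of \<open>\<sigma> u\<close> and
  \<open>\<sigma> v\<close>.\<close>

definition M :: "('c \<Rightarrow> 'c) \<Rightarrow> 'c \<times> 'c \<times> 'c \<times> 'c" where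
  "M \<sigma> = (\<Delta> (\<sigma> u) v, \<Delta> (\<sigma> v) v, \<Delta> u (\<sigma> u), \<Delta> u (\<sigma> v))"

lemma M_carrier: assumes "\<sigma> \<in> carrier G" shows "M \<sigma> \<in> carrier (SL2 k)"
proof -
  have m: "\<sigma> u \<in> V" "\<sigma> v \<in> V" using G_V[OF assms] uV vV by auto
  define x z y w where "x = \<Delta> (\<sigma> u) v" and "z = \<Delta> (\<sigma> v) v" and "y = \<Delta> u (\<sigma> u)" and "w = \<Delta> u (\<sigma> v)"
  have k: "x \<in> k" "z \<in> k" "y \<in> k" "w \<in> k" using m \<Delta>_k uV vV by (auto simp: x_def y_def z_def w_def)
  have su: "\<sigma> u = x * u + y * v" and sv: "\<sigma> v = z * u + w * v"
    using coords[of "\<sigma> u"] coords[of "\<sigma> v"] by (simp_all add: x_def y_def z_def w_def)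
  have "\<Delta> (\<sigma> u) (\<sigma> v) = \<sigma> 1" using G_\<Delta>[OF assms K_contains(3,4)] uv by simp
  also have "\<dots> = 1" using embeddingD(4)[OF K_subfield G_embedding(1)[OF assms]] .
  finally have "\<Delta> (x * u + y * v) (z * u + w * v) = 1" unfolding su sv .
  moreover have "\<Delta> (x * u + y * v) (z * u + w * v) = x * w - z * y"
    by (simp only: \<Delta>_add \<Delta>_scale[OF k(1)] \<Delta>_scale[OF k(2)] \<Delta>_scale[OF k(3)] \<Delta>_scale[OF k(4)]
        \<Delta>_self uv \<Delta>_swap[of v u]) (simp add: algebra_simps)
  ultimately show ?thesis using k unfolding M_def x_def[symmetric] y_def[symmetric] z_def[symmetric] w_def[symmetric] by simp
qed

lemma M_mult: assumes "\<sigma> \<in> carrier G" "\<tau> \<in> carrier G" shows "M (\<sigma> \<circ> \<tau>) = mmul (M \<sigma>) (M \<tau>)"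
proof -
  have key: "\<sigma> (\<tau> r) = \<Delta> (\<tau> r) v * \<sigma> u + \<Delta> u (\<tau> r) * \<sigma> v" if "r \<in> V" for r
    using G_lin[OF assms(1)] coords[of "\<tau> r"] \<Delta>_k G_V[OF assms(2) that] uV vV by metis
  have k: "\<Delta> (\<tau> r) v \<in> k" "\<Delta> u (\<tau> r) \<in> k" if "r \<in> V" for r
    using \<Delta>_k G_V[OF assms(2) that] uV vV by auto
  show ?thesis
    unfolding M_def
    by (simp only: o_apply mmul_simp key[OF uV] key[OF vV] \<Delta>_add \<Delta>_scale[OF k(1)[OF uV]]
        \<Delta>_scale[OF k(1)[OF vV]] \<Delta>_scale[OF k(2)[OF uV]] \<Delta>_scale[OF k(2)[OF vV]])
      (simp add: mult.commute)
qed

lemma M_hom: "M \<in> hom G (SL2 k)"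
  using M_carrier M_mult by (auto simp: hom_def G_mult)

lemma G_eqI:
  assumes "\<sigma> \<in> carrier G" "\<tau> \<in> carrier G" "\<sigma> u = \<tau> u" "\<sigma> v = \<tau> v" shows "\<sigma> = \<tau>"
proof
  fix x
  let ?E = "{x \<in> K. \<sigma> x = \<tau> x}"
  have "K \<subseteq> ?E"
  proof (rule K_least)
    show "is_subfield ?E"
      by (rule embedding_equalizer_subfield[OF K_subfield]) (use G_embedding assms in auto)
    show "F \<subseteq> ?E" using G_embedding(2)[OF assms(1)] G_embedding(2)[OF assms(2)] K_contains(1) by auto
  qed (use assms K_contains uV vV uv in auto)
  then show "\<sigma> x = \<tau> x" using assms(1,2) unfolding G_iff by (cases "x \<in> K") auto
qed

lemma M_inj: "inj_on M (carrier G)"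
proof (rule inj_onI)
  fix \<sigma> \<tau> assume st: "\<sigma> \<in> carrier G" "\<tau> \<in> carrier G" "M \<sigma> = M \<tau>"
  then have "\<sigma> u = \<tau> u" "\<sigma> v = \<tau> v"
    using coords[of "\<sigma> u"] coords[of "\<tau> u"] coords[of "\<sigma> v"] coords[of "\<tau> v"] by (auto simp: M_def)
  then show "\<sigma> = \<tau>" using G_eqI st by blast
qed

text \<open>The polynomial of degree q (for nonzero \<open>x\<close>) whose roots complete
  \<open>x\<close> to a normalised pair; for \<open>x = u\<close> it shows that \<open>v\<close> is
  algebraic over F(u).\<close>

definition \<Delta>_poly :: "'c \<Rightarrow> 'c poly" where "\<Delta>_poly x = monom x q - monom (x ^ q) 1 - 1"

lemma poly_\<Delta>_poly: "poly (\<Delta>_poly x) y = \<Delta> x y - 1"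
  by (simp add: \<Delta>_poly_def poly_monom \<Delta>_def)

lemma \<Delta>_poly_over: "is_subfield K' \<Longrightarrow> x \<in> K' \<Longrightarrow> poly_over K' (\<Delta>_poly x)"
  unfolding \<Delta>_poly_def by (intro poly_over_diff poly_over_monom) (auto simp: is_subfieldD)

lemma \<Delta>_poly_nz: "\<Delta>_poly x \<noteq> 0"
proof -
  have "poly (\<Delta>_poly x) 0 = -1" using q_gt_1 by (simp add: poly_\<Delta>_poly \<Delta>_def power_0_left)
  then show ?thesis by auto
qed

definition Fu :: "'c set" where "Fu = adj F u"

lemma Fu_subfield: "is_subfield Fu" and Fu_contains: "F \<subseteq> Fu" "u \<in> Fu"
proof -
  have "Lpoly q b \<noteq> 0"
    using Lpoly_nz(1)[of b] by auto
  then show "is_subfield Fu" unfolding Fu_def using adj_subfield[OF F(1) L_over _ u(1)] by blast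
  show "F \<subseteq> Fu" "u \<in> Fu" unfolding Fu_def by (rule adj_contains[OF F(1)])+
qed

text \<open>The splitting field is a tower of two simple extensions, so embeddings extend first to
  \<open>u\<close> and then to \<open>v\<close>.\<close>

lemma K_eq: "K = adj Fu v"
proof
  have sub: "is_subfield (adj Fu v)"
    by (rule adj_subfield[OF Fu_subfield \<Delta>_poly_over[OF Fu_subfield Fu_contains(2)] \<Delta>_poly_nz]) (simp add: poly_\<Delta>_poly uv)
  show "K \<subseteq> adj Fu v"
    using K_least[OF sub _ _ _ uV vV uv] adj_contains[OF Fu_subfield, of v] Fu_contains by blast
  have "Fu \<subseteq> K" unfolding Fu_def by (rule adj_least[OF K_subfield]) (use K_contains in auto)
  then show "adj Fu v \<subseteq> K" by (rule adj_least[OF K_subfield]) (use K_contains in auto)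
qed

text \<open>The extended map carries \<open>u\<close>, \<open>v\<close> to another normalised pair,
  and \<open>K_least\<close> for this pair shows that it maps \<open>K\<close> onto itself.\<close>

lemma extend_to_G:
  assumes \<sigma>: "embedding Fu \<sigma>" "\<And>x. x \<in> F \<Longrightarrow> \<sigma> x = x" "\<sigma> u \<in> V" "\<sigma> u \<noteq> 0"
    and rel: "\<And>P. poly_over Fu P \<Longrightarrow> poly P v = 0 \<Longrightarrow> poly (map_poly \<sigma> P) v' = 0"
  shows "\<exists>\<tau> \<in> carrier G. \<tau> u = \<sigma> u \<and> \<tau> v = v'"
proof -
  obtain \<tau> where \<tau>: "embedding (adj Fu v) \<tau>" "\<And>x. x \<in> Fu \<Longrightarrow> \<tau> x = \<sigma> x" "\<tau> v = v'"
    using embedding_extend[OF Fu_subfield \<sigma>(1) rel] by blast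
  have e: "embedding K \<tau>" using \<tau>(1) by (simp add: K_eq)
  note E = embeddingD[OF K_subfield e]
  have tF: "\<tau> x = x" if "x \<in> F" for x using \<tau>(2) \<sigma>(2) that Fu_contains by auto
  have tu: "\<tau> u = \<sigma> u" using \<tau>(2) Fu_contains by blast
  have "\<Delta> (\<tau> u) (\<tau> v) = \<tau> (\<Delta> u v)"
    unfolding \<Delta>_def using K_contains(3,4) is_subfieldD[OF K_subfield] by (simp add: E(6) E(2) E(9))
  then have D: "\<Delta> (\<sigma> u) v' = 1" using uv E(4) tu \<tau>(3) by simp
  then have v': "v' \<in> V" using V_of_\<Delta>[OF \<sigma>(3,4)] by simp
  \<comment> \<open>The image stays in \<open>K\<close>: the elements of \<open>K\<close> mapped
    into \<open>K\<close> form a field containing \<open>F\<close>, \<open>u\<close>,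
    \<open>v\<close>.\<close>
  have "K \<subseteq> {x \<in> K. \<tau> x \<in> K}"
  proof (rule K_least)
    show "is_subfield {x \<in> K. \<tau> x \<in> K}" by (rule embedding_preimage_subfield[OF K_subfield e K_subfield])
  qed (use K_contains tF tu \<tau>(3) \<sigma>(3) v' uV vV uv in auto)
  \<comment> \<open>Surjectivity: the image is a field containing \<open>F\<close> and a normalised
    pair of roots.\<close>
  moreover have "K \<subseteq> \<tau> ` K"
  proof (rule K_least)
    show "is_subfield (\<tau> ` K)" by (rule embedding_image_subfield[OF K_subfield e])
    show "F \<subseteq> \<tau> ` K" using tF K_contains(1) by (metis image_eqI subset_iff subsetI)
    show "\<sigma> u \<in> \<tau> ` K" "v' \<in> \<tau> ` K" using tu \<tau>(3) K_contains(3,4) by (metis imageI)+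
  qed (use \<sigma>(3) v' D in auto)
  ultimately have "bij_betw \<tau> K K"
    using embedding_inj[OF K_subfield e] unfolding bij_betw_def by blast
  \<comment> \<open>Automorphisms in \<open>aut_group\<close> are normalised to be the identity
    outside \<open>K\<close>.\<close>
  define \<rho> where "\<rho> x = (if x \<in> K then \<tau> x else x)" for x
  have r: "\<rho> x = \<tau> x" if "x \<in> K" for x using that by (simp add: \<rho>_def)
  have "bij_betw \<rho> K K" using \<open>bij_betw \<tau> K K\<close> r by (simp cong: bij_betw_cong)
  moreover have "\<rho> (x + y) = \<rho> x + \<rho> y \<and> \<rho> (x * y) = \<rho> x * \<rho> y" if "x \<in> K" "y \<in> K" for x y
    using that by (simp add: r is_subfieldD[OF K_subfield] E(1,2))
  moreover have "\<rho> x = x" if "x \<in> F" for x using that K_contains(1) r tF by (simp add: subset_iff)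
  ultimately have "\<rho> \<in> carrier G" unfolding G_iff by (simp add: \<rho>_def)
  moreover have "\<rho> u = \<sigma> u" "\<rho> v = v'" using tu \<tau>(3) K_contains(3,4) r by simp_all
  ultimately show ?thesis by blast
qed

lemma id_in_G: "id \<in> carrier G"
  unfolding G_iff by auto

text \<open>By irreducibility L(x)/x is the minimal polynomial of \<open>u\<close> up to a scalar,
  so \<open>u\<close> may be sent to any nonzero root.\<close>

lemma irreducible_transitive:
  assumes irr: "irreducible_over F (Lpoly q b div [:0,1:])"
  shows "transitive_subgroup k (M ` carrier G)"
proof -
  let ?P = "Lpoly q b div [:0,1:]"
  have ex: "\<exists>z w. (x,z,y,w) \<in> M ` carrier G" if xy: "x \<in> k" "y \<in> k" "x \<noteq> 0 \<or> y \<noteq> 0" for x y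
  proof -
    define u' where "u' = x * u + y * v"
    have u': "u' \<in> V" using V_lin xy by (simp add: u'_def)
    have "\<Delta> 0 z = 0" "\<Delta> z 0 = 0" for z using q_gt_1 by (simp_all add: \<Delta>_def power_0_left)
    then have "u' \<noteq> 0" using coords_lin[OF xy(1,2)] xy(3) unfolding u'_def by metis
    have P0: "poly ?P u = 0" "poly ?P u' = 0"
      using root_iff u u' \<open>u' \<noteq> 0\<close> by (auto simp: V_def)
    have Pover: "poly_over F ?P" using irr by (simp add: irreducible_over_def)
    obtain m where m: "poly_over F m" "m \<noteq> 0" "poly m u = 0"
      "\<And>r. poly_over F r \<Longrightarrow> poly r u = 0 \<Longrightarrow> \<exists>h. poly_over F h \<and> r = m * h"
      using minimal_polynomial[OF F(1) Pover Lpoly_nz(1) P0(1)] by metis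
    obtain h where h: "poly_over F h" "?P = m * h" using m(4)[OF Pover P0(1)] by blast
    have "degree m \<noteq> 0"
    proof
      assume "degree m = 0"
      then obtain c where "m = [:c:]" by (metis degree_eq_zeroE)
      then show False using m by simp
    qed
    then have "degree h = 0"
      using irr[unfolded irreducible_over_def, THEN conjunct2, THEN conjunct2, rule_format, of m h] h m(1) by simp
    then obtain c where c: "h = [:c:]" by (metis degree_eq_zeroE)
    then have "c \<noteq> 0" using h(2) Lpoly_nz(1)[of b] by auto
    then have mu': "poly m u' = 0" using P0(2) unfolding h(2) c by simp
    have idF: "embedding F id" by (simp add: embedding_def)
    have "poly (map_poly id R) u' = 0" if RR: "poly_over F R" "poly R u = 0" for R
    proof -
      obtain h' where "R = m * h'" using m(4) RR by blast
      then show ?thesis using mu' by simp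
    qed
    then obtain \<sigma> where \<sigma>: "embedding Fu \<sigma>" "\<And>x. x \<in> F \<Longrightarrow> \<sigma> x = x" "\<sigma> u = u'"
      using embedding_extend[OF F(1) idF] unfolding Fu_def by (metis id_apply)
    note Qo = \<Delta>_poly_over[OF Fu_subfield Fu_contains(2)]
    obtain m2 where m2: "poly_over Fu m2" "m2 \<noteq> 0" "poly m2 v = 0"
      "\<And>r. poly_over Fu r \<Longrightarrow> poly r v = 0 \<Longrightarrow> \<exists>h. poly_over Fu h \<and> r = m2 * h"
      using minimal_polynomial[OF Fu_subfield Qo \<Delta>_poly_nz, of v] uv by (simp add: poly_\<Delta>_poly) metis
    have "degree m2 \<noteq> 0"
    proof
      assume "degree m2 = 0"
      then obtain c where "m2 = [:c:]" by (metis degree_eq_zeroE)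
      then show False using m2 by simp
    qed
    then have "degree (map_poly \<sigma> m2) > 0"
      using embedding_map_poly(3)[OF Fu_subfield \<sigma>(1) m2(1,1)] by simp
    \<comment> \<open>Any root of the transported minimal polynomial of \<open>v\<close> is a
      legitimate image of \<open>v\<close>.\<close>
    then obtain v' where v': "poly (map_poly \<sigma> m2) v' = 0" using alg_closed_imp_poly_has_root by blast
    have rel: "poly (map_poly \<sigma> R) v' = 0" if R: "poly_over Fu R" "poly R v = 0" for R
    proof -
      obtain h' where h': "poly_over Fu h'" "R = m2 * h'" using m2(4) R by blast
      then show ?thesis using embedding_map_poly(2)[OF Fu_subfield \<sigma>(1) m2(1) h'(1)] v' by simp
    qed
    have "\<exists>\<tau> \<in> carrier G. \<tau> u = \<sigma> u \<and> \<tau> v = v'"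
      by (rule extend_to_G[OF \<sigma>(1,2) _ _ rel]) (simp_all only: \<sigma>(3) u' \<open>u' \<noteq> 0\<close> not_False_eq_True)
    then obtain \<tau> where \<tau>: "\<tau> \<in> carrier G" "\<tau> u = u'" unfolding \<sigma>(3) by blast
    have "M \<tau> = (x, \<Delta> (\<tau> v) v, y, \<Delta> u (\<tau> v))"
      unfolding M_def \<tau>(2) u'_def coords_lin[OF xy(1,2)] ..
    then show ?thesis using \<tau>(1) by (metis imageI)
  qed
  have sub: "M ` carrier G \<subseteq> carrier (SL2 k)" using M_carrier by blast
  have mult: "mmul g h \<in> M ` carrier G" if gh: "g \<in> M ` carrier G" "h \<in> M ` carrier G" for g h
  proof -
    obtain \<sigma> \<tau> where "\<sigma> \<in> carrier G" "\<tau> \<in> carrier G" "g = M \<sigma>" "h = M \<tau>" using gh by blast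
    then have "mmul g h = M (\<sigma> \<circ> \<tau>)" "\<sigma> \<circ> \<tau> \<in> carrier G" using M_mult G_comp by auto
    then show ?thesis by blast
  qed
  have ne: "M ` carrier G \<noteq> {}" using id_in_G by blast
  have "madj g \<in> M ` carrier G" if "g \<in> M ` carrier G" for g
    by (rule closed_imp_inverse_closed(2)[OF sub _ ne that]) (rule mult)
  then show ?thesis
    using sub mult ex unfolding transitive_subgroup_def by simp
qed

end

section \<open>Intermediate fields\<close>

definition root_prod :: "'c::field set \<Rightarrow> 'c poly" where
  "root_prod S = (\<Prod>y\<in>S. [:- y, 1:])"

lemma poly_root_prod: "finite S \<Longrightarrow> poly (root_prod S) x = 0 \<longleftrightarrow> x \<in> S"
  by (auto simp: root_prod_def poly_prod)

lemma degree_root_prod: "finite S \<Longrightarrow> degree (root_prod S) = card S" and root_prod_nz: "root_prod S \<noteq> 0"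
proof -
  show "root_prod S \<noteq> 0" unfolding root_prod_def by (cases "finite S") auto
  show "degree (root_prod S) = card S" if "finite S"
    unfolding root_prod_def using that by (subst degree_prod_eq_sum_degree) auto
qed

lemma root_prod_over:
  assumes K: "is_subfield K" shows "finite S \<Longrightarrow> S \<subseteq> K \<Longrightarrow> poly_over K (root_prod S)"
proof (induction S rule: finite_induct)
  case (insert x S)
  then show ?case
    using K by (simp add: root_prod_def poly_over_mult is_subfieldD del: mult_pCons_left)
qed (simp add: root_prod_def K)

lemma map_poly_root_prod:
  assumes K: "is_subfield K" "embedding K \<sigma>" and S: "finite S" "S \<subseteq> K" "\<sigma> ` S \<subseteq> S"
  shows "map_poly \<sigma> (root_prod S) = root_prod S"
proof -
  have inj: "inj_on \<sigma> S" using embedding_inj[OF K] S(2) by (rule inj_on_subset)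
  have im: "\<sigma> ` S = S" by (rule endo_inj_surj[OF S(1,3) inj])
  have "map_poly \<sigma> (root_prod T) = (\<Prod>y\<in>T. [:- \<sigma> y, 1:])" if "finite T" "T \<subseteq> K" for T
    using that
  proof (induction T rule: finite_induct)
    case empty
    then show ?case using embeddingD(4)[OF K] by (simp add: root_prod_def)
  next
    case (insert x T)
    have "map_poly \<sigma> (root_prod (insert x T)) = map_poly \<sigma> ([:- x, 1:] * root_prod T)"
      using insert.hyps by (simp add: root_prod_def)
    also have "\<dots> = map_poly \<sigma> [:- x, 1:] * map_poly \<sigma> (root_prod T)"
      by (rule embedding_map_poly(2)[OF K])
        (use insert.prems insert.hyps root_prod_over[OF K(1)] in \<open>simp_all add: is_subfieldD[OF K(1)] K(1)\<close>)
    also have "map_poly \<sigma> [:- x, 1:] = [:- \<sigma> x, 1:]"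
      using insert.prems embeddingD(3,4,5)[OF K] by (simp add: map_poly_pCons)
    finally show ?case using insert by simp
  qed
  then have "map_poly \<sigma> (root_prod S) = (\<Prod>y\<in>S. [:- \<sigma> y, 1:])" using S by blast
  also have "\<dots> = (\<Prod>y\<in>\<sigma> ` S. [:- y, 1:])" using inj by (simp add: prod.reindex)
  finally show ?thesis unfolding im root_prod_def .
qed

lemma poly_many_roots:
  fixes P :: "'c::field poly"
  assumes "S \<subseteq> {x. poly P x = 0}" "finite S" "P \<noteq> 0" shows "card S \<le> degree P"
  using card_mono[OF poly_roots_finite[OF assms(3)] assms(1)] card_poly_roots_bound[OF assms(3)] by linarith

text \<open>The device that replaces the Galois correspondence in
  \<open>fixed_field\<close>.\<close>

lemma poly_constant_on:
  fixes P :: "'c::field poly"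
  assumes "\<And>y. y \<in> S \<Longrightarrow> poly P y = x" "finite S" "degree P < card S" shows "P = [:x:]"
proof (rule ccontr)
  assume "P \<noteq> [:x:]"
  then have "card S \<le> degree (P - [:x:])" using assms by (intro poly_many_roots) auto
  also have "\<dots> \<le> degree P" by (rule degree_diff_le) auto
  finally show False using assms by simp
qed

context trinomial
begin

lemma V_nonzero: "V - {0} = (\<lambda>(x,y). x * u + y * v) ` (k \<times> k - {(0,0)})"
  and inj_lin: "inj_on (\<lambda>(x,y). x * u + y * v) (k \<times> k)"
proof -
  show inj: "inj_on (\<lambda>(x,y). x * u + y * v) (k \<times> k)"
    by (rule inj_onI) (clarsimp, metis coords_lin)
  show "V - {0} = (\<lambda>(x,y). x * u + y * v) ` (k \<times> k - {(0,0)})"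
  proof (intro equalityI subsetI)
    fix r assume r: "r \<in> V - {0}"
    then have "\<Delta> r v \<in> k" "\<Delta> u r \<in> k" using \<Delta>_k uV vV by auto
    moreover have "(\<Delta> r v, \<Delta> u r) \<noteq> (0,0)" using r coords[of r] by auto
    ultimately show "r \<in> (\<lambda>(x,y). x * u + y * v) ` (k \<times> k - {(0,0)})"
      by (intro image_eqI[of _ _ "(\<Delta> r v, \<Delta> u r)"]) (simp_all add: coords[symmetric])
  next
    fix r assume "r \<in> (\<lambda>(x,y). x * u + y * v) ` (k \<times> k - {(0,0)})"
    then obtain x y where xy: "x \<in> k" "y \<in> k" "(x,y) \<noteq> (0,0)" "r = x * u + y * v" by auto
    moreover have "r \<noteq> 0" using inj_onD[OF inj, of "(x,y)" "(0,0)"] xy by auto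
    ultimately show "r \<in> V - {0}" using V_lin by auto
  qed
qed

lemma card_V: "card (V - {0}) = q\<^sup>2 - 1" "finite (V - {0})"
proof -
  have "inj_on (\<lambda>(x,y). x * u + y * v) (k \<times> k - {(0,0)})" using inj_lin by (rule inj_on_subset) auto
  then show "card (V - {0}) = q\<^sup>2 - 1"
    using card_k finite_k unfolding V_nonzero
    by (simp add: card_image card_cartesian_product power2_eq_square)
  show "finite (V - {0})" unfolding V_nonzero by (simp add: finite_k)
qed

lemma finite_G: "finite (carrier G)"
  using inj_on_finite[OF M_inj _ finite_carrier_SL2] M_carrier by blast

lemma M_id: "M id = (1,0,0,1)"
  using uv \<Delta>_self by (simp add: M_def)

lemma M_column: assumes "\<sigma> \<in> carrier G" "M \<sigma> = (x,z,y,w)" shows "\<sigma> u = x * u + y * v" "\<sigma> v = z * u + w * v"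
  using coords[of "\<sigma> u"] coords[of "\<sigma> v"] assms(2) by (auto simp: M_def)

text \<open>A factor over \<open>F\<close> vanishing at \<open>u\<close> vanishes on the whole
  orbit, that is at q^2 - 1 points, and so has full degree.\<close>

lemma transitive_imp_irreducible:
  assumes tr: "\<And>r. r \<in> V - {0} \<Longrightarrow> \<exists>\<sigma> \<in> carrier G. \<sigma> u = r"
  shows "irreducible_over F (Lpoly q b div [:0,1:])"
proof -
  let ?P = "Lpoly q b div [:0,1:]"
  have A: "poly_over F ?P"
    unfolding Lpoly_div[of q b, OF order.strict_trans[OF zero_less_one q_gt_1]]
    using F by (intro poly_over_add poly_over_monom) (simp_all add: is_subfieldD)
  have B: "degree ?P > 0" using card_V(1) Lpoly_nz(2)[of b] q_gt_1 power_strict_mono[of 1 q 2] by simp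
  have one: "degree h = 0" if gh: "poly_over F g" "?P = g * h" "poly g u = 0" for g h
  proof -
    have nz: "g \<noteq> 0" "h \<noteq> 0" using gh(2) Lpoly_nz(1)[of b] by auto
    have "poly g r = 0" if r: "r \<in> V - {0}" for r
    proof -
      obtain \<sigma> where "\<sigma> \<in> carrier G" "\<sigma> u = r" using tr[OF r] by blast
      then show ?thesis using G_poly[OF _ gh(1), of \<sigma> u] K_contains(3) gh(3)
          embeddingD(3)[OF K_subfield G_embedding(1)] by metis
    qed
    then have "q\<^sup>2 - 1 \<le> degree g" using poly_many_roots[of "V - {0}" g] card_V nz by auto
    moreover have "q\<^sup>2 - 1 = degree g + degree h" using Lpoly_nz(2)[of b] gh(2) nz by (simp add: degree_mult_eq)
    ultimately show ?thesis by simp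
  qed
  have C: "degree g = 0 \<or> degree h = 0" if gh: "poly_over F g" "poly_over F h" "?P = g * h" for g h
  proof -
    have "poly g u * poly h u = 0" using root_iff[OF u(2), of b] u(1) gh(3) by simp
    then consider "poly g u = 0" | "poly h u = 0" by auto
    then show ?thesis
    proof cases
      case 1
      show ?thesis using one[OF gh(1,3) 1] by simp
    next
      case 2
      show ?thesis using one[OF gh(2) _ 2, of g] gh(3) by (simp add: mult.commute)
    qed
  qed
  show ?thesis unfolding irreducible_over_def
  proof (intro conjI allI impI)
    fix g h assume "poly_over F g \<and> poly_over F h \<and> ?P = g * h"
    then show "degree g = 0 \<or> degree h = 0" using C[of g h] by simp
  qed (rule A, rule B)
qed

text \<open>Reduce \<open>x\<close> to a polynomial of low degree in \<open>v\<close> over F(u),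
  then in \<open>u\<close> over \<open>F\<close>. Each time the group makes it take the value
  \<open>x\<close> at more points than its degree, so it is constant.\<close>

lemma fixed_field:
  assumes full: "M ` carrier G = carrier (SL2 k)" and x: "x \<in> K" "\<And>\<sigma>. \<sigma> \<in> carrier G \<Longrightarrow> \<sigma> x = x"
  shows "x \<in> F"
proof -
  have ex: "\<exists>\<sigma> \<in> carrier G. M \<sigma> = g" if "g \<in> carrier (SL2 k)" for g
    using full that by (metis imageE)
  obtain P where P: "poly_over Fu P" "x = poly P v" using x(1) unfolding K_eq adj_def by blast
  obtain h R where R: "poly_over Fu h" "poly_over Fu R" "P = \<Delta>_poly u * h + R" "R = 0 \<or> degree R < degree (\<Delta>_poly u)"
    using poly_over_division[OF Fu_subfield \<Delta>_poly_over[OF Fu_subfield Fu_contains(2)] \<Delta>_poly_nz P(1)] by blast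
  have xR: "x = poly R v" unfolding P(2) R(3) by (simp add: poly_\<Delta>_poly uv)
  have "degree (\<Delta>_poly u) \<le> q"
    unfolding \<Delta>_poly_def using q_gt_1
    by (intro degree_diff_le) (auto intro: order.trans[OF degree_monom_le])
  then have degR: "degree R < q" using R(4) q_gt_1 by auto
  \<comment> \<open>The transvections fix F(u) pointwise and move \<open>v\<close> to the q points
    \<open>v + c * u\<close>.\<close>
  have Rc: "poly R (v + c * u) = x" if c: "c \<in> k" for c
  proof -
    obtain \<sigma> where s: "\<sigma> \<in> carrier G" "M \<sigma> = (1,c,0,1)" using ex[of "(1,c,0,1)"] c by auto
    have su: "\<sigma> u = u" "\<sigma> v = c * u + v" using M_column[OF s] by auto
    note E = embeddingD[OF K_subfield G_embedding(1)[OF s(1)]]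
    have "\<sigma> a = a" if "a \<in> Fu" for a
    proof -
      obtain A where "poly_over F A" "a = poly A u" using \<open>a \<in> Fu\<close> unfolding Fu_def adj_def by blast
      then show ?thesis using G_poly[OF s(1), of A u] K_contains(3) su by simp
    qed
    then have "map_poly \<sigma> R = R" using R(2) E(3) by (intro poly_eqI) (simp add: coeff_map_poly poly_over_def)
    moreover have "Fu \<subseteq> K" unfolding Fu_def by (rule adj_least[OF K_subfield]) (use K_contains in auto)
    then have "poly_over K R" using R(2) poly_over_mono by blast
    ultimately have "\<sigma> (poly R v) = poly R (\<sigma> v)"
      using embedding_map_poly(4)[OF K_subfield G_embedding(1)[OF s(1)] _ _ K_contains(4), of R R] by simp
    then show ?thesis using x(2)[OF s(1)] xR su by (simp add: add.commute)
  qed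
  have "card ((\<lambda>c. v + c * u) ` k) = q" using u(2) card_k by (subst card_image) (auto simp: inj_on_def)
  then have "R = [:x:]" using Rc degR finite_k by (intro poly_constant_on[of "(\<lambda>c. v + c * u) ` k"]) auto
  then have "x \<in> Fu" using R(2) Fu_subfield by simp
  then obtain S where S: "poly_over F S" "x = poly S u" unfolding Fu_def adj_def by blast
  let ?P = "Lpoly q b div [:0,1:]"
  have "poly_over F ?P"
    unfolding Lpoly_div[of q b, OF order.strict_trans[OF zero_less_one q_gt_1]]
    using F by (intro poly_over_add poly_over_monom) (simp_all add: is_subfieldD)
  then obtain h T where T: "poly_over F h" "poly_over F T" "S = ?P * h + T" "T = 0 \<or> degree T < degree ?P"
    using poly_over_division[OF F(1) _ Lpoly_nz(1) S(1)] by blast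
  have xT: "x = poly T u" using root_iff[OF u(2), of b] u(1) unfolding S(2) T(3) by simp
  have "q\<^sup>2 - 1 > 0" using q_gt_1 power_strict_mono[of 1 q 2] by simp
  then have degT: "degree T < q\<^sup>2 - 1" using T(4) Lpoly_nz(2)[of b] by auto
  \<comment> \<open>Second descent: the group moves \<open>u\<close> to every one of the q^2 - 1
    nonzero roots.\<close>
  have "poly T r = x" if r: "r \<in> V - {0}" for r
  proof -
    obtain y z where yz: "y \<in> k" "z \<in> k" "(y,z) \<noteq> (0,0)" "r = y * u + z * v" using r unfolding V_nonzero by auto
    have "\<exists>c d. (y,c,z,d) \<in> carrier (SL2 k)"
    proof (cases "y = 0")
      case True
      then show ?thesis using yz by (intro exI[of _ "- inverse z"] exI[of _ 0]) auto
    next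
      case False
      then show ?thesis using yz by (intro exI[of _ 0] exI[of _ "inverse y"]) auto
    qed
    then obtain c d \<sigma> where s: "\<sigma> \<in> carrier G" "M \<sigma> = (y,c,z,d)" using ex by blast
    then have "\<sigma> u = r" using M_column(1)[OF s] yz(4) by simp
    then show ?thesis using G_poly[OF s(1) T(2) K_contains(3)] x(2)[OF s(1)] xT by simp
  qed
  then have "T = [:x:]" using degT card_V by (intro poly_constant_on[of "V - {0}"]) auto
  then show ?thesis using T(2) F(1) by simp
qed

lemma separating_element:
  assumes inf: "infinite F"
  obtains z where "z \<in> K" "inj_on (\<lambda>\<sigma>. \<sigma> z) (carrier G)"
proof -
  \<comment> \<open>The parameters for which two automorphisms could agree on
    \<open>u + l * v\<close>. If \<open>\<sigma> v = \<tau> v\<close> the quotient is 0 by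
    convention; such pairs are settled by their values at \<open>u\<close>.\<close>
  define bad where "bad = (\<lambda>(\<sigma>,\<tau>). (\<tau> u - \<sigma> u) / (\<sigma> v - \<tau> v)) ` (carrier G \<times> carrier G)"
  have "finite bad" unfolding bad_def using finite_G by simp
  then obtain l where l: "l \<in> F" "l \<notin> bad" using inf by (meson finite_subset subsetI)
  define z where "z = u + l * v"
  have zK: "z \<in> K" using l(1) K_contains is_subfieldD(3,4)[OF K_subfield] by (auto simp: z_def)
  have sz: "\<sigma> z = \<sigma> u + l * \<sigma> v" if "\<sigma> \<in> carrier G" for \<sigma>
  proof -
    have "l \<in> K" using l K_contains by blast
    then show ?thesis unfolding z_def
      using embeddingD(1,2)[OF K_subfield G_embedding(1)[OF that]] K_contains(3,4) is_subfieldD(4)[OF K_subfield]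
        G_embedding(2)[OF that l(1)] by simp
  qed
  have "inj_on (\<lambda>\<sigma>. \<sigma> z) (carrier G)"
  proof (rule inj_onI)
    fix \<sigma> \<tau> assume st: "\<sigma> \<in> carrier G" "\<tau> \<in> carrier G" "\<sigma> z = \<tau> z"
    then have eq: "l * (\<sigma> v - \<tau> v) = \<tau> u - \<sigma> u" by (simp add: sz algebra_simps)
    have "\<sigma> v = \<tau> v"
    proof (rule ccontr)
      assume "\<sigma> v \<noteq> \<tau> v"
      then have "l = (\<tau> u - \<sigma> u) / (\<sigma> v - \<tau> v)" using eq by (simp add: field_simps)
      then have "l \<in> bad" unfolding bad_def using st(1,2) by (intro image_eqI[of _ _ "(\<sigma>, \<tau>)"]) simp_all
      then show False using l(2) by blast
    qed
    then show "\<sigma> = \<tau>" using G_eqI[OF st(1,2)] eq by simp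
  qed
  with zK that show ?thesis by blast
qed

lemma power_basis:
  assumes MP: "poly_over F N" "poly N \<theta> = 0" "degree N = m" "N \<noteq> 0"
    and min: "\<And>P. poly_over F P \<Longrightarrow> poly P \<theta> = 0 \<Longrightarrow> P \<noteq> 0 \<Longrightarrow> m \<le> degree P"
  shows "ext_degree_is (adj F \<theta>) F m"
proof -
  define B where "B = (\<lambda>i. \<theta> ^ i) ` {..<m}"
  have small: "P = 0" if "poly_over F P" "poly P \<theta> = 0" "degree P < m \<or> P = 0" for P
    using min[OF that(1,2)] that(3) by (metis linorder_not_le)
  have poly_sum: "poly (\<Sum>i<m. monom (c i) i) \<theta> = (\<Sum>i<m. c i * \<theta> ^ i)" for c :: "nat \<Rightarrow> 'c"
    by (simp add: poly_sum poly_monom)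
  have coeff: "coeff (\<Sum>i<m. monom (c i) i) j = (if j < m then c j else 0)" for c :: "nat \<Rightarrow> 'c" and j
    by (simp add: coeff_sum coeff_monom sum.delta)
  have indep: "c j = 0" if c: "\<And>i. i < m \<Longrightarrow> c i \<in> F" "(\<Sum>i<m. c i * \<theta> ^ i) = 0" "j < m" for c j
  proof -
    let ?S = "\<Sum>i<m. monom (c i) i"
    have "poly_over F ?S" using c(1) is_subfieldD(1)[OF F(1)] by (simp add: poly_over_def coeff)
    moreover have "degree ?S < m \<or> ?S = 0"
    proof -
      have "degree ?S \<le> m - 1" by (rule degree_le) (use c(3) in \<open>auto simp: coeff\<close>)
      then show ?thesis using c(3) by linarith
    qed
    ultimately have "?S = 0" using small poly_sum c(2) by simp
    then show ?thesis using coeff[of c j] c(3) by simp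
  qed
  \<comment> \<open>A basis in \<open>ext_degree_is\<close> is a set of elements, so the powers must
    be pairwise distinct; a coincidence would be a relation with coefficients 1 and -1.\<close>
  have inj: "inj_on (\<lambda>i. \<theta> ^ i) {..<m}"
  proof (rule inj_onI, rule ccontr)
    fix i j assume ij: "i \<in> {..<m}" "j \<in> {..<m}" "\<theta> ^ i = \<theta> ^ j" "i \<noteq> j"
    define c :: "nat \<Rightarrow> 'c" where "c l = (if l = i then 1 else if l = j then -1 else 0)" for l
    have "(\<Sum>l<m. c l * \<theta> ^ l) = (\<Sum>l\<in>{i,j}. c l * \<theta> ^ l)"
      using ij by (intro sum.mono_neutral_right) (auto simp: c_def)
    also have "\<dots> = 0" using ij by (simp add: c_def)
    finally have sum0: "(\<Sum>l<m. c l * \<theta> ^ l) = 0" .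
    have "c l \<in> F" for l using is_subfieldD(1,2,5)[OF F(1)] by (simp add: c_def)
    from indep[OF this sum0] have "c i = 0" using ij(1) by simp
    then show False by (simp add: c_def)
  qed
  have sumB: "(\<Sum>w\<in>B. c w * w) = (\<Sum>i<m. c (\<theta> ^ i) * \<theta> ^ i)" for c :: "'c \<Rightarrow> 'c"
    unfolding B_def using inj by (simp add: sum.reindex)
  show ?thesis unfolding ext_degree_is_def
  proof (intro exI[of _ B] conjI allI impI ballI)
    show "finite B" "card B = m" using inj by (simp_all add: B_def card_image)
    show "B \<subseteq> adj F \<theta>"
    proof
      fix w assume "w \<in> B"
      then obtain i where "w = poly (monom 1 i) \<theta>" by (auto simp: B_def poly_monom)
      moreover have "poly_over F (monom 1 i)" using F(1) by (simp add: poly_over_monom is_subfieldD)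
      ultimately show "w \<in> adj F \<theta>" unfolding adj_def by blast
    qed
  next
    fix c w assume c: "(\<forall>v\<in>B. c v \<in> F) \<and> (\<Sum>v\<in>B. c v * v) = 0" and w: "w \<in> B"
    then obtain j where j: "j < m" "w = \<theta> ^ j" by (auto simp: B_def)
    have "c (\<theta> ^ j) = 0"
      by (rule indep[of "\<lambda>i. c (\<theta> ^ i)"]) (use c j sumB[of c] in \<open>auto simp: B_def\<close>)
    then show "c w = 0" using j by simp
  next
    fix x assume "x \<in> adj F \<theta>"
    then obtain P where P: "poly_over F P" "x = poly P \<theta>" by (auto simp: adj_def)
    obtain h R where R: "poly_over F h" "poly_over F R" "P = N * h + R" "R = 0 \<or> degree R < degree N"
      using poly_over_division[OF F(1) MP(1,4) P(1)] by blast
    define c where "c w = coeff R (inv_into {..<m} (\<lambda>i. \<theta> ^ i) w)" for w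
    have ci: "c (\<theta> ^ i) = coeff R i" if "i < m" for i
      unfolding c_def using inv_into_f_f[OF inj, of i] that by simp
    have "x = poly R \<theta>" unfolding P(2) R(3) by (simp add: MP(2))
    also have "R = (\<Sum>i<m. monom (coeff R i) i)"
      by (rule poly_eqI) (use R(4) MP(3) in \<open>auto simp: coeff coeff_eq_0\<close>)
    also have "poly \<dots> \<theta> = (\<Sum>w\<in>B. c w * w)" unfolding poly_sum sumB by (simp add: ci)
    finally show "\<exists>c. (\<forall>v\<in>B. c v \<in> F) \<and> x = (\<Sum>v\<in>B. c v * v)"
      using R(2) by (intro exI[of _ c]) (auto simp: c_def poly_over_def)
  qed
qed

text \<open>\<open>F\<close>\<open>'\<close> is generated by a coefficient of the product of all \<open>X - \<sigma> z\<close> with \<open>M \<sigma> \<in> H\<close>, where \<open>z\<close> has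
  pairwise different conjugates; its conjugates are permuted simply transitively by the unipotent
  matrices \<open>(1,c,0,1)\<close>.\<close>

lemma intermediate_field:
  assumes full: "M ` carrier G = carrier (SL2 k)" and inf: "infinite F" and H: "regular_subgroup k H"
  shows "\<exists>F'. is_subfield F' \<and> F \<subseteq> F' \<and> ext_degree_is F' F q \<and> irreducible_over F' (Lpoly q b div [:0,1:]) \<and>
    (\<exists>\<phi> \<in> hom (galois_group F' (Lpoly q b)) (SL2 k).
      inj_on \<phi> (carrier (galois_group F' (Lpoly q b))) \<and> \<phi> ` carrier (galois_group F' (Lpoly q b)) = H)"
proof -
  have Hsub: "H \<subseteq> carrier (SL2 k)" using H unfolding regular_subgroup_def transitive_subgroup_def by blast
  have ex: "\<exists>\<sigma> \<in> carrier G. M \<sigma> = g" if "g \<in> carrier (SL2 k)" for g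
    using full that by (metis imageE)
  have Hone: "(1,0,0,1) \<in> H"
  proof -
    obtain z w where "(1,z,0,w) \<in> H" using regular_subgroupD(3)[OF H, of 1 0] by auto
    moreover from this have "w = 1" using regular_subgroupD(4)[OF H] by fastforce
    ultimately show ?thesis using regular_subgroupD(5)[OF H] by blast
  qed
  define GH where "GH = {\<sigma> \<in> carrier G. M \<sigma> \<in> H}"
  have GHc: "\<sigma> \<circ> \<tau> \<in> GH" if "\<sigma> \<in> GH" "\<tau> \<in> GH" for \<sigma> \<tau>
    using that G_comp M_mult regular_subgroupD(1)[OF H] by (simp add: GH_def)
  obtain z where z: "z \<in> K" "inj_on (\<lambda>\<sigma>. \<sigma> z) (carrier G)" using separating_element[OF inf] .
  define Q where "Q = root_prod ((\<lambda>\<sigma>. \<sigma> z) ` GH)"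
  have finH: "finite ((\<lambda>\<sigma>. \<sigma> z) ` GH)" using finite_G by (simp add: GH_def)
  have subK: "(\<lambda>\<sigma>. \<sigma> z) ` GH \<subseteq> K" using G_embedding(3) z(1) by (auto simp: GH_def)
  have QK: "poly_over K Q" unfolding Q_def by (rule root_prod_over[OF K_subfield finH subK])
  have Qfix: "map_poly \<tau> Q = Q" if "\<tau> \<in> GH" for \<tau>
    unfolding Q_def
  proof (rule map_poly_root_prod[OF K_subfield _ finH subK])
    show "embedding K \<tau>" using that G_embedding(1) by (simp add: GH_def)
    show "\<tau> ` (\<lambda>\<sigma>. \<sigma> z) ` GH \<subseteq> (\<lambda>\<sigma>. \<sigma> z) ` GH"
    proof
      fix y assume "y \<in> \<tau> ` (\<lambda>\<sigma>. \<sigma> z) ` GH"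
      then obtain \<sigma> where "\<sigma> \<in> GH" "y = (\<tau> \<circ> \<sigma>) z" by auto
      then show "y \<in> (\<lambda>\<sigma>. \<sigma> z) ` GH" using GHc[OF that] by blast
    qed
  qed
  have coeff_map: "\<sigma> (coeff P i) = coeff (map_poly \<sigma> P) i" if "\<sigma> \<in> carrier G" for \<sigma> P i
    using embeddingD(3)[OF K_subfield G_embedding(1)[OF that]] by (simp add: coeff_map_poly)
  have ne: "H \<noteq> carrier (SL2 k)"
  proof
    assume "H = carrier (SL2 k)"
    then have "(1,1,0,1) \<in> H" by simp
    then show False using regular_subgroupD(5)[OF H] by fastforce
  qed
  then obtain g0 where g0: "g0 \<in> carrier (SL2 k)" "g0 \<notin> H" using Hsub by blast
  then obtain \<tau>0 where t0: "\<tau>0 \<in> carrier G" "M \<tau>0 = g0" using ex by blast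
  \<comment> \<open>If all coefficients were fixed, \<open>\<tau>0 z\<close> would be a root of
    \<open>Q\<close>, hence equal to some \<open>\<sigma> z\<close> with \<open>\<sigma>\<close> in
    \<open>GH\<close>; but \<open>z\<close> separates automorphisms.\<close>
  have "\<exists>i. \<tau>0 (coeff Q i) \<noteq> coeff Q i"
  proof (rule ccontr)
    assume "\<not> ?thesis"
    then have "map_poly \<tau>0 Q = Q" using coeff_map[OF t0(1)] by (intro poly_eqI) simp
    moreover have "poly Q z = 0"
      unfolding Q_def poly_root_prod[OF finH] using id_in_G Hone M_id by (intro image_eqI[of _ _ id]) (simp_all add: GH_def)
    ultimately have "poly Q (\<tau>0 z) = 0"
      using embedding_map_poly(4)[OF K_subfield G_embedding(1)[OF t0(1)] QK QK z(1)]
        embeddingD(3)[OF K_subfield G_embedding(1)[OF t0(1)]] by simp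
    then obtain \<sigma> where "\<sigma> \<in> GH" "\<tau>0 z = \<sigma> z" unfolding Q_def poly_root_prod[OF finH] by blast
    then have "\<tau>0 = \<sigma>" using inj_onD[OF z(2)] t0(1) by (simp add: GH_def)
    then show False using \<open>\<sigma> \<in> GH\<close> t0(2) g0(2) by (simp add: GH_def)
  qed
  then obtain i where i: "\<tau>0 (coeff Q i) \<noteq> coeff Q i" by blast
  define \<theta> where "\<theta> = coeff Q i"
  have \<theta>K: "\<theta> \<in> K" using QK by (simp add: \<theta>_def poly_over_def)
  have fixH: "\<sigma> \<theta> = \<theta>" if "\<sigma> \<in> GH" for \<sigma>
    using coeff_map[of \<sigma> Q i] Qfix[OF that] that by (simp add: \<theta>_def GH_def)
  \<comment> \<open>The stabilizer of \<open>\<theta>\<close>. It contains \<open>H\<close> and is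
    proper, so it is regular by the dichotomy and equals \<open>H\<close>; hence one coefficient is
    enough.\<close>
  define S where "S = M ` {\<sigma> \<in> carrier G. \<sigma> \<theta> = \<theta>}"
  have Ssub: "S \<subseteq> carrier (SL2 k)" using M_carrier by (auto simp: S_def)
  have HS: "H \<subseteq> S"
  proof
    fix g assume g: "g \<in> H"
    then obtain \<sigma> where "\<sigma> \<in> carrier G" "M \<sigma> = g" using ex Hsub by blast
    then show "g \<in> S" using g fixH by (auto simp: S_def GH_def)
  qed
  have Smult: "mmul g h \<in> S" if gh: "g \<in> S" "h \<in> S" for g h
  proof -
    obtain \<sigma> \<tau> where st: "\<sigma> \<in> carrier G" "\<tau> \<in> carrier G" "g = M \<sigma>" "h = M \<tau>" "\<sigma> \<theta> = \<theta>" "\<tau> \<theta> = \<theta>"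
      using gh by (auto simp: S_def)
    then have "mmul g h = M (\<sigma> \<circ> \<tau>)" "\<sigma> \<circ> \<tau> \<in> carrier G" "(\<sigma> \<circ> \<tau>) \<theta> = \<theta>" using M_mult G_comp by auto
    then show ?thesis unfolding S_def by blast
  qed
  have "transitive_subgroup k S"
    unfolding transitive_subgroup_def
  proof (intro conjI ballI impI)
    show "madj g \<in> S" if "g \<in> S" for g
      by (rule closed_imp_inverse_closed(2)[OF Ssub _ _ that]) (use Smult Hone HS in auto)
    show "\<exists>z w. (x,z,y,w) \<in> S" if "x \<in> k" "y \<in> k" "x \<noteq> 0 \<or> y \<noteq> 0" for x y
      using regular_subgroupD(3)[OF H that] HS by blast
  qed (use Ssub Smult in auto)
  moreover have "S \<noteq> carrier (SL2 k)"
  proof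
    assume "S = carrier (SL2 k)"
    then have "M \<tau>0 \<in> S" using g0(1) t0(2) by simp
    then obtain \<sigma> where "\<sigma> \<in> carrier G" "M \<tau>0 = M \<sigma>" "\<sigma> \<theta> = \<theta>" unfolding S_def by blast
    then have "\<sigma> = \<tau>0" using inj_onD[OF M_inj] t0(1) by blast
    then show False using i \<open>\<sigma> \<theta> = \<theta>\<close> by (simp add: \<theta>_def)
  qed
  ultimately have Sreg: "regular_subgroup k S" using full_or_regular by blast
  have "S \<subseteq> H"
  proof
    fix g assume g: "g \<in> S"
    obtain x z y w where g': "g = (x,z,y,w)" by (cases g)
    note gS = g[unfolded g']
    have "x \<in> k" "y \<in> k" "x \<noteq> 0 \<or> y \<noteq> 0" using regular_subgroupD(4)[OF Sreg gS] by auto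
    then obtain z' w' where h: "(x,z',y,w') \<in> H" using regular_subgroupD(3)[OF H] by blast
    then have "z = z' \<and> w = w'" using regular_unique[OF Sreg gS] HS by blast
    then show "g \<in> H" using h g' by simp
  qed
  then have SH: "S = H" using HS by blast
  have stab: "M \<sigma> \<in> H" if "\<sigma> \<in> carrier G" "\<sigma> \<theta> = \<theta>" for \<sigma>
    unfolding SH[symmetric] S_def using that by blast
  \<comment> \<open>The conjugates of \<open>\<theta>\<close>; there are as many as cosets of
    \<open>H\<close>, and the unipotent matrices represent these cosets.\<close>
  define \<Theta> where "\<Theta> = (\<lambda>\<sigma>. \<sigma> \<theta>) ` carrier G"
  have fin\<Theta>: "finite \<Theta>" using finite_G by (simp add: \<Theta>_def)
  have \<Theta>K: "\<Theta> \<subseteq> K" using G_embedding(3) \<theta>K by (auto simp: \<Theta>_def)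
  have "\<theta> \<in> \<Theta>" unfolding \<Theta>_def using id_in_G by (intro image_eqI[of _ _ id]) simp_all
  define U where "U c = (SOME \<sigma>. \<sigma> \<in> carrier G \<and> M \<sigma> = (1,c,0,1))" for c
  have U: "U c \<in> carrier G" "M (U c) = (1,c,0,1)" if "c \<in> k" for c
  proof -
    have "\<exists>\<sigma>. \<sigma> \<in> carrier G \<and> M \<sigma> = (1,c,0,1)" using ex[of "(1,c,0,1)"] that by auto
    from someI_ex[OF this] show "U c \<in> carrier G" "M (U c) = (1,c,0,1)" unfolding U_def by auto
  qed
  have "bij_betw (\<lambda>c. U c \<theta>) k \<Theta>"
    unfolding bij_betw_def
  proof
    show "inj_on (\<lambda>c. U c \<theta>) k"
    proof (rule inj_onI)
      fix c d assume cd: "c \<in> k" "d \<in> k" "U c \<theta> = U d \<theta>"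
      have e: "c - d \<in> k" using cd by blast
      have "M (U d \<circ> U (c - d)) = M (U c)"
        using M_mult[OF U(1)[OF cd(2)] U(1)[OF e]] U(2) cd e by simp
      then have "U d \<circ> U (c - d) = U c" using inj_onD[OF M_inj _ G_comp] U(1) cd e by blast
      then have "U d (U (c - d) \<theta>) = U d \<theta>" using cd(3) by (metis comp_apply)
      moreover have "U (c - d) \<theta> \<in> K" using G_embedding(3)[OF U(1)[OF e] \<theta>K] .
      ultimately have "U (c - d) \<theta> = \<theta>"
        using embedding_inj[OF K_subfield G_embedding(1)[OF U(1)[OF cd(2)]]] \<theta>K by (metis inj_onD)
      then have "(1,c - d,0,1) \<in> H" using stab[OF U(1)[OF e]] U(2)[OF e] by simp
      then show "c = d" using regular_subgroupD(5)[OF H] by fastforce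
    qed
    show "(\<lambda>c. U c \<theta>) ` k = \<Theta>"
    proof (intro equalityI subsetI)
      fix y assume "y \<in> (\<lambda>c. U c \<theta>) ` k"
      then show "y \<in> \<Theta>" using U(1) unfolding \<Theta>_def by blast
    next
      fix y assume "y \<in> \<Theta>"
      then obtain \<sigma> where s: "\<sigma> \<in> carrier G" "y = \<sigma> \<theta>" unfolding \<Theta>_def by blast
      obtain a b' c d where Ms: "M \<sigma> = (a,b',c,d)" by (cases "M \<sigma>")
      have abcd: "a \<in> k" "b' \<in> k" "c \<in> k" "d \<in> k" "a * d - b' * c = 1" using M_carrier[OF s(1)] Ms by auto
      then have "d \<noteq> 0 \<or> - c \<noteq> 0" by auto
      then obtain z' w' where h: "(d,z',-c,w') \<in> H" using regular_subgroupD(3)[OF H, of d "-c"] abcd by auto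
      then have h': "z' \<in> k" "w' \<in> k" "d * w' + z' * c = 1" using regular_subgroupD(4)[OF H h] by auto
      \<comment> \<open>Factorisation of \<open>M \<sigma>\<close> as \<open>(1,m,0,1)\<close> times
        an element of \<open>H\<close>: the latter is chosen with the same bottom row, as the
        inverse of the element of \<open>H\<close> with first column \<open>(d,-c)\<close>.\<close>
      obtain \<eta> where e: "\<eta> \<in> carrier G" "M \<eta> = (w',-z',c,d)"
        using ex[of "(w',-z',c,d)"] abcd h' by (auto simp: mult.commute)
      have "M \<eta> \<in> H" using regular_subgroupD(2)[OF H h] e(2) by simp
      then have "\<eta> \<theta> = \<theta>" using fixH e(1) by (simp add: GH_def)
      define m where "m = b' * w' + a * z'"
      have mk: "m \<in> k" using abcd h' by (auto simp: m_def)
      have ad: "a * d = 1 + b' * c" using abcd(5) by (simp add: algebra_simps)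
      have "w' + m * c = w' * (1 + b' * c) + a * z' * c" by (simp add: m_def algebra_simps)
      also have "\<dots> = a * (d * w' + z' * c)" unfolding ad[symmetric] by (simp add: algebra_simps)
      finally have 1: "w' + m * c = a" using h'(3) by simp
      have "- z' + m * d = b' * (d * w') + z' * (a * d - 1)" by (simp add: m_def algebra_simps)
      also have "\<dots> = b' * (d * w' + z' * c)" unfolding ad by (simp add: algebra_simps)
      finally have "- z' + m * d = b'" using h'(3) by simp
      with 1 have "M (U m \<circ> \<eta>) = M \<sigma>"
        using M_mult[OF U(1)[OF mk] e(1)] U(2)[OF mk] e(2) Ms by simp
      then have "U m \<circ> \<eta> = \<sigma>" using inj_onD[OF M_inj _ G_comp] U(1)[OF mk] e(1) s(1) by blast
      then have "y = U m \<theta>" using s(2) \<open>\<eta> \<theta> = \<theta>\<close> by (metis comp_apply)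
      then show "y \<in> (\<lambda>c. U c \<theta>) ` k" using mk by blast
    qed
  qed
  then have card\<Theta>: "card \<Theta> = q" using bij_betw_same_card card_k by metis
  \<comment> \<open>The minimal polynomial of \<open>\<theta>\<close>: its coefficients are fixed by
    \<open>G\<close>, so \<open>fixed_field\<close> places them in \<open>F\<close>.\<close>
  define N where "N = root_prod \<Theta>"
  have NK: "poly_over K N" unfolding N_def by (rule root_prod_over[OF K_subfield fin\<Theta> \<Theta>K])
  have Nfix: "map_poly \<tau> N = N" if "\<tau> \<in> carrier G" for \<tau>
    unfolding N_def
  proof (rule map_poly_root_prod[OF K_subfield G_embedding(1)[OF that] fin\<Theta> \<Theta>K])
    show "\<tau> ` \<Theta> \<subseteq> \<Theta>"
    proof
      fix y assume "y \<in> \<tau> ` \<Theta>"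
      then obtain \<sigma> where "\<sigma> \<in> carrier G" "y = (\<tau> \<circ> \<sigma>) \<theta>" by (auto simp: \<Theta>_def)
      then show "y \<in> \<Theta>" using G_comp[OF that] unfolding \<Theta>_def by blast
    qed
  qed
  have "coeff N j \<in> F" for j
    using NK coeff_map[of _ N j] Nfix by (intro fixed_field[OF full]) (simp_all add: poly_over_def)
  then have NF: "poly_over F N" by (simp add: poly_over_def)
  have N\<theta>: "poly N \<theta> = 0" "degree N = q" "N \<noteq> 0"
    unfolding N_def using poly_root_prod[OF fin\<Theta>] degree_root_prod[OF fin\<Theta>] card\<Theta> \<open>\<theta> \<in> \<Theta>\<close> root_prod_nz by auto
  define F' where "F' = adj F \<theta>"
  have F'sub: "is_subfield F'" unfolding F'_def by (rule adj_subfield[OF F(1) NF N\<theta>(3,1)])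
  have F'c: "F \<subseteq> F'" "\<theta> \<in> F'" unfolding F'_def by (rule adj_contains[OF F(1)])+
  have F'K: "F' \<subseteq> K" unfolding F'_def by (rule adj_least[OF K_subfield K_contains(1) \<theta>K])
  have ext: "ext_degree_is F' F q"
    unfolding F'_def
  proof (rule power_basis[OF NF N\<theta>])
    fix P assume P: "poly_over F P" "poly P \<theta> = 0" "P \<noteq> 0"
    have "poly P y = 0" if "y \<in> \<Theta>" for y
    proof -
      obtain \<sigma> where "\<sigma> \<in> carrier G" "y = \<sigma> \<theta>" using \<open>y \<in> \<Theta>\<close> unfolding \<Theta>_def by blast
      then show ?thesis using G_poly[OF _ P(1) \<theta>K, of \<sigma>] P(2) embeddingD(3)[OF K_subfield G_embedding(1)[of \<sigma>]] by simp
    qed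
    then show "q \<le> degree P" using poly_many_roots[OF _ fin\<Theta> P(3)] card\<Theta> by auto
  qed
  \<comment> \<open>Over \<open>F'\<close> the roots and the splitting field are unchanged; only the
    group shrinks to the stabilizer of \<open>\<theta>\<close>.\<close>
  interpret T: trinomial p n q k F' b u v
    by unfold_locales (use F'sub F'c F u uv in auto)
  have TK: "T.K = K"
    unfolding T.K_def splitting_field_def
  proof
    show "gen_field (F' \<union> {x. poly (Lpoly q b) x = 0}) \<subseteq> K"
      using F'K K_contains(2) by (intro gen_field_least[OF K_subfield]) (auto simp: V_def)
    show "K \<subseteq> gen_field (F' \<union> {x. poly (Lpoly q b) x = 0})"
      using gen_field_contains[of "F' \<union> {x. poly (Lpoly q b) x = 0}"] F'c(1) uV vV uv
      by (intro K_least[OF gen_field_subfield, of _ u v]) (auto simp: V_def)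
  qed
  have TG: "carrier T.G = {\<sigma> \<in> carrier G. \<sigma> \<theta> = \<theta>}"
  proof (intro equalityI subsetI)
    fix \<sigma> assume s: "\<sigma> \<in> carrier T.G"
    then have "\<sigma> \<in> carrier G" using F'c(1) unfolding T.G_iff G_iff TK by blast
    then show "\<sigma> \<in> {\<sigma> \<in> carrier G. \<sigma> \<theta> = \<theta>}" using T.G_embedding(2)[OF s F'c(2)] by simp
  next
    fix \<sigma> assume s: "\<sigma> \<in> {\<sigma> \<in> carrier G. \<sigma> \<theta> = \<theta>}"
    have "\<sigma> x = x" if "x \<in> F'" for x
    proof -
      obtain P where "poly_over F P" "x = poly P \<theta>" using \<open>x \<in> F'\<close> unfolding F'_def adj_def by blast
      then show ?thesis using G_poly[of \<sigma> P \<theta>] s \<theta>K by simp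
    qed
    then show "\<sigma> \<in> carrier T.G" using s unfolding T.G_iff G_iff TK by simp
  qed
  have TMH: "T.M ` carrier T.G = H" unfolding TG T.M_def[abs_def] SH[symmetric] S_def M_def ..
  have "irreducible_over F' (Lpoly q b div [:0,1:])"
  proof (rule T.transitive_imp_irreducible)
    fix r assume "r \<in> T.V - {0}"
    then obtain x y where xy: "x \<in> k" "y \<in> k" "x \<noteq> 0 \<or> y \<noteq> 0" "r = x * u + y * v"
      unfolding T.V_nonzero by auto
    then obtain z w where "(x,z,y,w) \<in> H" using regular_subgroupD(3)[OF H] by blast
    then obtain \<sigma> where "\<sigma> \<in> carrier T.G" "T.M \<sigma> = (x,z,y,w)" unfolding TMH[symmetric] by (metis imageE)
    then show "\<exists>\<sigma>\<in>carrier T.G. \<sigma> u = r" using T.M_column(1) xy(4) by blast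
  qed
  with F'sub F'c(1) ext T.M_hom T.M_inj TMH show ?thesis by blast
qed

end

section \<open>The generic polynomial\<close>

text \<open>The subfield k(x), described by quotients; for transcendental \<open>x\<close> a copy of
  the rational function field.\<close>

definition ratfun :: "'c::field set \<Rightarrow> 'c \<Rightarrow> 'c set" where
  "ratfun k x = {poly A x / poly B x | A B. poly_over k A \<and> poly_over k B \<and> poly B x \<noteq> 0}"

lemma ratfun_subfield: assumes k: "is_subfield k" shows "is_subfield (ratfun k x)"
proof -
  have mem: "poly A x / poly B x \<in> ratfun k x" if "poly_over k A" "poly_over k B" "poly B x \<noteq> 0" for A B
    using that unfolding ratfun_def by blast
  have "a + b \<in> ratfun k x" "a * b \<in> ratfun k x" "- a \<in> ratfun k x"
    if ab: "a \<in> ratfun k x" "b \<in> ratfun k x" for a b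
  proof -
    obtain A B where A: "poly_over k A" "poly_over k B" "poly B x \<noteq> 0" "a = poly A x / poly B x"
      using ab(1) unfolding ratfun_def by blast
    obtain A' B' where B: "poly_over k A'" "poly_over k B'" "poly B' x \<noteq> 0" "b = poly A' x / poly B' x"
      using ab(2) unfolding ratfun_def by blast
    have "a + b = poly (A * B' + A' * B) x / poly (B * B') x"
      unfolding A(4) B(4) using A(3) B(3) by (simp add: add_frac_eq)
    then show "a + b \<in> ratfun k x"
      using mem[of "A * B' + A' * B" "B * B'"] A B k by (simp add: poly_over_add poly_over_mult)
    have "a * b = poly (A * A') x / poly (B * B') x" unfolding A(4) B(4) by simp
    then show "a * b \<in> ratfun k x"
      using mem[of "A * A'" "B * B'"] A B k by (simp add: poly_over_mult)
    have "- a = poly (- A) x / poly B x" unfolding A(4) by simp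
    then show "- a \<in> ratfun k x"
      using mem[of "- A" B] A k by (simp add: poly_over_uminus)
  qed
  moreover have "inverse a \<in> ratfun k x" if a: "a \<in> ratfun k x" "a \<noteq> 0" for a
  proof -
    obtain A B where A: "poly_over k A" "poly_over k B" "poly B x \<noteq> 0" "a = poly A x / poly B x"
      using a(1) unfolding ratfun_def by blast
    then show ?thesis using mem[of B A] a(2) by simp
  qed
  moreover have "0 \<in> ratfun k x" "1 \<in> ratfun k x"
    using mem[of 0 1] mem[of 1 1] k by simp_all
  ultimately show ?thesis unfolding is_subfield_def by simp
qed

lemma ratfun_contains: assumes k: "is_subfield k" shows "k \<subseteq> ratfun k x" "x \<in> ratfun k x"
proof -
  have mem: "poly A x / poly 1 x \<in> ratfun k x" if "poly_over k A" for A
  proof -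
    have "poly_over k 1" "poly 1 x \<noteq> 0" using k by simp_all
    then show ?thesis using that unfolding ratfun_def by blast
  qed
  show "k \<subseteq> ratfun k x" using mem[of "[:_:]"] k by auto
  show "x \<in> ratfun k x" using mem[of "[:0,1:]"] k is_subfieldD(1,2)[OF k] by simp
qed

lemma dvd_mult_X_power:
  fixes D a :: "'c::field poly"
  assumes "poly D 0 \<noteq> 0" shows "D dvd a * [:0,1:] ^ m \<Longrightarrow> D dvd a"
proof (induction m)
  case (Suc m)
  let ?X = "[:0,1::'c:]"
  obtain h where h: "a * ?X ^ Suc m = D * h" using Suc.prems by (elim dvdE)
  have "poly (D * h) 0 = 0" unfolding h[symmetric] by simp
  then have "poly h 0 = 0" using assms by simp
  then obtain h' where h': "h = ?X * h'" using poly_eq_0_iff_dvd[of h 0] by (auto elim!: dvdE)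
  have "?X * (a * ?X ^ m) = ?X * (D * h')" using h unfolding h' by (simp only: power_Suc mult_ac)
  then have "a * ?X ^ m = D * h'" by simp
  then show ?case using Suc.IH by simp
qed simp

text \<open>Linearity of \<open>D(x) + T x\<^sup>m\<close> in \<open>T\<close> makes it generate the kernel of \<open>T \<mapsto> - D(u) / u\<^sup>m\<close>:
  divisibility by \<open>D\<close> kills the coefficients one after the other.\<close>

lemma no_relation:
  fixes D :: "'c::field poly"
  assumes D: "poly D 0 \<noteq> 0" "degree D = N"
  shows "\<lbrakk>\<And>j. j \<le> J \<Longrightarrow> degree (a j) < N; (\<Sum>j\<le>J. a j * (- D) ^ j * ([:0,1:] ^ m) ^ (J - j)) = 0; j \<le> J\<rbrakk> \<Longrightarrow> a j = 0"
proof (induction J arbitrary: a j)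
  case 0
  then show ?case by simp
next
  case (Suc J)
  let ?C = "[:0,1::'c:] ^ m"
  have D0: "D \<noteq> 0" using D(1) by auto
  have "(\<Sum>j\<le>Suc J. a j * (- D) ^ j * ?C ^ (Suc J - j))
      = a 0 * ?C ^ Suc J + (\<Sum>j\<le>J. a (Suc j) * (- D) ^ Suc j * ?C ^ (J - j))"
    by (subst sum.atMost_Suc_shift) simp
  also have "(\<Sum>j\<le>J. a (Suc j) * (- D) ^ Suc j * ?C ^ (J - j))
      = - D * (\<Sum>j\<le>J. a (Suc j) * (- D) ^ j * ?C ^ (J - j))"
    by (simp add: sum_distrib_left mult_ac del: mult_minus_left)
  finally have eq: "a 0 * ?C ^ Suc J + - D * (\<Sum>j\<le>J. a (Suc j) * (- D) ^ j * ?C ^ (J - j)) = 0"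
    using Suc.prems(2) by simp
  then have "a 0 * ?C ^ Suc J = D * (\<Sum>j\<le>J. a (Suc j) * (- D) ^ j * ?C ^ (J - j))" by simp
  then have "a 0 * [:0,1:] ^ (m * Suc J) = D * (\<Sum>j\<le>J. a (Suc j) * (- D) ^ j * ?C ^ (J - j))"
    by (simp only: power_mult)
  then have "D dvd a 0 * [:0,1:] ^ (m * Suc J)" by (rule dvdI)
  then have "D dvd a 0" by (rule dvd_mult_X_power[OF D(1)])
  have a0: "a 0 = 0"
  proof (rule ccontr)
    assume "a 0 \<noteq> 0"
    then have "degree D \<le> degree (a 0)" using \<open>D dvd a 0\<close> by (rule dvd_imp_degree_le[rotated])
    then show False using Suc.prems(1)[of 0] D(2) by simp
  qed
  then have "(\<Sum>j\<le>J. a (Suc j) * (- D) ^ j * ?C ^ (J - j)) = 0" using eq D0 by simp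
  then have "a (Suc i) = 0" if "i \<le> J" for i
    using Suc.IH[of "\<lambda>j. a (Suc j)" i] Suc.prems(1) that by simp
  then show ?case using a0 Suc.prems(3) by (cases j) auto
qed

text \<open>At \<open>x = 0\<close> the function \<open>A / B\<close> would have a pole of order \<open>(q + 1) / q\<close> if equality held.\<close>

lemma no_rational_solution:
  fixes A B :: "'c::field poly"
  assumes q: "q > 1"
  shows "B \<noteq> 0 \<Longrightarrow> [:0,1:] * A ^ q - [:0,1:] ^ q * A * B ^ (q - 1) \<noteq> B ^ q"
proof (induction "degree B" arbitrary: A B rule: less_induct)
  case less
  let ?X = "[:0,1::'c:]"
  define r where "r = q - 2"
  then have r: "q = Suc (Suc r)" using q by simp
  show ?case
  proof
    assume eq: "?X * A ^ q - ?X ^ q * A * B ^ (q - 1) = B ^ q"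
    \<comment> \<open>Descent: the equation forces X to divide \<open>B\<close>, then
      \<open>A\<close>, and the quotients satisfy the same equation with smaller degree of the
      denominator.\<close>
    have "poly (B ^ q) 0 = 0" unfolding eq[symmetric] using q by (simp add: power_0_left)
    then have "poly B 0 = 0" using q by simp
    then obtain B' where B': "B = ?X * B'" using poly_eq_0_iff_dvd[of B 0] by (auto elim!: dvdE)
    have B'0: "B' \<noteq> 0" using less.prems B' by auto
    have pX: "?X ^ q = ?X * ?X ^ (q - 1)" using q by (simp add: power_eq_if[of _ q] del: mult_pCons_left)
    have "?X * (A ^ q - ?X ^ (q - 1) * A * B ^ (q - 1)) = ?X * A ^ q - ?X ^ q * A * B ^ (q - 1)"
      unfolding pX by (simp only: right_diff_distrib mult_ac)
    also have "\<dots> = ?X * (?X ^ (q - 1) * B' ^ q)"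
      unfolding eq unfolding B' power_mult_distrib pX by (simp only: mult_ac)
    finally have "?X * (A ^ q - ?X ^ (q - 1) * A * B ^ (q - 1)) = ?X * (?X ^ (q - 1) * B' ^ q)" .
    then have eq2: "A ^ q - ?X ^ (q - 1) * A * B ^ (q - 1) = ?X ^ (q - 1) * B' ^ q" by simp
    have "poly (A ^ q) 0 = poly (?X ^ (q - 1) * A * B ^ (q - 1) + ?X ^ (q - 1) * B' ^ q) 0"
      unfolding eq2[symmetric] by simp
    also have "\<dots> = 0" by (simp add: r)
    finally have "poly A 0 = 0" using q by simp
    then obtain A' where A': "A = ?X * A'" using poly_eq_0_iff_dvd[of A 0] by (auto elim!: dvdE)
    have "?X ^ q * (?X * A' ^ q - ?X ^ q * A' * B' ^ (q - 1)) = ?X ^ q * B' ^ q"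
    proof -
      have "?X ^ q * (?X * A' ^ q - ?X ^ q * A' * B' ^ (q - 1)) = ?X * A ^ q - ?X ^ q * A * B ^ (q - 1)"
        unfolding A' B' power_mult_distrib right_diff_distrib
        unfolding pX by (simp only: mult_ac)
      then show ?thesis unfolding eq unfolding B' power_mult_distrib .
    qed
    then have "?X * A' ^ q - ?X ^ q * A' * B' ^ (q - 1) = B' ^ q" by simp
    moreover have "degree B' < degree B" unfolding B' using B'0 by (subst degree_mult_eq) auto
    ultimately show False using less.hyps[OF _ B'0] by blast
  qed
qed

context finite_subfield
begin

lemma ex_\<Delta>_1: assumes "u \<noteq> 0" shows "\<exists>v. \<Delta> u v = (1::'c)"
proof -
  let ?Q = "monom u q - monom (u ^ q) 1 - 1 :: 'c poly"
  have "coeff ?Q q = u" using q_gt_1 by (simp add: coeff_monom)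
  then have "degree ?Q > 0" using assms q_gt_1 le_degree[of ?Q q] by simp
  then obtain v where "poly ?Q v = 0" using alg_closed_imp_poly_has_root by blast
  then show ?thesis by (intro exI[of _ v]) (simp add: \<Delta>_def poly_monom)
qed

lemma full_iso: assumes "\<phi> \<in> hom H (SL2 k)" "inj_on \<phi> (carrier H)" "\<phi> ` carrier H = carrier (SL2 k)"
  shows "H \<cong> SL2 k"
  using assms by (intro is_isoI[of \<phi>]) (simp add: iso_def bij_betw_def)

lemma galois_cases:
  assumes F: "is_subfield F" "k \<subseteq> F" "b \<in> F" and irr: "irreducible_over F (Lpoly q b div [:0,1:])"
  shows "galois_group F (Lpoly q b) \<cong> SL2 k \<or> (q \<in> {2,3,5,7,11} \<and>
    (\<exists>\<phi> \<in> hom (galois_group F (Lpoly q b)) (SL2 k). inj_on \<phi> (carrier (galois_group F (Lpoly q b))) \<and>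
       regular_subgroup k (\<phi> ` carrier (galois_group F (Lpoly q b)))))"
proof -
  have "q\<^sup>2 - 1 > 0" using q_gt_1 power_strict_mono[of 1 q 2] by simp
  then obtain u where u0: "poly (Lpoly q b div [:0,1:]) u = 0"
    using alg_closed_imp_poly_has_root Lpoly_nz(2)[of b] by metis
  then have "u \<noteq> 0" using Lpoly_nz(3)[of b] by auto
  moreover from this have "poly (Lpoly q b) u = 0" using root_iff u0 by blast
  moreover obtain v where "\<Delta> u v = 1" using ex_\<Delta>_1[OF \<open>u \<noteq> 0\<close>] by blast
  ultimately interpret T: trinomial p n q k F b u v using F by unfold_locales auto
  have "transitive_subgroup k (T.M ` carrier T.G)" by (rule T.irreducible_transitive[OF irr])
  then consider "T.M ` carrier T.G = carrier (SL2 k)" | "regular_subgroup k (T.M ` carrier T.G)"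
    using full_or_regular by blast
  then show ?thesis
  proof cases
    case 1
    then show ?thesis using full_iso[OF T.M_hom T.M_inj] by blast
  next
    case 2
    then show ?thesis using regular_imp_q T.M_hom T.M_inj by blast
  qed
qed

lemma galois_iso_model:
  assumes F: "is_subfield F" "k \<subseteq> F" "b \<in> F" and irr: "irreducible_over F (Lpoly q b div [:0,1:])"
    and model: "regular_model H"
  shows "galois_group F (Lpoly q b) \<cong> H \<or> galois_group F (Lpoly q b) \<cong> SL2 k"
  using galois_cases[OF F irr] iso_regular_model[OF model] by blast

lemma model_occurs:
  assumes tr: "transcendental_over k (u::'c)" and model: "regular_model H"
  shows "occurs_over_rational_function_field q H TYPE('c)"
proof -
  note ks = k_subfield
  have trP: "P = 0" if "poly_over k P" "poly P u = 0" for P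
    using tr that unfolding transcendental_over_def by blast
  have u0: "u \<noteq> 0"
  proof
    assume "u = 0"
    then have "[:0,1::'c:] = 0" by (intro trP) (simp_all add: ks)
    then show False by simp
  qed
  define N where "N = q\<^sup>2 - 1"
  have N: "N > 0" "q\<^sup>2 = Suc N" using q_gt_1 power_strict_mono[of 1 q 2] by (simp_all add: N_def)
  \<comment> \<open>L(u) = 0 solved for the middle coefficient.\<close>
  define t where "t = - (u ^ q\<^sup>2 + u) / u ^ q"
  have Lu: "poly (Lpoly q t) u = 0" using u0 by (simp add: poly_Lpoly t_def field_simps)
  \<comment> \<open>L(x)/x is D(x) + t x^(q-1), linear in t.\<close>
  define D :: "'c poly" where "D = monom 1 N + 1"
  have D0: "poly D 0 \<noteq> 0" using N by (simp add: D_def poly_monom power_0_left)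
  have Dd: "degree D = N"
    unfolding D_def using N(1) by (subst degree_add_eq_left) (simp_all add: degree_monom_eq)
  have tC: "t * u ^ (q - 1) = - poly D u"
  proof -
    have "u ^ q = u * u ^ (q - 1)" using q_gt_1 by (simp add: power_eq_if)
    then show ?thesis using u0 by (simp add: t_def D_def poly_monom N(2) field_simps)
  qed
  \<comment> \<open>The powers of \<open>u\<close> below N are linearly independent over k[t]; both
    the transcendence of \<open>t\<close> and the degree of \<open>u\<close> follow from
    this.\<close>
  have core: "A i = 0" if A: "\<And>i. poly_over k (A i)" "(\<Sum>i<N. poly (A i) t * u ^ i) = 0" "i < N" for A i
  proof -
    define J where "J = Max ((\<lambda>i. degree (A i)) ` {..<N})"
    have J: "degree (A i) \<le> J" if "i < N" for i unfolding J_def using that by (intro Max_ge) auto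
    \<comment> \<open>The relation is regrouped by powers of \<open>t\<close>: \<open>a j\<close>
      collects the polynomial in \<open>u\<close> that multiplies the j-th power.\<close>
    define a where "a j = (\<Sum>i<N. monom (coeff (A i) j) i)" for j
    have ca: "coeff (a j) i = (if i < N then coeff (A i) j else 0)" for i j
      by (simp add: a_def coeff_sum coeff_monom sum.delta)
    have da: "degree (a j) < N" for j
    proof -
      have "degree (a j) \<le> N - 1" by (rule degree_le) (auto simp: ca)
      then show ?thesis using N by linarith
    qed
    have pa: "poly (a j) u = (\<Sum>i<N. coeff (A i) j * u ^ i)" for j by (simp add: a_def poly_sum poly_monom)
    have pA: "poly (A i) t = (\<Sum>j\<le>J. coeff (A i) j * t ^ j)" if "i < N" for i
      unfolding poly_altdef using J[OF that] by (intro sum.mono_neutral_left) (auto simp: coeff_eq_0)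
    let ?C = "[:0,1::'c:] ^ (q - 1)"
    \<comment> \<open>Multiplying by the J-th power of u^(q-1) replaces \<open>t\<close> by
      -D(u)/u^(q-1) and gives a polynomial relation in the transcendental \<open>u\<close>.\<close>
    have "poly (\<Sum>j\<le>J. a j * (- D) ^ j * ?C ^ (J - j)) u
        = (\<Sum>j\<le>J. poly (a j) u * (t * u ^ (q - 1)) ^ j * (u ^ (q - 1)) ^ (J - j))"
      unfolding tC by (simp add: poly_sum)
    also have "\<dots> = (\<Sum>j\<le>J. (u ^ (q - 1)) ^ J * (poly (a j) u * t ^ j))"
    proof (rule sum.cong[OF refl])
      fix j assume "j \<in> {..J}"
      then have "(u ^ (q - 1)) ^ J = (u ^ (q - 1)) ^ j * (u ^ (q - 1)) ^ (J - j)"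
        unfolding power_add[symmetric] by simp
      then show "poly (a j) u * (t * u ^ (q - 1)) ^ j * (u ^ (q - 1)) ^ (J - j) = (u ^ (q - 1)) ^ J * (poly (a j) u * t ^ j)"
        by (simp only: power_mult_distrib mult_ac)
    qed
    also have "\<dots> = (u ^ (q - 1)) ^ J * (\<Sum>j\<le>J. \<Sum>i<N. coeff (A i) j * u ^ i * t ^ j)"
      by (simp add: sum_distrib_left pa sum_distrib_right)
    also have "(\<Sum>j\<le>J. \<Sum>i<N. coeff (A i) j * u ^ i * t ^ j) = (\<Sum>i<N. poly (A i) t * u ^ i)"
      by (subst sum.swap) (simp add: pA sum_distrib_left sum_distrib_right mult_ac)
    finally have "poly (\<Sum>j\<le>J. a j * (- D) ^ j * ?C ^ (J - j)) u = 0" using A(2) by simp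
    moreover have "poly_over k (\<Sum>j\<le>J. a j * (- D) ^ j * ?C ^ (J - j))"
    proof -
      have pw: "poly_over k (P ^ e)" if "poly_over k P" for P e
        using that by (induction e) (simp_all add: ks poly_over_mult)
      have "poly_over k (a j)" for j using A(1) by (simp add: poly_over_def ca)
      moreover have "poly_over k D" unfolding D_def by (intro poly_over_add poly_over_monom) (simp_all add: ks)
      moreover have "poly_over k [:0,1:]" by (simp add: ks)
      ultimately have "poly_over k (a j * (- D) ^ j * ?C ^ (J - j))" for j
        by (intro poly_over_mult pw poly_over_uminus ks)
      then show ?thesis unfolding poly_over_def coeff_sum by (intro allI subfield_sum[OF ks]) simp
    qed
    ultimately have "(\<Sum>j\<le>J. a j * (- D) ^ j * ?C ^ (J - j)) = 0" by (intro trP)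
    then have "a j = 0" if "j \<le> J" for j using no_relation[OF D0 Dd, of J a "q - 1" j] da that by simp
    then have "coeff (A i) j = 0" for j
      using ca[of j i] A(3) J[OF A(3)] by (cases "j \<le> J") (auto simp: coeff_eq_0)
    then show ?thesis by (intro poly_eqI) simp
  qed
  have trt: "P = 0" if P: "poly_over k P" "poly P t = 0" for P
  proof -
    have "(\<Sum>i<N. poly (if i = 0 then P else 0) t * u ^ i) = 0"
      by (rule sum.neutral) (simp add: P(2))
    then show ?thesis using core[of "\<lambda>i. if i = 0 then P else 0" 0] N(1) P(1) ks by simp
  qed
  then have tt: "transcendental_over k t" unfolding transcendental_over_def by blast
  define E where "E = gen_field (k \<union> {t})"
  have Es: "is_subfield E" unfolding E_def by (rule gen_field_subfield)
  have Ec: "k \<subseteq> E" "t \<in> E" unfolding E_def using gen_field_contains[of "k \<union> {t}"] by simp_all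
  have Er: "E \<subseteq> ratfun k t"
    unfolding E_def using ratfun_contains[OF ks, of t] by (intro gen_field_least ratfun_subfield ks) auto
  \<comment> \<open>Infinitely many scalars are required for the separating element in
    \<open>intermediate_field\<close>.\<close>
  have infE: "infinite E"
  proof
    assume "finite E"
    moreover have "range (\<lambda>i::nat. t ^ i) \<subseteq> E" using is_subfieldD(9)[OF Es Ec(2)] by blast
    ultimately have "finite (range (\<lambda>i::nat. t ^ i))" by (rule rev_finite_subset)
    then have "\<not> inj (\<lambda>i::nat. t ^ i)" using range_inj_infinite by blast
    then obtain i j :: nat where ij: "t ^ i = t ^ j" "i \<noteq> j" by (auto simp: inj_on_def)
    have "monom 1 i - monom 1 j = (0 :: 'c poly)"
      by (rule trt) (simp_all add: poly_over_diff poly_over_monom ks poly_monom ij(1))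
    then have "coeff (monom 1 i - monom 1 j :: 'c poly) i = 0" by simp
    then show False using ij(2) by (simp add: coeff_monom)
  qed
  have deg_u: "N \<le> degree P" if P: "poly_over E P" "poly P u = 0" "P \<noteq> 0" for P
  proof (rule ccontr)
    assume "\<not> N \<le> degree P"
    have "\<exists>A B. poly_over k A \<and> poly_over k B \<and> poly B t \<noteq> 0 \<and> coeff P i = poly A t / poly B t" for i
      using P(1) Er unfolding poly_over_def ratfun_def by blast
    then obtain A B where AB: "\<And>i. poly_over k (A i)" "\<And>i. poly_over k (B i)" "\<And>i. poly (B i) t \<noteq> 0"
      "\<And>i. coeff P i = poly (A i) t / poly (B i) t" by metis
    \<comment> \<open>Common denominator \<open>d\<close> of the coefficients, turning a relation
      over k(t) into one over k[t].\<close>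
    define A' where "A' i = A i * (\<Prod>j\<in>{..<N} - {i}. B j)" for i
    define d where "d = (\<Prod>j<N. poly (B j) t)"
    have d0: "d \<noteq> 0" unfolding d_def using AB(3) by simp
    have A't: "poly (A' i) t = coeff P i * d" if "i < N" for i
    proof -
      have "d = poly (B i) t * (\<Prod>j\<in>{..<N} - {i}. poly (B j) t)"
        unfolding d_def using that by (subst prod.remove[of _ i]) auto
      then show ?thesis using AB(3,4)[of i] by (simp add: A'_def poly_prod)
    qed
    have "(\<Sum>i<N. poly (A' i) t * u ^ i) = d * (\<Sum>i<N. coeff P i * u ^ i)"
      by (simp add: A't sum_distrib_left mult_ac)
    also have "(\<Sum>i<N. coeff P i * u ^ i) = poly P u"
      unfolding poly_altdef using \<open>\<not> N \<le> degree P\<close> by (intro sum.mono_neutral_right) (auto simp: coeff_eq_0)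
    finally have "(\<Sum>i<N. poly (A' i) t * u ^ i) = 0" using P(2) by simp
    moreover have "poly_over k (A' i)" for i
    proof -
      have "poly_over k (prod B S)" for S
        by (induction S rule: infinite_finite_induct) (simp_all add: ks AB(2) poly_over_mult)
      then show ?thesis unfolding A'_def by (intro poly_over_mult ks AB(1))
    qed
    ultimately have "A' i = 0" if "i < N" for i using core that by blast
    then have "coeff P i * d = 0" if "i < N" for i using A't[OF that] that by simp
    then have "coeff P i = 0" for i using d0 \<open>\<not> N \<le> degree P\<close> by (cases "i < N") (auto simp: coeff_eq_0)
    then show False using P(3) by (metis leading_coeff_0_iff)
  qed
  obtain v where v: "\<Delta> u v = 1" using ex_\<Delta>_1[OF u0] by blast
  interpret T: trinomial p n q k E t u v by unfold_locales (use Es Ec Lu u0 v in auto)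
  have irr: "irreducible_over E (Lpoly q t div [:0,1:])"
  proof -
    let ?P = "Lpoly q t div [:0,1:]"
    have dP: "degree ?P = N" using Lpoly_nz(2)[of t] by (simp add: N_def)
    have over: "poly_over E ?P"
      unfolding Lpoly_div[of q t, OF order.strict_trans[OF zero_less_one q_gt_1]]
      using Es Ec by (intro poly_over_add poly_over_monom) (simp_all add: is_subfieldD)
    have "degree g = 0 \<or> degree h = 0" if gh: "poly_over E g" "poly_over E h" "?P = g * h" for g h
    proof -
      have nz: "g \<noteq> 0" "h \<noteq> 0" using gh(3) Lpoly_nz(1)[of t] by auto
      have d: "N = degree g + degree h" using dP gh(3) nz by (simp add: degree_mult_eq)
      have "poly g u * poly h u = 0" using root_iff[OF u0, of t] Lu gh(3) by simp
      then have "N \<le> degree g \<or> N \<le> degree h" using deg_u gh nz by auto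
      then show ?thesis using d by linarith
    qed
    then show ?thesis unfolding irreducible_over_def using over dP N(1) by simp
  qed
  \<comment> \<open>F(u) lies in k(u), where \<open>\<Delta> u v = 1\<close> has no solution
    \<open>v\<close>.\<close>
  have vFu: "v \<notin> T.Fu"
  proof
    assume "v \<in> T.Fu"
    moreover have "T.Fu \<subseteq> ratfun k u"
    proof -
      note R = ratfun_subfield[OF ks, of u] and Rc = ratfun_contains[OF ks, of u]
      note RD = is_subfieldD[OF R]
      have "t \<in> ratfun k u" unfolding t_def using Rc(2) by (intro RD(8) RD(5) RD(3) RD(9))
      then have "E \<subseteq> ratfun k u" unfolding E_def using Rc by (intro gen_field_least R) auto
      then show ?thesis unfolding T.Fu_def using Rc by (intro adj_least R) auto
    qed
    ultimately obtain A B where AB: "poly_over k A" "poly_over k B" "poly B u \<noteq> 0" "v = poly A u / poly B u"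
      unfolding ratfun_def by blast
    \<comment> \<open>\<open>\<Delta> u v = 1\<close> with v = A(u)/B(u), cleared of
      denominators.\<close>
    let ?P = "[:0,1:] * A ^ q - [:0,1:] ^ q * A * B ^ (q - 1) - B ^ q"
    have bq: "poly B u ^ q = poly B u * poly B u ^ (q - 1)" using q_gt_1 by (simp add: power_eq_if)
    have "poly ?P u = poly B u ^ q * (\<Delta> u v - 1)"
      unfolding AB(4) \<Delta>_def using AB(3) by (simp add: power_divide field_simps bq)
    then have "poly ?P u = 0" using v by simp
    moreover have "poly_over k ?P"
    proof -
      have pw: "poly_over k (P ^ e)" if "poly_over k P" for P e
        using that by (induction e) (simp_all add: ks poly_over_mult)
      have "poly_over k [:0,1:]" by (simp add: ks)
      then show ?thesis using AB(1,2) by (intro poly_over_diff poly_over_mult pw ks)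
    qed
    ultimately have "?P = 0" by (intro trP)
    then have "[:0,1:] * A ^ q - [:0,1:] ^ q * A * B ^ (q - 1) = B ^ q" by simp
    moreover have "B \<noteq> 0" using AB(3) by auto
    ultimately show False using no_rational_solution[OF q_gt_1] by blast
  qed
  have full: "T.M ` carrier T.G = carrier (SL2 k)"
  proof (rule ccontr)
    assume "T.M ` carrier T.G \<noteq> carrier (SL2 k)"
    then have reg: "regular_subgroup k (T.M ` carrier T.G)"
      using full_or_regular[OF T.irreducible_transitive[OF irr]] by blast
    \<comment> \<open>In the regular case an automorphism fixing \<open>u\<close> is trivial. But
      the minimal polynomial of \<open>v\<close> over F(u) is not linear, and a second root yields
      one that moves \<open>v\<close>.\<close>
    obtain m where m: "poly_over T.Fu m" "m \<noteq> 0" "poly m v = 0"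
      "\<And>r. poly_over T.Fu r \<Longrightarrow> poly r v = 0 \<Longrightarrow> \<exists>h. poly_over T.Fu h \<and> r = m * h"
      using minimal_polynomial[OF T.Fu_subfield T.\<Delta>_poly_over[OF T.Fu_subfield T.Fu_contains(2)] T.\<Delta>_poly_nz, of v]
        v by (simp add: T.poly_\<Delta>_poly) metis
    obtain m1 where m1: "m = [:- v, 1:] * m1" using m(3) poly_eq_0_iff_dvd by (metis dvdE)
    have "degree m1 \<noteq> 0"
    proof
      assume "degree m1 = 0"
      then obtain c where c: "m1 = [:c:]" by (metis degree_eq_zeroE)
      then have "c \<noteq> 0" using m(2) m1 by auto
      have "coeff m 0 = - (c * v)" "coeff m 1 = c" unfolding m1 c by simp_all
      then have "c \<in> T.Fu" "- (c * v) \<in> T.Fu" using m(1) unfolding poly_over_def by metis+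
      then have "- (- (c * v)) / c \<in> T.Fu" using is_subfieldD(5,8)[OF T.Fu_subfield] by blast
      then show False using vFu \<open>c \<noteq> 0\<close> by simp
    qed
    then obtain w where w: "poly m1 w = 0" using alg_closed_imp_poly_has_root by blast
    obtain h where h: "T.\<Delta>_poly u = m * h"
      using m(4)[OF T.\<Delta>_poly_over[OF T.Fu_subfield T.Fu_contains(2)]] v by (auto simp: T.poly_\<Delta>_poly)
    \<comment> \<open>Separability: the derivative of the polynomial for \<open>v\<close> is the
      nonzero constant -u^q.\<close>
    have "w \<noteq> v"
    proof
      assume "w = v"
      then obtain m2 where m2: "m1 = [:- v, 1:] * m2" using w poly_eq_0_iff_dvd by (metis dvdE)
      define R where "R = [:- v, 1:]"
      have "poly R v = 0" by (simp add: R_def)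
      have "T.\<Delta>_poly u = R * (R * (m2 * h))" unfolding h m1 m2 R_def[symmetric] by (simp only: mult_ac)
      then have "poly (pderiv (T.\<Delta>_poly u)) v = 0" using \<open>poly R v = 0\<close> by (simp add: pderiv_mult)
      moreover have "(of_nat q :: 'c) = 0" using q_eq n_pos by (simp add: power_0_left)
      then have "pderiv (T.\<Delta>_poly u) = - [:u ^ q:]"
        by (simp add: T.\<Delta>_poly_def pderiv_diff pderiv_monom monom_0)
      ultimately show False using u0 by simp
    qed
    have idF: "embedding T.Fu id" by (simp add: embedding_def)
    have rel: "poly (map_poly id P) w = 0" if P: "poly_over T.Fu P" "poly P v = 0" for P
    proof -
      obtain h where "P = m * h" using m(4)[OF P] by blast
      then show ?thesis using w m1 by simp
    qed
    have "\<exists>\<tau> \<in> carrier T.G. \<tau> u = id u \<and> \<tau> v = w"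
      by (rule T.extend_to_G[OF idF _ _ _ rel]) (simp_all add: T.uV u0)
    then obtain \<tau> where \<tau>: "\<tau> \<in> carrier T.G" "\<tau> u = u" "\<tau> v = w" by auto
    obtain c d where M: "T.M \<tau> = (1, c, 0, d)" using v \<tau>(2) by (simp add: T.M_def)
    then have "d = 1" using T.M_carrier[OF \<tau>(1)] by simp
    then have "(1,c,0,1) \<in> T.M ` carrier T.G" using M \<tau>(1) by (metis imageI)
    then have "c = 0" by (rule regular_subgroupD(5)[OF reg])
    then have "\<tau> v = v" using T.M_column(2)[OF \<tau>(1) M] \<open>d = 1\<close> by simp
    then show False using \<tau>(3) \<open>w \<noteq> v\<close> by simp
  qed
  obtain \<psi> where \<psi>: "regular_subgroup k (\<psi> ` carrier H)" using model unfolding regular_model_def by blast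
  obtain F' where F': "is_subfield F'" "E \<subseteq> F'" "ext_degree_is F' E q" "irreducible_over F' (Lpoly q t div [:0,1:])"
    "\<exists>\<phi> \<in> hom (galois_group F' (Lpoly q t)) (SL2 k).
      inj_on \<phi> (carrier (galois_group F' (Lpoly q t))) \<and> \<phi> ` carrier (galois_group F' (Lpoly q t)) = \<psi> ` carrier H"
    using T.intermediate_field[OF full infE \<psi>] by blast
  then have "galois_group F' (Lpoly q t) \<cong> H" using iso_regular_model[OF model] \<psi> by metis
  moreover have "t \<in> F'" using F'(2) Ec(2) by blast
  ultimately show ?thesis
    unfolding occurs_over_rational_function_field_def
    using tt F'(1-4) unfolding E_def k_eq by blast
qed

end

theorem theorem7p3:
  fixes p n q :: nat and F :: "'c::alg_closed_field set" and b :: 'c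
  assumes "prime p" and "n > 0" and "q = p ^ n" and "CHAR('c) = p"
  shows "(is_subfield F \<and> Fq q \<subseteq> F \<and> b \<in> F \<and> irreducible_over F (Lpoly q b div [:0,1:]) \<longrightarrow>
           (let G = galois_group F (Lpoly q b) in
             (q \<notin> {2,3,5,7,11} \<longrightarrow> G \<cong> SL2 (Fq q :: 'c set)) \<and>
             (q = 2 \<longrightarrow> G \<cong> integer_mod_group 3 \<or> G \<cong> SL2 (Fq 2 :: 'c set)) \<and>
             (q = 3 \<longrightarrow> G \<cong> quaternion_group \<or> G \<cong> SL2 (Fq 3 :: 'c set)) \<and>
             (q = 5 \<longrightarrow> G \<cong> SL2 (UNIV :: 3 set) \<or> G \<cong> SL2 (Fq 5 :: 'c set)) \<and>
             (q = 7 \<longrightarrow> G \<cong> binary_octahedral_group \<or> G \<cong> SL2 (Fq 7 :: 'c set)) \<and>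
             (q = 11 \<longrightarrow> G \<cong> SL2 (UNIV :: 5 set) \<or> G \<cong> SL2 (Fq 11 :: 'c set))))
       \<and> ((\<exists>t::'c. transcendental_over (Fq q) t) \<longrightarrow>
             (q = 2 \<longrightarrow> occurs_over_rational_function_field 2 (integer_mod_group 3) TYPE('c)) \<and>
             (q = 3 \<longrightarrow> occurs_over_rational_function_field 3 quaternion_group TYPE('c)) \<and>
             (q = 5 \<longrightarrow> occurs_over_rational_function_field 5 (SL2 (UNIV :: 3 set)) TYPE('c)) \<and>
             (q = 7 \<longrightarrow> occurs_over_rational_function_field 7 binary_octahedral_group TYPE('c)) \<and>
             (q = 11 \<longrightarrow> occurs_over_rational_function_field 11 (SL2 (UNIV :: 5 set)) TYPE('c)))"
proof -
  interpret finite_subfield p n q "Fq q :: 'c set"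
    by unfold_locales (use assms in auto)
  have 1: "let G = galois_group F (Lpoly q b) in
             (q \<notin> {2,3,5,7,11} \<longrightarrow> G \<cong> SL2 (Fq q :: 'c set)) \<and>
             (q = 2 \<longrightarrow> G \<cong> integer_mod_group 3 \<or> G \<cong> SL2 (Fq 2 :: 'c set)) \<and>
             (q = 3 \<longrightarrow> G \<cong> quaternion_group \<or> G \<cong> SL2 (Fq 3 :: 'c set)) \<and>
             (q = 5 \<longrightarrow> G \<cong> SL2 (UNIV :: 3 set) \<or> G \<cong> SL2 (Fq 5 :: 'c set)) \<and>
             (q = 7 \<longrightarrow> G \<cong> binary_octahedral_group \<or> G \<cong> SL2 (Fq 7 :: 'c set)) \<and>
             (q = 11 \<longrightarrow> G \<cong> SL2 (UNIV :: 5 set) \<or> G \<cong> SL2 (Fq 11 :: 'c set))"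
    if "is_subfield F \<and> Fq q \<subseteq> F \<and> b \<in> F \<and> irreducible_over F (Lpoly q b div [:0,1:])"
  proof -
    from that have F: "is_subfield F" "Fq q \<subseteq> F" "b \<in> F" "irreducible_over F (Lpoly q b div [:0,1:])" by auto
    note model = galois_iso_model[OF F]
    show ?thesis
      unfolding Let_def
      using galois_cases[OF F] model[OF regular_model_cyclic] model[OF regular_model_quaternion] model[OF regular_model_SL2_3] model[OF regular_model_octahedral] model[OF regular_model_SL2_5]
      by metis
  qed
  have 2: "(q = 2 \<longrightarrow> occurs_over_rational_function_field 2 (integer_mod_group 3) TYPE('c)) \<and>
             (q = 3 \<longrightarrow> occurs_over_rational_function_field 3 quaternion_group TYPE('c)) \<and>
             (q = 5 \<longrightarrow> occurs_over_rational_function_field 5 (SL2 (UNIV :: 3 set)) TYPE('c)) \<and>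
             (q = 7 \<longrightarrow> occurs_over_rational_function_field 7 binary_octahedral_group TYPE('c)) \<and>
             (q = 11 \<longrightarrow> occurs_over_rational_function_field 11 (SL2 (UNIV :: 5 set)) TYPE('c))"
    if t: "\<exists>t::'c. transcendental_over (Fq q) t"
  proof -
    from t obtain u :: 'c where u: "transcendental_over (Fq q) u" by blast
    note occ = model_occurs[OF u]
    show ?thesis
    proof (intro conjI impI)
      assume q: "q = 2"
      show "occurs_over_rational_function_field 2 (integer_mod_group 3) TYPE('c)"
        using occ[OF regular_model_cyclic[OF q]] unfolding q .
    next
      assume q: "q = 3"
      show "occurs_over_rational_function_field 3 quaternion_group TYPE('c)"
        using occ[OF regular_model_quaternion[OF q]] unfolding q .
    next
      assume q: "q = 5"
      show "occurs_over_rational_function_field 5 (SL2 (UNIV :: 3 set)) TYPE('c)"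
        using occ[OF regular_model_SL2_3[OF q]] unfolding q .
    next
      assume q: "q = 7"
      show "occurs_over_rational_function_field 7 binary_octahedral_group TYPE('c)"
        using occ[OF regular_model_octahedral[OF q]] unfolding q .
    next
      assume q: "q = 11"
      show "occurs_over_rational_function_field 11 (SL2 (UNIV :: 5 set)) TYPE('c)"
        using occ[OF regular_model_SL2_5[OF q]] unfolding q .
    qed
  qed
  from 1 2 show ?thesis by blast
qed

end
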